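(* Let $W$ be a wavelet set and let $\tilde h_W:[0,1)\to[0,1)$ be the associated wavelet induced map. Then: (i) $\tilde h_W$ is a measurable bijection of $[0,1)$; (ii) there exist a measurable partition $\{A_k\}_{k\in\mathbb{Z}}$ of $[\frac12,1)$ and a measurable partition $\{B_k\}_{k\in\mathbb{Z}}$ of $[0,\frac12)$ such that $$\tilde h_W(x)=\begin{cases}\lfloor 2^kx\rfloor, & x\in A_k,\ k\in\mathbb{Z},\\ \lfloor 2^k(x-1)\rfloor, & x\in B_k,\ k\in\mathbb{Z},\end{cases}$$ where $\lfloor x\rfloor$ denotes the fractional part of the real number $x$ (not the integer part); (iii) if $h:[0,1)\to[0,1)$ is a map satisfying (i) and (ii) (in place of $\tilde h_W$), then there exists a wavelet set $W$ such that $h=\tilde h_W$; (iv) for any two wavelet sets $W_1$ and $W_2$, $$W_1\cap W_2=\delta_{|W_1}^{-1}\circ\xi^{-1}(\Omega)=\delta_{|W_2}^{-1}\circ\xi^{-1}(\Omega)\quad\text{a.e. }[\mu],$$ where $\Omega=\{x\in[0,1):\tilde h_{W_1}(x)=\tilde h_{W_2}(x)\}$.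
   Context: $\mu$ is Lebesgue measure on $\mathbb{R}$; "measurable" means Lebesgue measurable; members of a partition may be empty; the fractional part of $y\in\mathbb{R}$ is the unique element of $[0,1)\cap(y+\mathbb{Z})$. An orthonormal wavelet is $w\in L^2(\mathbb{R})$ such that $\{2^{j/2}w(2^j\cdot-k)\}_{j,k\in\mathbb{Z}}$ is an orthonormal basis of $L^2(\mathbb{R})$. With $\hat f(x)=\frac1{\sqrt{2\pi}}\int_{\mathbb{R}}e^{-itx}f(t)\,d\mu(t)$ (extended to $L^2(\mathbb{R})$), a measurable $W\subset\mathbb{R}$ is a wavelet set if $\frac1{\sqrt{\mu(W)}}\chi_W=\hat w$ for some orthonormal wavelet $w$. Let $E=[-2\pi,-\pi)\cup[\pi,2\pi)$; $\tau:\mathbb{R}\to E$, $\tau(x)=x+2j\pi$ with $j$ the unique integer such that $x+2j\pi\in E$; $\delta:\mathbb{R}\setminus\{0\}\to E$, $\delta(x)=2^kx$ with $k$ the unique integer such that $2^kx\in E$. It is a known fact that $W$ is a wavelet set if and only if there is a set $W'$ equal to $W$ a.e. such that $\tau_{|W'},\delta_{|W'}:W'\to E$ are measurable bijections; such $W'$ is called regularized. For a wavelet set $W$ (with regularized version $W'$) put $h_W=\tau_{|W'}\circ(\delta_{|W'})^{-1}:E\to E$ and $\tilde h_W=\xi\circ h_W\circ\xi^{-1}:[0,1)\to[0,1)$, where $\xi:E\to[0,1)$ is $\xi(x)=\frac{x}{2\pi}$ on $[\pi,2\pi)$ and $\xi(x)=\frac{x}{2\pi}+1$ on $[-2\pi,-\pi)$.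 Different choices of $W'$ change $h_W$ only on a null set. Throughout, a wavelet set is tacitly replaced by a regularized version when writing $\delta_{|W}^{-1}$ (the inverse of the bijection $\delta_{|W}:W\to E$) and $\tilde h_W$; "$=$ a.e." between sets means that the symmetric difference is $\mu$-null. *)

theory Defs
  imports "HOL-Analysis.Analysis"
begin

text \<open>Elements of \<open>L\<^sup>2(\<real>)\<close> are represented by functions; equality almost everywhere is not quotiented
  out. Squared distances take values in \<^typ>\<open>ennreal\<close>, so that they are infinite, rather than
  \<open>0\<close>, when the difference is not square-integrable.\<close>

definition L2 :: "(real \<Rightarrow> complex) set" where
  "L2 = {f \<in> borel_measurable lebesgue. integrable lebesgue (\<lambda>t. (cmod (f t))\<^sup>2)}"

definition L2_inner :: "(real \<Rightarrow> complex) \<Rightarrow> (real \<Rightarrow> complex) \<Rightarrow> complex" where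
  "L2_inner f g = (\<integral>t. f t * cnj (g t) \<partial>lebesgue)"

definition L2_sqdist :: "(real \<Rightarrow> complex) \<Rightarrow> (real \<Rightarrow> complex) \<Rightarrow> ennreal" where
  "L2_sqdist f g = (\<integral>\<^sup>+t. ennreal ((cmod (f t - g t))\<^sup>2) \<partial>lebesgue)"

text \<open>An orthonormal family whose finite linear combinations are dense in \<open>L\<^sup>2(\<real>)\<close>.\<close>

definition orthonormal_basis_L2 :: "('i \<Rightarrow> real \<Rightarrow> complex) \<Rightarrow> bool" where
  "orthonormal_basis_L2 u \<longleftrightarrow>
     (\<forall>i. u i \<in> L2) \<and>
     (\<forall>i i'. L2_inner (u i) (u i') = (if i = i' then 1 else 0)) \<and>
     (\<forall>f\<in>L2. \<forall>e>0. \<exists>I c. finite I \<and> L2_sqdist f (\<lambda>t. \<Sum>i\<in>I. c i * u i t) < e)"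

definition wavelet_family :: "(real \<Rightarrow> complex) \<Rightarrow> int \<times> int \<Rightarrow> real \<Rightarrow> complex" where
  "wavelet_family w = (\<lambda>(j, k) t. of_real (2 powr (of_int j / 2)) * w (2 powi j * t - of_int k))"

definition orthonormal_wavelet :: "(real \<Rightarrow> complex) \<Rightarrow> bool" where
  "orthonormal_wavelet w \<longleftrightarrow> w \<in> L2 \<and> orthonormal_basis_L2 (wavelet_family w)"

definition fourier :: "(real \<Rightarrow> complex) \<Rightarrow> real \<Rightarrow> complex" where
  "fourier f x = of_real (1 / sqrt (2 * pi)) * (\<integral>t. exp (- \<i> * of_real (t * x)) * f t \<partial>lebesgue)"

text \<open>The continuous extension of \<^const>\<open>fourier\<close> from \<open>L\<^sup>1 \<inter> L\<^sup>2\<close> to \<open>L\<^sup>2\<close>. It is a relation because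
  the transform is only determined up to null sets.\<close>

definition is_L2_fourier :: "(real \<Rightarrow> complex) \<Rightarrow> (real \<Rightarrow> complex) \<Rightarrow> bool" where
  "is_L2_fourier f g \<longleftrightarrow> f \<in> L2 \<and> g \<in> L2 \<and>
     (\<exists>s :: nat \<Rightarrow> real \<Rightarrow> complex.
        (\<forall>n. s n \<in> L2 \<and> integrable lebesgue (s n)) \<and>
        (\<lambda>n. L2_sqdist (s n) f) \<longlonglongrightarrow> 0 \<and>
        (\<lambda>n. L2_sqdist (fourier (s n)) g) \<longlonglongrightarrow> 0)"

text \<open>If \<open>W\<close> has infinite measure then \<open>measure lebesgue W = 0\<close>, so the function below is \<open>0\<close>; it is
  then not the transform of a wavelet, as it should be.\<close>

definition wavelet_set :: "real set \<Rightarrow> bool" where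
  "wavelet_set W \<longleftrightarrow> W \<in> sets lebesgue \<and>
     (\<exists>w. orthonormal_wavelet w \<and>
          is_L2_fourier w (\<lambda>x. of_real (1 / sqrt (measure lebesgue W) * indicator W x)))"

definition E :: "real set" where
  "E = {-2 * pi ..< -pi} \<union> {pi ..< 2 * pi}"

definition \<tau> :: "real \<Rightarrow> real" where
  "\<tau> x = x + 2 * of_int (THE j. x + 2 * of_int j * pi \<in> E) * pi"

text \<open>Only meaningful for nonzero arguments.\<close>

definition \<delta> :: "real \<Rightarrow> real" where
  "\<delta> x = 2 powi (THE k. 2 powi k * x \<in> E) * x"

definition ae_eq :: "real set \<Rightarrow> real set \<Rightarrow> bool" where
  "ae_eq A B \<longleftrightarrow> sym_diff A B \<in> null_sets lebesgue"

definition measurable_bij :: "(real \<Rightarrow> real) \<Rightarrow> real set \<Rightarrow> real set \<Rightarrow> bool" where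
  "measurable_bij f A B \<longleftrightarrow>
     A \<in> sets lebesgue \<and> f \<in> borel_measurable (lebesgue_on A) \<and> bij_betw f A B"

definition regularized_version :: "real set \<Rightarrow> real set \<Rightarrow> bool" where
  "regularized_version W W' \<longleftrightarrow>
     ae_eq W' W \<and> 0 \<notin> W' \<and> measurable_bij \<tau> W' E \<and> measurable_bij \<delta> W' E"

definition \<xi> :: "real \<Rightarrow> real" where
  "\<xi> x = (if x \<in> {pi ..< 2 * pi} then x / (2 * pi) else x / (2 * pi) + 1)"

text \<open>The following two maps are meant for regularized \<open>W\<close>, on the domains \<^const>\<open>E\<close> and \<open>[0,1)\<close>.\<close>

definition wavelet_map :: "real set \<Rightarrow> real \<Rightarrow> real" where
  "wavelet_map W = \<tau> \<circ> inv_into W \<delta>"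

definition wavelet_induced_map :: "real set \<Rightarrow> real \<Rightarrow> real" where
  "wavelet_induced_map W = \<xi> \<circ> wavelet_map W \<circ> inv_into E \<xi>"

definition measurable_partition :: "(int \<Rightarrow> real set) \<Rightarrow> real set \<Rightarrow> bool" where
  "measurable_partition A S \<longleftrightarrow>
     (\<forall>k. A k \<in> sets lebesgue) \<and> disjoint_family A \<and> (\<Union>k. A k) = S"

definition dyadic_form :: "(real \<Rightarrow> real) \<Rightarrow> bool" where
  "dyadic_form h \<longleftrightarrow>
     (\<exists>A B. measurable_partition A {1/2 ..< 1} \<and> measurable_partition B {0 ..< 1/2} \<and>
        (\<forall>k. \<forall>x\<in>A k. h x = frac (2 powi k * x)) \<and>
        (\<forall>k. \<forall>x\<in>B k. h x = frac (2 powi k * (x - 1))))"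

end

theory Submission
  imports Defs
begin

text \<open>The proposition is about sets that tile the line in two ways at once, and everything rests on one
equivalence: up to null sets, \<open>W\<close> is a wavelet set exactly when its translates by multiples of \<open>2\<pi>\<close>
and its dilates by powers of two both partition the line (\<open>exact_tiling\<close>).  The
regularized sets are the exact tilings (\<open>exact_tiling_iff\<close>).

The equivalence is proved in frequency.  Plancherel's identity turns the family
\<open>2\<^sup>j\<^sup>/\<^sup>2 w(2\<^sup>j t - k)\<close> into the modes \<open>exp(-i k y / 2\<^sup>j)\<close> cut off to \<open>2\<^sup>j W\<close>
(\<open>wavelet_set_iff_basis\<close>).  If \<open>W\<close> tiles, reduction modulo \<open>2\<pi>\<close> carries \<open>W\<close> onto a period and preserves
measure, so at each scale Parseval's identity for Fourier series shows that the modes exhaust the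
functions on \<open>2\<^sup>j W\<close>; the dilates partition the line, so the scales add up to all of \<open>L\<^sup>2\<close>
(\<open>exact_tiling_wavelet_set\<close>).  Conversely, orthogonality of different scales says that
the dilates of \<open>W\<close> are disjoint; completeness at scale 0 says that the translates are disjoint, because
no mode distinguishes two points of \<open>W\<close> that are congruent modulo \<open>2\<pi>\<close>; Parseval applied to the indicator
of \<open>W\<close>, whose Fourier coefficients of nonzero index all vanish, gives \<open>\<mu>(W)\<^sup>2 = 2\<pi> \<mu>(W)\<close>, so the translates
cover; and a set missed by all dilates has an indicator orthogonal to every mode.

Both identities come from one source.  Parseval's identity follows from the density of trigonometric
polynomials, that is, from the Stone-Weierstrass theorem on the circle.  For \<open>f\<close> supported in a period it
reads \<open>\<Sum>\<^sub>k |F(x + k)|\<^sup>2 = \<parallel>f\<parallel>\<^sup>2\<close> for every shift \<open>x\<close>, where \<open>F\<close> is the Fourier transform of \<open>f\<close>; integrating over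
\<open>x \<in> [0,1)\<close> gives Plancherel's identity (\<open>plancherel_period\<close>).

To regularize a wavelet set, the null set of bad points is enlarged to a null set invariant under
all affine maps \<open>x \<mapsto> p x + 2\<pi> q\<close> with rational \<open>p \<noteq> 0\<close> and \<open>q\<close>; on it, \<open>W\<close> is replaced by the exact tiling \<open>E\<close>
(\<open>wavelet_set_regularized\<close>).

The rest is bookkeeping with orbits.  A point \<open>x\<close> of \<open>[0,1)\<close> names, through \<open>\<xi>\<close>, a dyadic orbit; an exact
tiling \<open>W\<close> contains exactly one point \<open>2\<^sup>k \<xi>\<^sup>-\<^sup>1(x)\<close> of that orbit, and the induced map sends \<open>x\<close> to the
class of this point modulo \<open>2\<pi>\<close> (\<open>induced_map_eq\<close>).  Thus the level sets of the exponent \<open>k\<close> form the partitions of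
the two halves of \<open>[0,1)\<close>, and conversely any such choice of exponents defines a set \<open>W\<close>, on which \<open>\<delta>\<close> is a bijection by construction and \<open>\<tau>\<close>
is one because \<open>h\<close> is (\<open>dyadic_form_realized\<close>).  If two induced maps agree at \<open>x\<close>, the two chosen
points are congruent modulo \<open>2\<pi>\<close> and differ by a factor \<open>2\<^sup>m\<close>; they coincide unless they lie in a fixed
countable set.  So up to null sets the points of agreement are those of \<open>W1 \<inter> W2\<close>
(\<open>intersection_of_coincidence\<close>).\<close>

section \<open>Square-integrable functions\<close>

text \<open>Real-valued, hence meaningful on \<^const>\<open>L2\<close> only; there it agrees with \<^const>\<open>L2_sqdist\<close> to \<open>0\<close>.\<close>

definition L2_sqnorm :: "(real \<Rightarrow> complex) \<Rightarrow> real" where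
  "L2_sqnorm f = (\<integral>t. (cmod (f t))\<^sup>2 \<partial>lebesgue)"

lemma L2_integrable_sq: "f \<in> L2 \<Longrightarrow> integrable lebesgue (\<lambda>t. (cmod (f t))\<^sup>2)"
  by (simp add: L2_def)

lemma L2_sqnorm_nonneg [simp]: "0 \<le> L2_sqnorm f"
  by (simp add: L2_sqnorm_def)

lemma L2I:
  assumes "f \<in> borel_measurable lebesgue" "(\<integral>\<^sup>+t. ennreal ((cmod (f t))\<^sup>2) \<partial>lebesgue) < \<infinity>"
  shows "f \<in> L2"
  using assms by (auto simp: L2_def integrable_iff_bounded)

lemma L2_nn_integral: "f \<in> L2 \<Longrightarrow> (\<integral>\<^sup>+t. ennreal ((cmod (f t))\<^sup>2) \<partial>lebesgue) = ennreal (L2_sqnorm f)"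
  unfolding L2_sqnorm_def by (intro nn_integral_eq_integral L2_integrable_sq) auto

lemma cmod_add_sq_le: "(cmod (x + y))\<^sup>2 \<le> 2 * (cmod x)\<^sup>2 + 2 * (cmod y)\<^sup>2"
proof -
  have "(cmod (x + y))\<^sup>2 \<le> (cmod x + cmod y)\<^sup>2"
    by (intro power_mono norm_triangle_ineq) auto
  also have "\<dots> \<le> 2 * (cmod x)\<^sup>2 + 2 * (cmod y)\<^sup>2"
    using sum_squares_bound[of "cmod x" "cmod y"] by (simp add: power2_sum)
  finally show ?thesis .
qed

lemma L2_add: assumes "f \<in> L2" "g \<in> L2" shows "(\<lambda>t. f t + g t) \<in> L2"
proof -
  have [measurable]: "f \<in> borel_measurable lebesgue" "g \<in> borel_measurable lebesgue"
    using assms by (auto simp: L2_def)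
  have "integrable lebesgue (\<lambda>t. (cmod (f t + g t))\<^sup>2)"
    by (rule Bochner_Integration.integrable_bound
          [where f="\<lambda>t. 2 * (cmod (f t))\<^sup>2 + 2 * (cmod (g t))\<^sup>2"])
       (use assms in \<open>auto simp: L2_def cmod_add_sq_le\<close>)
  then show ?thesis by (simp add: L2_def)
qed

lemma L2_cmult: assumes "f \<in> L2" shows "(\<lambda>t. c * f t) \<in> L2"
  using assms by (auto simp: L2_def norm_mult power_mult_distrib)

lemma L2_zero [simp]: "(\<lambda>t. 0) \<in> L2"
  by (simp add: L2_def)

lemma L2_diff: assumes "f \<in> L2" "g \<in> L2" shows "(\<lambda>t. f t - g t) \<in> L2"
  using L2_add[OF assms(1) L2_cmult[OF assms(2), of "-1"]] by simp

lemma L2_sum: "(\<And>i. i \<in> I \<Longrightarrow> u i \<in> L2) \<Longrightarrow> (\<lambda>t. \<Sum>i\<in>I. u i t) \<in> L2"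
  by (induction I rule: infinite_finite_induct) (auto intro: L2_add)

lemma L2_bounded_mult:
  assumes "f \<in> L2" "m \<in> borel_measurable lebesgue" "\<And>t. cmod (m t) \<le> 1"
  shows "(\<lambda>t. m t * f t) \<in> L2"
proof -
  have "integrable lebesgue (\<lambda>t. (cmod (m t * f t))\<^sup>2)"
    by (rule Bochner_Integration.integrable_bound[OF L2_integrable_sq[OF assms(1)]])
       (use assms in \<open>auto simp: L2_def norm_mult power_mult_distrib abs_square_le_1
          intro!: mult_left_le_one_le power_le_one\<close>)
  then show ?thesis using assms by (auto simp: L2_def)
qed

lemma L2_mult_integrable: assumes "f \<in> L2" "g \<in> L2" shows "integrable lebesgue (\<lambda>t. f t * g t)"
proof -
  have [measurable]: "f \<in> borel_measurable lebesgue" "g \<in> borel_measurable lebesgue"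
    using assms by (auto simp: L2_def)
  have "cmod (f t) * cmod (g t) \<le> (cmod (f t))\<^sup>2 + (cmod (g t))\<^sup>2" for t
    using sum_squares_bound[of "cmod (f t)" "cmod (g t)"]
      mult_nonneg_nonneg[of "cmod (f t)" "cmod (g t)"] norm_ge_zero[of "f t"] norm_ge_zero[of "g t"]
    by linarith
  then have le: "norm (f t * g t) \<le> norm ((cmod (f t))\<^sup>2 + (cmod (g t))\<^sup>2)" for t
    unfolding norm_mult real_norm_def by (rule order_trans[OF _ abs_ge_self])
  have "integrable lebesgue (\<lambda>t. (cmod (f t))\<^sup>2 + (cmod (g t))\<^sup>2)"
    using assms by (intro Bochner_Integration.integrable_add L2_integrable_sq)
  then show ?thesis
    by (rule Bochner_Integration.integrable_bound) (measurable, rule always_eventually, use le in blast)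
qed

lemma borel_measurable_cnj [measurable]: "cnj \<in> borel_measurable borel"
  by (intro borel_measurable_continuous_onI continuous_intros)

lemma L2_cnj: "f \<in> L2 \<Longrightarrow> (\<lambda>t. cnj (f t)) \<in> L2"
  by (auto simp: L2_def)

lemma L2_inner_integrable: "f \<in> L2 \<Longrightarrow> g \<in> L2 \<Longrightarrow> integrable lebesgue (\<lambda>t. f t * cnj (g t))"
  using L2_mult_integrable[OF _ L2_cnj] .

lemma L2_inner_add_left:
  "f \<in> L2 \<Longrightarrow> g \<in> L2 \<Longrightarrow> h \<in> L2 \<Longrightarrow> L2_inner (\<lambda>t. f t + g t) h = L2_inner f h + L2_inner g h"
  by (simp add: L2_inner_def ring_distribs L2_inner_integrable)

lemma L2_inner_diff_left:
  "f \<in> L2 \<Longrightarrow> g \<in> L2 \<Longrightarrow> h \<in> L2 \<Longrightarrow> L2_inner (\<lambda>t. f t - g t) h = L2_inner f h - L2_inner g h"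
  by (simp add: L2_inner_def ring_distribs L2_inner_integrable)

lemma L2_inner_cmult_left: "L2_inner (\<lambda>t. c * f t) g = c * L2_inner f g"
  by (simp add: L2_inner_def mult.assoc)

lemma L2_inner_cmult_right: "L2_inner f (\<lambda>t. c * g t) = cnj c * L2_inner f g"
  by (simp add: L2_inner_def mult.left_commute)

lemma L2_inner_sum_left:
  assumes "\<And>i. i \<in> I \<Longrightarrow> u i \<in> L2" "h \<in> L2"
  shows "L2_inner (\<lambda>t. \<Sum>i\<in>I. u i t) h = (\<Sum>i\<in>I. L2_inner (u i) h)"
  using assms
proof (induction I rule: infinite_finite_induct)
  case (insert i I)
  then show ?case by (simp add: L2_inner_add_left L2_sum)
qed (auto simp: L2_inner_def)

lemma L2_inner_self: "L2_inner f f = of_real (L2_sqnorm f)"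
  by (simp add: L2_inner_def L2_sqnorm_def complex_norm_square[symmetric] del: of_real_power flip: integral_complex_of_real)

lemma L2_sqnorm_diff:
  assumes "f \<in> L2" "g \<in> L2"
  shows "L2_sqnorm (\<lambda>t. f t - g t) = L2_sqnorm f + L2_sqnorm g - 2 * Re (L2_inner f g)"
proof -
  have *: "(cmod (f t - g t))\<^sup>2 = (cmod (f t))\<^sup>2 + (cmod (g t))\<^sup>2 - 2 * Re (f t * cnj (g t))" for t
    unfolding cmod_power2 by (simp add: power2_eq_square algebra_simps)
  note i = L2_inner_integrable[OF assms]
  show ?thesis
    unfolding L2_sqnorm_def L2_inner_def * integral_Re[OF i, symmetric]
    using assms integrable_Re[OF i] by (simp add: L2_integrable_sq del: times_complex.sel complex_cnj)
qed

lemma L2_sqnorm_cmult: "L2_sqnorm (\<lambda>t. c * f t) = (cmod c)\<^sup>2 * L2_sqnorm f"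
  by (simp add: L2_sqnorm_def norm_mult power_mult_distrib)

lemma L2_sqdist_eq: "f \<in> L2 \<Longrightarrow> g \<in> L2 \<Longrightarrow> L2_sqdist f g = ennreal (L2_sqnorm (\<lambda>t. f t - g t))"
  unfolding L2_sqdist_def by (rule L2_nn_integral) (rule L2_diff)

text \<open>Squared distances obey the triangle inequality up to a factor 2, which is all that density
arguments require, and no square roots of \<^typ>\<open>ennreal\<close> values arise.\<close>

lemma L2_sqdist_triangle:
  assumes "f \<in> L2" "g \<in> L2" "h \<in> L2"
  shows "L2_sqdist f h \<le> 2 * L2_sqdist f g + 2 * L2_sqdist g h"
proof -
  have [measurable]: "f \<in> borel_measurable lebesgue" "g \<in> borel_measurable lebesgue"
      "h \<in> borel_measurable lebesgue"
    using assms by (auto simp: L2_def)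
  have "L2_sqdist f h \<le> (\<integral>\<^sup>+t. 2 * ennreal ((cmod (f t - g t))\<^sup>2) + 2 * ennreal ((cmod (g t - h t))\<^sup>2) \<partial>lebesgue)"
    unfolding L2_sqdist_def
  proof (rule nn_integral_mono)
    fix t
    have "ennreal ((cmod (f t - h t))\<^sup>2) \<le> ennreal (2 * (cmod (f t - g t))\<^sup>2 + 2 * (cmod (g t - h t))\<^sup>2)"
      using cmod_add_sq_le[of "f t - g t" "g t - h t"] by (intro ennreal_leI) simp
    also have "\<dots> = 2 * ennreal ((cmod (f t - g t))\<^sup>2) + 2 * ennreal ((cmod (g t - h t))\<^sup>2)"
      by (simp add: ennreal_plus ennreal_mult)
    finally show "ennreal ((cmod (f t - h t))\<^sup>2) \<le> \<dots>" .
  qed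
  also have "\<dots> = 2 * L2_sqdist f g + 2 * L2_sqdist g h"
    unfolding L2_sqdist_def by (simp add: nn_integral_add nn_integral_cmult)
  finally show ?thesis .
qed

lemma L2_sqdist_commute: "L2_sqdist f g = L2_sqdist g f"
  by (simp add: L2_sqdist_def norm_minus_commute)

lemma L2_sqdist_eq_0_AE:
  assumes "f \<in> L2" "g \<in> L2" "L2_sqdist f g = 0"
  shows "AE t in lebesgue. f t = g t"
proof -
  have [measurable]: "f \<in> borel_measurable lebesgue" "g \<in> borel_measurable lebesgue"
    using assms by (auto simp: L2_def)
  have "AE t in lebesgue. ennreal ((cmod (f t - g t))\<^sup>2) = 0"
    using assms(3) unfolding L2_sqdist_def by (subst (asm) nn_integral_0_iff_AE) auto
  then show ?thesis by eventually_elim simp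
qed

lemma L2_sqdist_cong_AE:
  assumes "AE t in lebesgue. f t = f' t" "AE t in lebesgue. g t = g' t"
  shows "L2_sqdist f g = L2_sqdist f' g'"
  unfolding L2_sqdist_def by (rule nn_integral_cong_AE) (use assms in eventually_elim, simp)

lemma L2_inner_cong_AE:
  assumes "AE t in lebesgue. f t = f' t" "AE t in lebesgue. g t = g' t"
    "f \<in> L2" "g \<in> L2" "f' \<in> L2" "g' \<in> L2"
  shows "L2_inner f g = L2_inner f' g'"
  unfolding L2_inner_def
proof (rule integral_cong_AE)
  show "AE t in lebesgue. f t * cnj (g t) = f' t * cnj (g' t)"
    using assms(1,2) by eventually_elim simp
qed (intro borel_measurable_integrable L2_inner_integrable assms)+

definition orthonormal_L2 :: "('i \<Rightarrow> real \<Rightarrow> complex) \<Rightarrow> bool" where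
  "orthonormal_L2 u \<longleftrightarrow> (\<forall>i. u i \<in> L2) \<and>
     (\<forall>i i'. L2_inner (u i) (u i') = (if i = i' then 1 else 0))"

text \<open>One identity that contains Bessel's inequality (take the \<open>a i\<close> to be the Fourier coefficients)
and the best approximation property (the last sum is nonnegative).\<close>

lemma sqnorm_diff_orthonormal_sum:
  assumes u: "orthonormal_L2 u" and f: "f \<in> L2" and "finite I"
  shows "L2_sqnorm (\<lambda>t. f t - (\<Sum>i\<in>I. a i * u i t)) =
    L2_sqnorm f - (\<Sum>i\<in>I. (cmod (L2_inner f (u i)))\<^sup>2) + (\<Sum>i\<in>I. (cmod (a i - L2_inner f (u i)))\<^sup>2)"
  using \<open>finite I\<close>
proof (induction I rule: finite_induct)
  case (insert j I)
  have uL: "u i \<in> L2" for i using u by (auto simp: orthonormal_L2_def)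
  have on: "L2_inner (u i) (u i') = (if i = i' then 1 else 0)" for i i'
    using u by (auto simp: orthonormal_L2_def)
  let ?F = "\<lambda>t. f t - (\<Sum>i\<in>I. a i * u i t)"
  have F: "?F \<in> L2" by (intro L2_diff f L2_sum L2_cmult uL)
  have "L2_inner ?F (u j) = L2_inner f (u j) - (\<Sum>i\<in>I. L2_inner (\<lambda>t. a i * u i t) (u j))"
    by (subst L2_inner_diff_left)
       (auto intro!: f L2_sum L2_cmult uL L2_inner_sum_left[of I "\<lambda>i t. a i * u i t"])
  also have "(\<Sum>i\<in>I. L2_inner (\<lambda>t. a i * u i t) (u j)) = 0"
    using insert by (intro sum.neutral) (auto simp: L2_inner_cmult_left on)
  finally have inn: "L2_inner ?F (u j) = L2_inner f (u j)" by simp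
  have nj: "L2_sqnorm (u j) = 1" using on[of j j] unfolding L2_inner_self by simp
  have "L2_sqnorm (\<lambda>t. f t - (\<Sum>i\<in>insert j I. a i * u i t)) = L2_sqnorm (\<lambda>t. ?F t - a j * u j t)"
    using insert by (simp add: algebra_simps)
  also have "\<dots> = L2_sqnorm ?F + (cmod (a j))\<^sup>2 - 2 * Re (cnj (a j) * L2_inner f (u j))"
    by (subst L2_sqnorm_diff[OF F L2_cmult[OF uL]]) (simp add: L2_sqnorm_cmult nj L2_inner_cmult_right inn)
  moreover have "(cmod (a j))\<^sup>2 - 2 * Re (cnj (a j) * L2_inner f (u j)) =
      (cmod (a j - L2_inner f (u j)))\<^sup>2 - (cmod (L2_inner f (u j)))\<^sup>2"
    unfolding cmod_power2 by (simp add: power2_eq_square algebra_simps)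
  ultimately show ?case using insert by simp
qed simp

lemma sum_le_nn_integral_count_space:
  fixes f :: "'i \<Rightarrow> ennreal"
  assumes "finite I"
  shows "(\<Sum>i\<in>I. f i) \<le> (\<integral>\<^sup>+i. f i \<partial>count_space UNIV)"
proof -
  have "(\<Sum>i\<in>I. f i) = (\<integral>\<^sup>+i. f i \<partial>count_space I)"
    using assms by (simp add: nn_integral_count_space_finite)
  also have "\<dots> = (\<integral>\<^sup>+i. f i * indicator I i \<partial>count_space UNIV)"
    by (simp add: nn_integral_count_space_indicator)
  also have "\<dots> \<le> (\<integral>\<^sup>+i. f i \<partial>count_space UNIV)"
    by (intro nn_integral_mono) (auto simp: indicator_def)
  finally show ?thesis .
qed

text \<open>An unordered sum of nonnegative terms is the supremum of its finite partial sums; enumerating the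
index type reduces this to monotone convergence.\<close>

lemma nn_integral_count_space_le:
  fixes f :: "'i::countable \<Rightarrow> ennreal"
  assumes "\<And>I. finite I \<Longrightarrow> (\<Sum>i\<in>I. f i) \<le> c"
  shows "(\<integral>\<^sup>+i. f i \<partial>count_space UNIV) \<le> c"
proof -
  define I where "I n = {i::'i. to_nat i \<le> n}" for n
  have fin: "finite (I n)" for n
    unfolding I_def using finite_vimageI[of "{..n}" "to_nat :: 'i \<Rightarrow> nat"] by (simp add: vimage_def)
  have "f = (\<lambda>i. SUP n. f i * indicator (I n) i)"
  proof
    fix i
    have "(SUP n. f i * indicator (I n) i) \<le> f i"
      by (intro SUP_least) (auto simp: indicator_def)
    moreover have "f i \<le> (SUP n. f i * indicator (I n) i)"
      by (intro SUP_upper2[of "to_nat i"]) (auto simp: I_def)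
    ultimately show "f i = (SUP n. f i * indicator (I n) i)" by (rule antisym[rotated])
  qed
  then have "(\<integral>\<^sup>+i. f i \<partial>count_space UNIV) = (\<integral>\<^sup>+i. (SUP n. f i * indicator (I n) i) \<partial>count_space UNIV)"
    by (rule arg_cong)
  also have "\<dots> = (SUP n. \<integral>\<^sup>+i. f i * indicator (I n) i \<partial>count_space UNIV)"
    by (intro nn_integral_monotone_convergence_SUP)
       (auto simp: incseq_def le_fun_def I_def indicator_def)
  also have "\<dots> = (SUP n. \<Sum>i\<in>I n. f i)"
    by (simp add: nn_integral_count_space_finite fin flip: nn_integral_count_space_indicator)
  also have "\<dots> \<le> c" by (intro SUP_least assms fin)
  finally show ?thesis .
qed

lemma ennreal_pos_real_below:
  assumes "0 < (e :: ennreal)" obtains d where "0 < d" "ennreal d \<le> e"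
proof (cases "e = top")
  case False
  then show ?thesis using assms that[of "enn2real e"] by (auto simp: enn2real_positive_iff less_top)
qed (use that[of 1] in auto)

text \<open>Together with \<open>approx_of_parseval\<close> below: for an orthonormal family, being approximable by finite
combinations and satisfying Parseval's identity are the same.  Approximability is the
definition of a basis, whereas Parseval's identity can be summed and integrated over parameters.\<close>

lemma parseval_of_approx:
  fixes u :: "'i::countable \<Rightarrow> real \<Rightarrow> complex"
  assumes u: "orthonormal_L2 u" and f: "f \<in> L2"
    and approx: "\<And>e. 0 < e \<Longrightarrow> \<exists>I c. finite I \<and> L2_sqdist f (\<lambda>t. \<Sum>i\<in>I. c i * u i t) < e"
  shows "(\<integral>\<^sup>+i. ennreal ((cmod (L2_inner f (u i)))\<^sup>2) \<partial>count_space UNIV) = ennreal (L2_sqnorm f)"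
proof (rule antisym)
  have uL: "u i \<in> L2" for i using u by (auto simp: orthonormal_L2_def)
  show "(\<integral>\<^sup>+i. ennreal ((cmod (L2_inner f (u i)))\<^sup>2) \<partial>count_space UNIV) \<le> ennreal (L2_sqnorm f)"
  proof (rule nn_integral_count_space_le)
    fix I :: "'i set" assume "finite I"
    from sqnorm_diff_orthonormal_sum[OF u f this, of "\<lambda>i. L2_inner f (u i)"]
    have "(\<Sum>i\<in>I. (cmod (L2_inner f (u i)))\<^sup>2) \<le> L2_sqnorm f"
      using L2_sqnorm_nonneg[of "\<lambda>t. f t - (\<Sum>i\<in>I. L2_inner f (u i) * u i t)"] by simp
    then show "(\<Sum>i\<in>I. ennreal ((cmod (L2_inner f (u i)))\<^sup>2)) \<le> ennreal (L2_sqnorm f)"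
      by (simp add: sum_ennreal ennreal_leI)
  qed
  show "ennreal (L2_sqnorm f) \<le> (\<integral>\<^sup>+i. ennreal ((cmod (L2_inner f (u i)))\<^sup>2) \<partial>count_space UNIV)"
  proof (rule ennreal_le_epsilon)
    fix e :: real assume "0 < e"
    then obtain I c where I: "finite I" and d: "L2_sqdist f (\<lambda>t. \<Sum>i\<in>I. c i * u i t) < ennreal e"
      using approx[of "ennreal e"] by auto
    have "L2_sqnorm (\<lambda>t. f t - (\<Sum>i\<in>I. c i * u i t)) < e"
      using d by (subst (asm) L2_sqdist_eq) (auto intro!: f L2_sum L2_cmult uL simp: ennreal_less_iff)
    then have "L2_sqnorm f \<le> (\<Sum>i\<in>I. (cmod (L2_inner f (u i)))\<^sup>2) + e"
      unfolding sqnorm_diff_orthonormal_sum[OF u f I]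
      using sum_nonneg[of I "\<lambda>i. (cmod (c i - L2_inner f (u i)))\<^sup>2"] by simp
    then have "ennreal (L2_sqnorm f) \<le> (\<Sum>i\<in>I. ennreal ((cmod (L2_inner f (u i)))\<^sup>2)) + ennreal e"
      using \<open>0 < e\<close> by (simp add: sum_ennreal sum_nonneg ennreal_leI flip: ennreal_plus)
    also have "\<dots> \<le> (\<integral>\<^sup>+i. ennreal ((cmod (L2_inner f (u i)))\<^sup>2) \<partial>count_space UNIV) + ennreal e"
      by (intro add_right_mono sum_le_nn_integral_count_space I)
    finally show "ennreal (L2_sqnorm f) \<le> \<dots>" .
  qed
qed

lemma approx_of_parseval:
  fixes u :: "'i::countable \<Rightarrow> real \<Rightarrow> complex"
  assumes u: "orthonormal_L2 u" and f: "f \<in> L2" and e: "0 < e"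
    and parseval: "ennreal (L2_sqnorm f) \<le> (\<integral>\<^sup>+i. ennreal ((cmod (L2_inner f (u i)))\<^sup>2) \<partial>count_space UNIV)"
  shows "\<exists>I c. finite I \<and> L2_sqdist f (\<lambda>t. \<Sum>i\<in>I. c i * u i t) < e"
proof (rule ccontr)
  assume no: "\<not> ?thesis"
  have uL: "u i \<in> L2" for i using u by (auto simp: orthonormal_L2_def)
  let ?c = "\<lambda>i. L2_inner f (u i)"
  obtain d where d: "0 < d" "ennreal d \<le> e" by (rule ennreal_pos_real_below[OF e])
  have le: "(\<Sum>i\<in>I. (cmod (?c i))\<^sup>2) \<le> L2_sqnorm f - d" if I: "finite I" for I
  proof -
    have "\<not> L2_sqdist f (\<lambda>t. \<Sum>i\<in>I. ?c i * u i t) < ennreal d"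
    proof
      assume "L2_sqdist f (\<lambda>t. \<Sum>i\<in>I. ?c i * u i t) < ennreal d"
      then have "L2_sqdist f (\<lambda>t. \<Sum>i\<in>I. ?c i * u i t) < e" using d(2) by (rule less_le_trans)
      with no I show False by (simp add: not_ex)
    qed
    then have "d \<le> L2_sqnorm (\<lambda>t. f t - (\<Sum>i\<in>I. ?c i * u i t))"
      by (subst (asm) L2_sqdist_eq) (auto intro!: f L2_sum L2_cmult uL simp: ennreal_less_iff not_less)
    then show ?thesis unfolding sqnorm_diff_orthonormal_sum[OF u f I] by simp
  qed
  have pos: "0 \<le> L2_sqnorm f - d" using le[of "{}"] by simp
  have "(\<integral>\<^sup>+i. ennreal ((cmod (?c i))\<^sup>2) \<partial>count_space UNIV) \<le> ennreal (L2_sqnorm f - d)"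
    by (rule nn_integral_count_space_le) (simp add: sum_ennreal ennreal_leI le)
  with parseval have "ennreal (L2_sqnorm f) \<le> ennreal (L2_sqnorm f - d)" by (rule order_trans)
  then show False using d pos by (simp add: ennreal_le_iff)
qed

section \<open>Fourier series\<close>

lemma L2_dominated_convergence:
  fixes f :: "real \<Rightarrow> complex" and s :: "nat \<Rightarrow> real \<Rightarrow> complex" and G :: "real \<Rightarrow> real"
  assumes [measurable]: "\<And>n. s n \<in> borel_measurable lebesgue" "f \<in> borel_measurable lebesgue"
    and G: "integrable lebesgue (\<lambda>t. (G t)\<^sup>2)"
    and bound: "\<And>n t. cmod (s n t) \<le> G t" "\<And>t. cmod (f t) \<le> G t"
    and lim: "AE t in lebesgue. (\<lambda>n. s n t) \<longlonglongrightarrow> f t"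
  shows "(\<lambda>n. L2_sqdist (s n) f) \<longlonglongrightarrow> 0"
proof -
  have "(\<lambda>n. \<integral>\<^sup>+t. ennreal ((cmod (s n t - f t))\<^sup>2) \<partial>lebesgue) \<longlonglongrightarrow> (\<integral>\<^sup>+t. 0 \<partial>(lebesgue :: real measure))"
  proof (rule nn_integral_dominated_convergence[where w="\<lambda>t. ennreal (4 * (G t)\<^sup>2)"])
    have [measurable]: "(\<lambda>t. (G t)\<^sup>2) \<in> borel_measurable lebesgue" using G by simp
    show "(\<lambda>t. ennreal (4 * (G t)\<^sup>2)) \<in> borel_measurable lebesgue" by measurable
    have "integrable lebesgue (\<lambda>t. 4 * (G t)\<^sup>2)" using G by simp
    then show "(\<integral>\<^sup>+t. ennreal (4 * (G t)\<^sup>2) \<partial>lebesgue) < \<infinity>"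
      by (simp add: nn_integral_eq_integral)
    show "AE t in lebesgue. ennreal ((cmod (s n t - f t))\<^sup>2) \<le> ennreal (4 * (G t)\<^sup>2)" for n
    proof (intro always_eventually allI ennreal_leI)
      fix t
      have "cmod (s n t - f t) \<le> 2 * G t"
        using norm_triangle_ineq4[of "s n t" "f t"] bound(1)[of n t] bound(2)[of t] by simp
      then have "(cmod (s n t - f t))\<^sup>2 \<le> (2 * G t)\<^sup>2" by (intro power_mono) auto
      then show "(cmod (s n t - f t))\<^sup>2 \<le> 4 * (G t)\<^sup>2" by (simp add: power_mult_distrib)
    qed
    show "AE t in lebesgue. (\<lambda>n. ennreal ((cmod (s n t - f t))\<^sup>2)) \<longlonglongrightarrow> 0"
      using lim
    proof eventually_elim
      case (elim t)
      then have "(\<lambda>n. (cmod (s n t - f t))\<^sup>2) \<longlonglongrightarrow> (cmod (f t - f t))\<^sup>2"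
        by (intro tendsto_intros)
      then have "(\<lambda>n. ennreal ((cmod (s n t - f t))\<^sup>2)) \<longlonglongrightarrow> ennreal ((cmod (f t - f t))\<^sup>2)"
        by (rule tendsto_ennrealI)
      then show ?case by simp
    qed
  qed auto
  then show ?thesis unfolding L2_sqdist_def by simp
qed

text \<open>Generated from single modes, so that closure under products is an induction and no index sets have
to be reorganized; \<open>trig_poly_sum_form\<close> recovers the sum.\<close>

inductive trig_poly :: "(real \<Rightarrow> complex) \<Rightarrow> bool" where
  mode: "trig_poly (\<lambda>t. c * cis (of_int k * t))"
| add: "trig_poly p \<Longrightarrow> trig_poly q \<Longrightarrow> trig_poly (\<lambda>t. p t + q t)"

lemma trig_poly_const: "trig_poly (\<lambda>t. c)"
  using trig_poly.mode[of c 0] by simp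

lemma trig_poly_mult:
  assumes "trig_poly p" "trig_poly q"
  shows "trig_poly (\<lambda>t. p t * q t)"
  using assms(1)
proof induction
  case (mode c k)
  from assms(2) show ?case
  proof induction
    case (mode d l)
    have "c * cis (of_int k * t) * (d * cis (of_int l * t)) = (c * d) * cis (of_int (k + l) * t)" for t
      by (simp add: cis_mult[symmetric] algebra_simps)
    then show ?case using trig_poly.mode[of "c * d" "k + l"] by (simp only:)
  qed (simp add: distrib_left trig_poly.add)
qed (simp add: distrib_right trig_poly.add)

lemma trig_poly_sum_form:
  assumes "trig_poly p"
  shows "\<exists>I c. finite (I :: int set) \<and> p = (\<lambda>t. \<Sum>k\<in>I. c k * cis (of_int k * t))"
  using assms
proof induction
  case (mode c k)
  show ?case by (intro exI[of _ "{k}"] exI[of _ "\<lambda>_. c"]) simp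
next
  case (add p q)
  then obtain I c J d where I: "finite I" "p = (\<lambda>t. \<Sum>k\<in>I. c k * cis (of_int k * t))"
    and J: "finite J" "q = (\<lambda>t. \<Sum>k\<in>J. d k * cis (of_int k * t))" by blast
  define a where "a k = (if k \<in> I then c k else 0) + (if k \<in> J then d k else 0)" for k
  have "(\<Sum>k\<in>I \<union> J. a k * cis (of_int k * t)) = p t + q t" for t
  proof -
    have "(\<Sum>k\<in>I \<union> J. a k * cis (of_int k * t)) =
        (\<Sum>k\<in>I \<union> J. if k \<in> I then c k * cis (of_int k * t) else 0) +
        (\<Sum>k\<in>I \<union> J. if k \<in> J then d k * cis (of_int k * t) else 0)"
      unfolding a_def sum.distrib[symmetric] by (intro sum.cong) (auto simp: ring_distribs)
    also have "\<dots> = p t + q t"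
      using I J by (simp add: sum.If_cases Int_absorb1 Int_absorb2 Un_Int_eq Int_commute)
    finally show ?thesis .
  qed
  then show ?case using I(1) J(1)
    by (intro exI[of _ "I \<union> J"] exI[of _ a]) auto
qed

text \<open>On the unit circle the coordinates are \<open>cos t\<close> and \<open>sin t\<close>, combinations of \<open>cis t\<close> and
\<open>cis (-t)\<close>; hence every polynomial in the coordinates is a trigonometric polynomial.\<close>

lemma trig_poly_real_polynomial:
  assumes "real_polynomial_function g"
  shows "trig_poly (\<lambda>t. of_real (g (cis t)))"
  using assms
proof induction
  case (linear f)
  interpret bounded_linear f by fact
  let ?a = "complex_of_real (f 1)" and ?b = "complex_of_real (f \<i>)"
  have "complex_of_real (f (cis t)) =
      (?a / 2 - \<i> * ?b / 2) * cis (of_int 1 * t) + (?a / 2 + \<i> * ?b / 2) * cis (of_int (-1) * t)" for t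
  proof -
    have "f (cis t) = f (cos t *\<^sub>R 1 + sin t *\<^sub>R \<i>)"
      by (rule arg_cong[of _ _ f]) (simp add: complex_eq_iff)
    also have "\<dots> = cos t * f 1 + sin t * f \<i>" by (simp add: add scaleR)
    finally show ?thesis by (simp add: complex_eq_iff algebra_simps)
  qed
  then show ?case by (simp only:) (intro trig_poly.intros)
next
  case (mult f g)
  then show ?case by (simp add: trig_poly_mult)
qed (simp_all add: trig_poly_const trig_poly.add)

text \<open>Equality of the end values lets \<open>h\<close> descend to a continuous function on the unit circle, where the
Stone-Weierstrass theorem applies.\<close>

lemma trig_poly_uniform_approx:
  fixes h :: "real \<Rightarrow> complex"
  assumes cont: "continuous_on {0..2*pi} h" and per: "h 0 = h (2*pi)" and e: "0 < e"
  shows "\<exists>p. trig_poly p \<and> (\<forall>t\<in>{0..2*pi}. cmod (h t - p t) < e)"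
proof -
  \<comment> \<open>As \<open>h\<close> is a loop after rescaling, the theorem on loops as circle maps gives the continuity of \<open>H\<close> also at the
      point 1, where \<open>Arg2pi\<close> jumps.\<close>
  define H where "H = (\<lambda>s. h (2 * pi * s)) \<circ> (\<lambda>z. Arg2pi z / (2 * pi))"
  have "continuous_on {0..1} (\<lambda>s. h (2 * pi * s))"
    by (rule continuous_on_compose2[OF cont]) (auto intro!: continuous_intros simp: mult_le_cancel_left1)
  then have "homotopic_loops UNIV (\<lambda>s. h (2 * pi * s)) (\<lambda>s. h (2 * pi * s))"
    using per by (simp add: homotopic_loops_refl path_def pathfinish_def pathstart_def)
  from homotopic_with_imp_continuous[OF homotopic_loops_imp_homotopic_circlemaps[OF this]]
  have H: "continuous_on (sphere 0 1) H" by (simp add: H_def)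
  have Hcis: "H (cis t) = h t" if "t \<in> {0..2*pi}" for t
  proof (cases "t = 2 * pi")
    case True
    then show ?thesis using per by (simp add: H_def Arg2pi_of_real[of 1, simplified])
  next
    case False
    then have "Arg2pi (cis t) = t"
      using that by (intro Arg2pi_unique[of 1]) (auto simp: cis_conv_exp)
    then show ?thesis by (simp add: H_def)
  qed
  obtain g1 where g1: "real_polynomial_function g1" "\<And>z. z \<in> sphere 0 1 \<Longrightarrow> \<bar>Re (H z) - g1 z\<bar> < e / 2"
    using Stone_Weierstrass_real_polynomial_function[of "sphere 0 1" "\<lambda>z. Re (H z)" "e / 2"] H e
    by (auto intro!: continuous_intros)
  obtain g2 where g2: "real_polynomial_function g2" "\<And>z. z \<in> sphere 0 1 \<Longrightarrow> \<bar>Im (H z) - g2 z\<bar> < e / 2"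
    using Stone_Weierstrass_real_polynomial_function[of "sphere 0 1" "\<lambda>z. Im (H z)" "e / 2"] H e
    by (auto intro!: continuous_intros)
  let ?p = "\<lambda>t. of_real (g1 (cis t)) + \<i> * of_real (g2 (cis t))"
  have "trig_poly ?p"
    by (intro trig_poly.add trig_poly_mult trig_poly_const trig_poly_real_polynomial g1 g2)
  moreover have "cmod (h t - ?p t) < e" if t: "t \<in> {0..2*pi}" for t
  proof -
    have "cmod (h t - ?p t) \<le> \<bar>Re (h t - ?p t)\<bar> + \<bar>Im (h t - ?p t)\<bar>" by (rule cmod_le)
    also have "\<dots> < e / 2 + e / 2"
      using g1(2)[of "cis t"] g2(2)[of "cis t"] Hcis[OF t] by (intro add_strict_mono) auto
    finally show ?thesis by simp
  qed
  ultimately show ?thesis by blast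
qed

text \<open>The normalized exponentials on one period, extended by zero to elements of \<^const>\<open>L2\<close>.\<close>

definition fourier_mode :: "int \<Rightarrow> real \<Rightarrow> complex" where
  "fourier_mode k t = of_real (indicator {0..<2*pi} t / sqrt (2 * pi)) * cis (of_int k * t)"

lemma L2_indicator_bounded:
  assumes "S \<in> lmeasurable" "m \<in> borel_measurable lebesgue" "\<And>t. cmod (m t) \<le> B"
  shows "(\<lambda>t. indicator S t * m t) \<in> L2"
proof -
  have [measurable]: "S \<in> sets lebesgue" "m \<in> borel_measurable lebesgue" using assms by auto
  have "integrable lebesgue (\<lambda>t. B\<^sup>2 * indicator S t)"
    using assms by (auto simp: fmeasurable_def)
  then have "integrable lebesgue (\<lambda>t. (cmod (indicator S t * m t))\<^sup>2)"
    by (rule Bochner_Integration.integrable_bound)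
       (measurable, auto simp: indicator_def assms(3) intro!: always_eventually power_mono)
  then show ?thesis by (simp add: L2_def)
qed

lemma borel_measurable_cis [measurable]: "cis \<in> borel_measurable borel"
  by (intro borel_measurable_continuous_onI continuous_intros)

lemma borel_measurable_lebesgue_cis [measurable]: "(\<lambda>t. cis (a * t)) \<in> borel_measurable lebesgue"
  by (rule measurable_completion) measurable

lemma lmeasurable_Ico [simp]: "{a..<b::real} \<in> lmeasurable"
  by (rule bounded_set_imp_lmeasurable) auto

lemma fourier_mode_L2: "fourier_mode k \<in> L2"
proof -
  have "(\<lambda>t. indicator {0..<2*pi} t * (cis (of_int k * t) / of_real (sqrt (2*pi)))) \<in> L2"
    by (rule L2_indicator_bounded[where B="1 / sqrt (2*pi)"]) (auto simp: norm_divide)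
  moreover have "fourier_mode k =
      (\<lambda>t. indicator {0..<2*pi} t * (cis (of_int k * t) / of_real (sqrt (2*pi))))"
    by (rule ext) (simp add: fourier_mode_def indicator_def)
  ultimately show ?thesis by simp
qed

lemma integral_period_cis:
  "(\<integral>t. indicator {0..<2*pi} t * cis (of_int m * t) \<partial>lebesgue) = (if m = 0 then 2 * of_real pi else 0)"
proof -
  have "(\<integral>t. indicator {0..<2*pi} t * cis (of_int m * t) \<partial>lebesgue) =
      (\<integral>t. indicator {0..2*pi} t *\<^sub>R cis (of_int m * t) \<partial>lebesgue)"
  proof (rule integral_cong_AE)
    have "AE t in lebesgue. t \<noteq> 2 * pi"
      by (rule AE_I[where N="{2*pi}"]) auto
    then show "AE t in lebesgue. indicator {0..<2*pi} t * cis (of_int m * t) =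
        indicator {0..2*pi} t *\<^sub>R cis (of_int m * t)"
      by eventually_elim (auto simp: indicator_def)
  qed (auto intro!: borel_measurable_times borel_measurable_scaleR borel_measurable_indicator
      borel_measurable_lebesgue_cis)
  also have "\<dots> = (\<integral>t. indicator {0..2*pi} t *\<^sub>R cis (of_int m * t) \<partial>lborel)"
    by (rule integral_completion) measurable
  also have "\<dots> = (if m = 0 then 2 * of_real pi else 0)"
  proof (cases "m = 0")
    case True
    then show ?thesis
      by (subst integral_FTC_atLeastAtMost[where F="\<lambda>t. of_real t"])
         (auto intro!: derivative_eq_intros simp: has_vector_derivative_of_real)
  next
    case False
    have "(\<integral>t. indicator {0..2*pi} t *\<^sub>R cis (of_int m * t) \<partial>lborel) =
        cis (of_int m * (2 * pi)) / (\<i> * of_int m) - cis (of_int m * 0) / (\<i> * of_int m)"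
    proof (rule integral_FTC_atLeastAtMost)
      show "((\<lambda>t. cis (of_int m * t) / (\<i> * of_int m)) has_vector_derivative cis (of_int m * x))
          (at x within {0..2*pi})" for x
      proof -
        have "((\<lambda>z. exp (\<i> * of_int m * z) / (\<i> * of_int m)) has_field_derivative
            exp (\<i> * of_int m * of_real x)) (at (of_real x))"
          using False by (auto intro!: derivative_eq_intros)
        from has_vector_derivative_real_field[OF this, of "{0..2*pi}"] show ?thesis
          by (simp add: cis_conv_exp mult.assoc)
      qed
    qed (auto intro!: continuous_intros)
    also have "cis (of_int m * (2 * pi)) = 1"
      using cis_multiple_2pi[of "of_int m"] by (simp add: mult.commute mult.left_commute)
    finally show ?thesis using False by simp
  qed
  finally show ?thesis .
qed

lemma orthonormal_fourier_mode: "orthonormal_L2 fourier_mode"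
  unfolding orthonormal_L2_def
proof (intro conjI allI fourier_mode_L2)
  fix k l :: int
  have "fourier_mode k t * cnj (fourier_mode l t) =
      1 / of_real (2*pi) * (indicator {0..<2*pi} t * cis (of_int (k - l) * t))" for t
    by (auto simp: fourier_mode_def indicator_def cis_cnj cis_mult algebra_simps simp flip: of_real_mult)
  then have "L2_inner (fourier_mode k) (fourier_mode l) =
      1 / of_real (2*pi) * (\<integral>t. indicator {0..<2*pi} t * cis (of_int (k - l) * t) \<partial>lebesgue)"
    unfolding L2_inner_def by simp
  then show "L2_inner (fourier_mode k) (fourier_mode l) = (if k = l then 1 else 0)"
    unfolding integral_period_cis by simp
qed

lemma L2_sqdist_le_uniform:
  assumes "S \<in> lmeasurable" "0 \<le> d" "\<And>t. t \<in> S \<Longrightarrow> cmod (f t - g t) \<le> d" "\<And>t. t \<notin> S \<Longrightarrow> f t = g t"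
  shows "L2_sqdist f g \<le> ennreal (d\<^sup>2 * measure lebesgue S)"
proof -
  have "L2_sqdist f g \<le> (\<integral>\<^sup>+t. ennreal (d\<^sup>2) * indicator S t \<partial>lebesgue)"
    unfolding L2_sqdist_def
    by (intro nn_integral_mono) (auto simp: indicator_def assms intro!: ennreal_leI power_mono)
  also have "\<dots> = ennreal (d\<^sup>2 * measure lebesgue S)"
    using assms by (simp add: nn_integral_cmult_indicator fmeasurableD emeasure_eq_measure2 ennreal_mult)
  finally show ?thesis .
qed

lemma ennreal_tendsto_0D:
  fixes a :: "nat \<Rightarrow> ennreal"
  assumes "a \<longlonglongrightarrow> 0" "0 < e"
  shows "\<exists>n. a n < e"
  using order_tendstoD(2)[OF assms] by (auto simp: eventually_sequentially)

text \<open>The constant \<open>1/4\<close> compensates the factor 2 in \<open>L2_sqdist_triangle\<close>.\<close>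

lemma L2_approx_chain:
  assumes "f \<in> L2" "g \<in> L2" "h \<in> L2" "L2_sqdist f g < ennreal (e / 4)" "L2_sqdist g h < ennreal (e / 4)" "0 < e"
  shows "L2_sqdist f h < ennreal e"
proof -
  have "L2_sqdist f h \<le> 2 * L2_sqdist f g + 2 * L2_sqdist g h"
    using assms by (intro L2_sqdist_triangle)
  also have "\<dots> < 2 * ennreal (e / 4) + 2 * ennreal (e / 4)"
    using assms by (intro add_strict_mono ennreal_mult_strict_left_mono) auto
  also have "2 * ennreal (e / 4) = ennreal (e / 2)"
    using assms(6) ennreal_mult[of 2 "e / 4"] by simp
  also have "ennreal (e / 2) + ennreal (e / 2) = ennreal e"
    using assms(6) by (subst ennreal_plus[symmetric]) auto
  finally show ?thesis .
qed

text \<open>On a set of finite measure, uniform approximation by trigonometric polynomials is mean square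
approximation.  Vanishing at both ends makes \<open>h\<close> periodic.\<close>

lemma fourier_mode_approx_continuous:
  assumes cont: "continuous_on UNIV h" and supp: "\<And>t. t \<notin> {0<..<2*pi} \<Longrightarrow> h t = 0" and e: "0 < e"
  shows "\<exists>I c. finite I \<and> L2_sqdist h (\<lambda>t. \<Sum>k\<in>I. c k * fourier_mode k t) < ennreal e"
proof -
  define d where "d = sqrt (e / (4 * pi))"
  have d: "0 < d" "d\<^sup>2 = e / (4 * pi)" using e by (auto simp: d_def)
  have "continuous_on {0..2*pi} h" by (rule continuous_on_subset[OF cont]) auto
  moreover have "h 0 = h (2*pi)" by (simp add: supp)
  ultimately obtain p where p: "trig_poly p" "\<forall>t\<in>{0..2*pi}. cmod (h t - p t) < d"
    using trig_poly_uniform_approx[of h d] d by blast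
  from trig_poly_sum_form[OF p(1)] obtain I c where
    I: "finite (I :: int set)" and pI: "p = (\<lambda>t. \<Sum>k\<in>I. c k * cis (of_int k * t))" by blast
  define a where "a k = of_real (sqrt (2*pi)) * c k" for k
  have sum: "(\<Sum>k\<in>I. a k * fourier_mode k t) = indicator {0..<2*pi} t * p t" for t
    unfolding pI sum_distrib_left
    by (intro sum.cong) (auto simp: a_def fourier_mode_def indicator_def)
  have "L2_sqdist h (\<lambda>t. \<Sum>k\<in>I. a k * fourier_mode k t) \<le> ennreal (d\<^sup>2 * measure lebesgue {0..<2*pi})"
  proof (rule L2_sqdist_le_uniform)
    show "cmod (h t - (\<Sum>k\<in>I. a k * fourier_mode k t)) \<le> d" if "t \<in> {0..<2*pi}" for t
      using p(2) that unfolding sum by (auto simp: less_imp_le)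
    show "h t = (\<Sum>k\<in>I. a k * fourier_mode k t)" if "t \<notin> {0..<2*pi}" for t
      using supp[of t] that unfolding sum by auto
  qed (use d in auto)
  also have "\<dots> < ennreal e" using e by (simp add: d(2) ennreal_lessI)
  finally show ?thesis using I by blast
qed

text \<open>A Lebesgue measurable function is an almost everywhere limit of continuous ones.  Clamping these to the
bound of \<open>f\<close> and cutting them off at the ends of the period makes dominated convergence and
\<open>fourier_mode_approx_continuous\<close> applicable.\<close>

lemma fourier_mode_approx_bounded:
  assumes f: "f \<in> borel_measurable lebesgue" and supp: "\<And>t. t \<notin> {0..<2*pi} \<Longrightarrow> f t = 0"
    and bound: "\<And>t. cmod (f t) \<le> B" and e: "0 < e"
  shows "\<exists>I c. finite I \<and> L2_sqdist f (\<lambda>t. \<Sum>k\<in>I. c k * fourier_mode k t) < ennreal e"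
proof -
  have B: "0 \<le> B" using order_trans[OF norm_ge_zero bound[of 0]] .
  from lebesgue_measurable_imp_measurable_on[OF f, of UNIV]
  obtain N g where N: "negligible N" and g: "\<And>n. continuous_on UNIV (g n)"
    and lim: "\<And>x. x \<notin> N \<Longrightarrow> (\<lambda>n::nat. g n x) \<longlonglongrightarrow> f x"
    by (auto simp: measurable_on_def)
  \<comment> \<open>A continuous cutoff that vanishes outside the open period and tends to 1 inside it.\<close>
  define cut where "cut n t = max 0 (min 1 (real n * min t (2*pi - t)))" for n t
  \<comment> \<open>The nearest-point retraction onto the disc of radius \<open>B\<close> fixes the values of \<open>f\<close>.\<close>
  define clamp where "clamp = closest_point (cball (0::complex) B)"
  define h where "h n t = clamp (g n t) * of_real (cut n t)" for n t
  have clamp_cont: "continuous_on UNIV clamp"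
    unfolding clamp_def using B by (intro continuous_on_closest_point) auto
  have clamp_le: "cmod (clamp z) \<le> B" for z
    using closest_point_in_set[of "cball (0::complex) B" z] B by (simp add: clamp_def)
  have clamp_f: "clamp (f t) = f t" for t
    unfolding clamp_def by (rule closest_point_self) (simp add: bound)
  have cut01: "0 \<le> cut n t" "cut n t \<le> 1" for n t by (auto simp: cut_def)
  have cut0: "cut n t = 0" if "t \<notin> {0<..<2*pi}" for n t
  proof -
    have "real n * min t (2*pi - t) \<le> 0"
      using that by (intro mult_nonneg_nonpos) (auto simp: min_def)
    then show ?thesis by (simp add: cut_def)
  qed
  have h_cont: "continuous_on UNIV (h n)" for n
    unfolding h_def[abs_def] cut_def
    by (intro continuous_intros continuous_on_compose2[OF clamp_cont g]) auto
  have h_supp: "h n t = 0" if "t \<notin> {0<..<2*pi}" for n t using cut0[OF that] by (simp add: h_def)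
  have h_le: "cmod (h n t) \<le> B * indicator {0..2*pi} t" for n t
  proof (cases "t \<in> {0<..<2*pi}")
    case True
    have "cmod (clamp (g n t)) * cut n t \<le> B * 1"
      using clamp_le cut01 B by (intro mult_mono) auto
    then show ?thesis using True cut01[of n t] by (simp add: h_def norm_mult)
  qed (simp add: h_supp B)
  have lim_h: "(\<lambda>n. h n t) \<longlonglongrightarrow> f t" if t: "t \<notin> N" "t \<noteq> 0" for t
  proof (cases "t \<in> {0<..<2*pi}")
    case True
    have c1: "(\<lambda>n. clamp (g n t)) \<longlonglongrightarrow> clamp (f t)"
      using clamp_cont lim[OF t(1)] by (auto intro: isCont_tendsto_compose simp: continuous_on_eq_continuous_at)
    define m where "m = min t (2*pi - t)"
    have m: "0 < m" using True by (auto simp: m_def)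
    obtain n0 where n0: "1 / m < real n0" using reals_Archimedean2 by blast
    have "cut n t = 1" if "n \<ge> n0" for n
    proof -
      have "1 / m < real n" using n0 that by (meson less_le_trans of_nat_mono)
      then have "1 \<le> real n * m" using m by (simp add: field_simps)
      then show ?thesis by (simp add: cut_def m_def)
    qed
    then have "eventually (\<lambda>n. cut n t = 1) sequentially" by (auto simp: eventually_sequentially)
    then have "(\<lambda>n. cut n t) \<longlonglongrightarrow> 1" by (rule tendsto_eventually)
    from tendsto_mult[OF c1 tendsto_of_real[OF this]] show ?thesis
      by (simp add: h_def clamp_f)
  next
    case False
    then have "f t = 0" using supp[of t] t(2) by auto
    then show ?thesis using h_supp[OF False] by simp
  qed
  have hm: "h n \<in> borel_measurable lebesgue" for n
    using borel_measurable_continuous_onI[OF h_cont] by (simp add: measurable_completion)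
  have iB: "integrable lebesgue (\<lambda>t. (B * indicator {0..2*pi} t)\<^sup>2)"
  proof -
    have "(\<lambda>t. (B * indicator {0..2*pi} t)\<^sup>2) = (\<lambda>t. B\<^sup>2 * indicator {0..2*pi} (t::real))"
      by (auto simp: indicator_def)
    then show ?thesis by simp
  qed
  have fB: "cmod (f t) \<le> B * indicator {0..2*pi} t" for t
    using bound[of t] supp[of t] by (cases "t \<in> {0..<2*pi}") (auto simp: indicator_def B)
  have "AE t in lebesgue. t \<notin> N \<and> t \<noteq> 0"
    using N by (intro AE_I'[of "insert 0 N"]) (auto simp: negligible_iff_null_sets)
  then have ae: "AE t in lebesgue. (\<lambda>n. h n t) \<longlonglongrightarrow> f t" by eventually_elim (auto intro: lim_h)
  have conv: "(\<lambda>n. L2_sqdist (h n) f) \<longlonglongrightarrow> 0"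
    by (rule L2_dominated_convergence[OF hm f iB h_le fB ae])
  have bL2: "k \<in> L2" if "k \<in> borel_measurable lebesgue" "\<And>t. cmod (k t) \<le> B * indicator {0..2*pi} t" for k
  proof -
    have "integrable lebesgue (\<lambda>t. (cmod (k t))\<^sup>2)"
      by (rule Bochner_Integration.integrable_bound[OF iB])
         (use that in \<open>auto intro!: always_eventually power_mono\<close>)
    then show ?thesis using that by (simp add: L2_def)
  qed
  obtain n where n: "L2_sqdist f (h n) < ennreal (e / 4)"
    using ennreal_tendsto_0D[OF conv, of "ennreal (e / 4)"] e by (auto simp: L2_sqdist_commute)
  obtain I c where I: "finite I" "L2_sqdist (h n) (\<lambda>t. \<Sum>k\<in>I. c k * fourier_mode k t) < ennreal (e / 4)"
    using fourier_mode_approx_continuous[OF h_cont[of n] h_supp, where e="e / 4"] e by auto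
  have "L2_sqdist f (\<lambda>t. \<Sum>k\<in>I. c k * fourier_mode k t) < ennreal e"
    by (rule L2_approx_chain[OF bL2[OF f fB] bL2[OF hm h_le] _ n I(2) e])
       (intro L2_sum L2_cmult fourier_mode_L2)
  then show ?thesis using I by blast
qed

lemma L2_truncate_tendsto:
  assumes f: "f \<in> L2" and S: "\<And>n. S n \<in> sets lebesgue"
    and ev: "\<And>t. eventually (\<lambda>n. t \<in> S n) sequentially"
  shows "(\<lambda>n. L2_sqdist (\<lambda>t. indicator (S n) t * f t) f) \<longlonglongrightarrow> 0"
proof (rule L2_dominated_convergence[where G="\<lambda>t. cmod (f t)"])
  have [measurable]: "f \<in> borel_measurable lebesgue" "\<And>n. S n \<in> sets lebesgue" using f S by (auto simp: L2_def)
  show "(\<lambda>t. indicator (S n) t * f t) \<in> borel_measurable lebesgue" for n by measurable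
  show "f \<in> borel_measurable lebesgue" by measurable
  show "AE t in lebesgue. (\<lambda>n. indicator (S n) t * f t) \<longlonglongrightarrow> f t"
  proof (intro always_eventually allI)
    fix t
    have "eventually (\<lambda>n. indicator (S n) t * f t = f t) sequentially"
      using ev[of t] by eventually_elim simp
    then show "(\<lambda>n. indicator (S n) t * f t) \<longlonglongrightarrow> f t" by (rule tendsto_eventually)
  qed
qed (use f in \<open>auto simp: L2_def norm_mult indicator_def\<close>)

lemma L2_indicator_mult:
  assumes "f \<in> L2" "S \<in> sets lebesgue"
  shows "(\<lambda>t. indicator S t * f t) \<in> L2"
  using assms(2) by (intro L2_bounded_mult[OF assms(1)]) (auto simp: indicator_def)

lemma fourier_mode_approx:
  assumes f: "f \<in> L2" and supp: "\<And>t. t \<notin> {0..<2*pi} \<Longrightarrow> f t = 0" and e: "0 < e"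
  shows "\<exists>I c. finite I \<and> L2_sqdist f (\<lambda>t. \<Sum>k\<in>I. c k * fourier_mode k t) < ennreal e"
proof -
  have [measurable]: "f \<in> borel_measurable lebesgue" using f by (simp add: L2_def)
  define S where "S n = {t. cmod (f t) \<le> real n}" for n
  have S: "S n \<in> sets lebesgue" for n
  proof -
    have "{t \<in> space lebesgue. cmod (f t) \<le> real n} \<in> sets lebesgue" by measurable
    then show ?thesis by (simp add: S_def)
  qed
  have "eventually (\<lambda>n. t \<in> S n) sequentially" for t
    using eventually_ge_at_top[of "nat \<lceil>cmod (f t)\<rceil>"]
    unfolding S_def mem_Collect_eq by eventually_elim linarith
  from L2_truncate_tendsto[OF f S this]
  obtain n where n: "L2_sqdist f (\<lambda>t. indicator (S n) t * f t) < ennreal (e / 4)"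
    using e ennreal_tendsto_0D[of _ "ennreal (e / 4)"] by (auto simp: L2_sqdist_commute)
  have "\<exists>I c. finite I \<and> L2_sqdist (\<lambda>t. indicator (S n) t * f t) (\<lambda>t. \<Sum>k\<in>I. c k * fourier_mode k t) < ennreal (e / 4)"
  proof (rule fourier_mode_approx_bounded[where B="real n"])
    show "(\<lambda>t. indicator (S n) t * f t) \<in> borel_measurable lebesgue" using S[of n] by measurable
    show "cmod (indicator (S n) t * f t) \<le> real n" for t
      by (auto simp: S_def indicator_def)
  qed (use e supp in auto)
  then obtain I c where I: "finite I"
    "L2_sqdist (\<lambda>t. indicator (S n) t * f t) (\<lambda>t. \<Sum>k\<in>I. c k * fourier_mode k t) < ennreal (e / 4)" by blast
  have "L2_sqdist f (\<lambda>t. \<Sum>k\<in>I. c k * fourier_mode k t) < ennreal e"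
    by (rule L2_approx_chain[OF f L2_indicator_mult[OF f S] _ n I(2) e])
       (intro L2_sum L2_cmult fourier_mode_L2)
  then show ?thesis using I by blast
qed

theorem parseval_fourier_series:
  assumes f: "f \<in> L2" and supp: "\<And>t. t \<notin> {0..<2*pi} \<Longrightarrow> f t = 0"
  shows "(\<integral>\<^sup>+k. ennreal ((cmod (\<integral>t. f t * cis (- (of_int k * t)) \<partial>lebesgue))\<^sup>2) \<partial>count_space UNIV) =
    ennreal (2 * pi * L2_sqnorm f)"
proof -
  have "(\<integral>t. f t * cis (- (of_int k * t)) \<partial>lebesgue) = of_real (sqrt (2*pi)) * L2_inner f (fourier_mode k)" for k
  proof -
    have "f t * cis (- (of_int k * t)) = of_real (sqrt (2*pi)) * (f t * cnj (fourier_mode k t))" for t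
      using supp[of t] by (cases "t \<in> {0..<2*pi}") (auto simp: fourier_mode_def cis_cnj)
    then show ?thesis unfolding L2_inner_def by (simp only: integral_mult_right_zero)
  qed
  then have "(\<integral>\<^sup>+k. ennreal ((cmod (\<integral>t. f t * cis (- (of_int k * t)) \<partial>lebesgue))\<^sup>2) \<partial>count_space UNIV) =
      (\<integral>\<^sup>+k. ennreal (2*pi) * ennreal ((cmod (L2_inner f (fourier_mode k)))\<^sup>2) \<partial>count_space UNIV)"
    by (simp add: norm_mult power_mult_distrib flip: ennreal_mult)
  also have "\<dots> = ennreal (2*pi) * (\<integral>\<^sup>+k. ennreal ((cmod (L2_inner f (fourier_mode k)))\<^sup>2) \<partial>count_space UNIV)"
    by (rule nn_integral_cmult) simp
  also have "(\<integral>\<^sup>+k. ennreal ((cmod (L2_inner f (fourier_mode k)))\<^sup>2) \<partial>count_space UNIV) = ennreal (L2_sqnorm f)"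
  proof (rule parseval_of_approx[OF orthonormal_fourier_mode f])
    fix e :: ennreal assume e: "0 < e"
    obtain d where d: "0 < d" "ennreal d \<le> e" by (rule ennreal_pos_real_below[OF e])
    show "\<exists>I c. finite I \<and> L2_sqdist f (\<lambda>t. \<Sum>k\<in>I. c k * fourier_mode k t) < e"
      using fourier_mode_approx[OF f supp d(1)] d(2) by (meson less_le_trans)
  qed
  finally show ?thesis by (simp add: ennreal_mult)
qed

section \<open>Plancherel's identity\<close>

lemma measurable_lebesgue_affine: "c \<noteq> 0 \<Longrightarrow> (\<lambda>x::real. a + c * x) \<in> lebesgue \<rightarrow>\<^sub>M lebesgue"
  using lebesgue_affine_measurable[where c="\<lambda>_. c" and t=a] by simp

lemma borel_measurable_cmod_sq:
  "g \<in> borel_measurable M \<Longrightarrow> (\<lambda>x. ennreal ((cmod (g x))\<^sup>2)) \<in> borel_measurable M"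
  by measurable

lemma borel_measurable_Ico_lebesgue:
  "F \<in> borel_measurable lebesgue \<Longrightarrow> (\<lambda>x. F x * indicator {a..<b::real} x :: ennreal) \<in> borel_measurable lebesgue"
  by (rule borel_measurable_times_ennreal[OF _ borel_measurable_indicator]) auto

text \<open>The intervals \<open>[k p, (k+1) p)\<close> partition the line; translate each of them to \<open>[0, p)\<close>.\<close>

lemma nn_integral_split_period:
  fixes F :: "real \<Rightarrow> ennreal"
  assumes [measurable]: "F \<in> borel_measurable lebesgue" and p: "0 < p"
  shows "(\<integral>\<^sup>+x. F x \<partial>lebesgue) =
    (\<integral>\<^sup>+k. (\<integral>\<^sup>+x. F (x + of_int k * p) * indicator {0..<p} x \<partial>lebesgue) \<partial>count_space (UNIV :: int set))"
proof -
  have fl: "x \<in> {of_int k * p..<of_int k * p + p} \<longleftrightarrow> k = \<lfloor>x / p\<rfloor>" for x and k :: int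
  proof -
    have "k = \<lfloor>x / p\<rfloor> \<longleftrightarrow> of_int k \<le> x / p \<and> x / p < of_int k + 1"
      by (auto simp: floor_eq_iff eq_commute[of k])
    then show ?thesis using p by (auto simp: field_simps)
  qed
  have "(\<integral>\<^sup>+x. F x \<partial>lebesgue) =
      (\<integral>\<^sup>+x. (\<integral>\<^sup>+k. F x * indicator {of_int k * p..<of_int k * p + p} x \<partial>count_space (UNIV :: int set)) \<partial>lebesgue)"
  proof (rule nn_integral_cong)
    fix x
    have "(\<integral>\<^sup>+k. F x * indicator {of_int k * p..<of_int k * p + p} x \<partial>count_space (UNIV :: int set)) =
        (\<integral>\<^sup>+k. F x * indicator {\<lfloor>x / p\<rfloor>} k \<partial>count_space UNIV)"
      by (simp only: indicator_def fl singleton_iff)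
    also have "\<dots> = F x" by (subst nn_integral_cmult_indicator) auto
    finally show "F x = (\<integral>\<^sup>+k. F x * indicator {of_int k * p..<of_int k * p + p} x \<partial>count_space (UNIV :: int set))"
      by (rule sym)
  qed
  also have "\<dots> = (\<integral>\<^sup>+k. (\<integral>\<^sup>+x. F x * indicator {of_int k * p..<of_int k * p + p} x \<partial>lebesgue) \<partial>count_space (UNIV :: int set))"
    by (rule nn_integral_count_space_nn_integral) (auto intro: borel_measurable_Ico_lebesgue assms)
  also have "\<dots> = (\<integral>\<^sup>+k. (\<integral>\<^sup>+x. F (x + of_int k * p) * indicator {0..<p} x \<partial>lebesgue) \<partial>count_space (UNIV :: int set))"
  proof (rule nn_integral_cong)
    fix k :: int
    have "(\<integral>\<^sup>+x. F x * indicator {of_int k * p..<of_int k * p + p} x \<partial>lebesgue) =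
        (\<integral>\<^sup>+x. F (of_int k * p + 1 * x) * indicator {of_int k * p..<of_int k * p + p} (of_int k * p + 1 * x) \<partial>lebesgue)"
      by (subst nn_integral_real_affine_lebesgue[of _ 1 "of_int k * p"])
         (auto intro: borel_measurable_Ico_lebesgue assms)
    also have "\<dots> = (\<integral>\<^sup>+x. F (x + of_int k * p) * indicator {0..<p} x \<partial>lebesgue)"
      by (intro nn_integral_cong) (auto simp: indicator_def add.commute)
    finally show "(\<integral>\<^sup>+x. F x * indicator {of_int k * p..<of_int k * p + p} x \<partial>lebesgue) = \<dots>" .
  qed
  finally show ?thesis .
qed

text \<open>Needed for Fubini's theorem on the completed measure.\<close>

lemma sigma_finite_lebesgue: "sigma_finite_measure (lebesgue :: real measure)"
proof
  show "\<exists>A::real set set. countable A \<and> A \<subseteq> sets lebesgue \<and> \<Union>A = space lebesgue \<and> (\<forall>a\<in>A. emeasure lebesgue a \<noteq> \<infinity>)"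
  proof (intro exI[of _ "range (\<lambda>n::nat. {-real n..real n})"] conjI)
    show "\<Union>(range (\<lambda>n::nat. {-real n..real n})) = space lebesgue"
    proof -
      have "\<exists>n::nat. - real n \<le> x \<and> x \<le> real n" for x :: real
      proof -
        obtain n where "\<bar>x\<bar> \<le> real n" using real_arch_simple by blast
        then show ?thesis by (intro exI[of _ n]) linarith
      qed
      then show ?thesis by auto
    qed
  qed auto
qed

interpretation lebesgue_pair: pair_sigma_finite "lebesgue :: real measure" "lebesgue :: real measure"
  by (simp add: pair_sigma_finite_def sigma_finite_lebesgue)

text \<open>The space \<open>L\<^sup>1 \<inter> L\<^sup>2\<close>, where the transform is given by an absolutely convergent integral.\<close>

definition L12 :: "(real \<Rightarrow> complex) set" where
  "L12 = {f \<in> L2. integrable lebesgue f}"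

lemma L12_L2: "f \<in> L12 \<Longrightarrow> f \<in> L2" and L12_integrable: "f \<in> L12 \<Longrightarrow> integrable lebesgue f"
  by (auto simp: L12_def)

lemma L12_cmult: "f \<in> L12 \<Longrightarrow> (\<lambda>t. c * f t) \<in> L12"
  by (simp add: L12_def L2_cmult)

lemma L12_diff: "f \<in> L12 \<Longrightarrow> g \<in> L12 \<Longrightarrow> (\<lambda>t. f t - g t) \<in> L12"
  by (simp add: L12_def L2_diff)

lemma L12_sum: "(\<And>i. i \<in> I \<Longrightarrow> u i \<in> L12) \<Longrightarrow> (\<lambda>t. \<Sum>i\<in>I. u i t) \<in> L12"
  by (simp add: L12_def L2_sum)

lemma L12_indicator_mult: "f \<in> L12 \<Longrightarrow> S \<in> sets lebesgue \<Longrightarrow> (\<lambda>t. indicator S t * f t) \<in> L12"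
proof -
  assume f: "f \<in> L12" and S: "S \<in> sets lebesgue"
  have "integrable lebesgue (\<lambda>t. indicator S t *\<^sub>R f t)"
    using S L12_integrable[OF f] by (rule integrable_mult_indicator)
  also have "(\<lambda>t. indicator S t *\<^sub>R f t) = (\<lambda>t. indicator S t * f t)"
    by (auto simp: indicator_def)
  finally show "(\<lambda>t. indicator S t * f t) \<in> L12"
    using L2_indicator_mult[OF L12_L2[OF f] S] by (simp add: L12_def)
qed

lemma L2_restrict_L12: assumes f: "f \<in> L2" and S: "S \<in> lmeasurable" shows "(\<lambda>t. indicator S t * f t) \<in> L12"
proof -
  have "(\<lambda>t. indicator S t * (1::complex)) \<in> L2" by (rule L2_indicator_bounded[OF S, of _ 1]) auto
  from L2_mult_integrable[OF this f] show ?thesis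
    using L2_indicator_mult[OF f] S by (simp add: L12_def fmeasurableD)
qed

lemma eventually_in_interval:
  fixes t :: real
  shows "eventually (\<lambda>n. t \<in> {-real n..<real n}) sequentially"
  using eventually_gt_at_top[of "nat \<lceil>\<bar>t\<bar>\<rceil>"] unfolding atLeastLessThan_iff by eventually_elim linarith

lemmas eventually_in_Suc_interval = eventually_in_interval[THEN eventually_sequentially_Suc[THEN iffD2]]

lemma L2_approx_L12:
  assumes f: "f \<in> L2" and e: "0 < e"
  shows "\<exists>f'\<in>L12. L2_sqdist f f' < e"
proof -
  have "(\<lambda>n. L2_sqdist (\<lambda>t. indicator {-real n..<real n} t * f t) f) \<longlonglongrightarrow> 0"
    by (rule L2_truncate_tendsto[OF f _ eventually_in_interval]) auto
  from ennreal_tendsto_0D[OF this e] obtain n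
    where "L2_sqdist (\<lambda>t. indicator {-real n..<real n} t * f t) f < e" by blast
  then show ?thesis
    using L2_restrict_L12[OF f] by (intro bexI[of _ "\<lambda>t. indicator {-real n..<real n} t * f t"])
      (auto simp: L2_sqdist_commute)
qed

lemma lebesgue_borel_measurable [simp]: "f \<in> borel_measurable borel \<Longrightarrow> f \<in> borel_measurable lebesgue"
  by (simp add: measurable_completion)

lemma integrable_exp_mult:
  assumes "integrable lebesgue f"
  shows "integrable lebesgue (\<lambda>t. exp (- \<i> * of_real (t * x)) * f t)"
proof (rule Bochner_Integration.integrable_bound[OF assms])
  have "(\<lambda>t. exp (- \<i> * of_real (t * x))) \<in> borel_measurable lebesgue"
    by (rule lebesgue_borel_measurable) measurable
  then show "(\<lambda>t. exp (- \<i> * of_real (t * x)) * f t) \<in> borel_measurable lebesgue"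
    using assms by (intro borel_measurable_times) auto
qed (simp add: norm_mult)

lemma fourier_kernel_measurable:
  assumes f: "f \<in> borel_measurable lebesgue"
  shows "(\<lambda>(x, t). exp (- \<i> * of_real (t * x)) * f t) \<in> borel_measurable (lebesgue \<Otimes>\<^sub>M lebesgue)"
proof -
  have id: "(\<lambda>t. t) \<in> borel_measurable (lebesgue :: real measure)" by simp
  have [measurable]: "fst \<in> borel_measurable (lebesgue \<Otimes>\<^sub>M lebesgue :: (real \<times> real) measure)"
      "snd \<in> borel_measurable (lebesgue \<Otimes>\<^sub>M lebesgue :: (real \<times> real) measure)"
    using measurable_compose[OF measurable_fst id] measurable_compose[OF measurable_snd id] by auto
  have [measurable]: "(\<lambda>p. f (snd p)) \<in> borel_measurable (lebesgue \<Otimes>\<^sub>M lebesgue :: (real \<times> real) measure)"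
    by (rule measurable_compose[OF measurable_snd f])
  show ?thesis unfolding split_beta' by measurable
qed

lemma fourier_measurable: "f \<in> borel_measurable lebesgue \<Longrightarrow> fourier f \<in> borel_measurable lebesgue"
  unfolding fourier_def[abs_def]
  by (intro borel_measurable_times borel_measurable_const
      sigma_finite_measure.borel_measurable_lebesgue_integral[OF sigma_finite_lebesgue] fourier_kernel_measurable)

lemma fourier_add: "integrable lebesgue f \<Longrightarrow> integrable lebesgue g \<Longrightarrow>
    fourier (\<lambda>t. f t + g t) x = fourier f x + fourier g x"
  unfolding fourier_def
  using Bochner_Integration.integral_add[OF integrable_exp_mult[of f x] integrable_exp_mult[of g x]]
  by (simp add: ring_distribs)

lemma fourier_cmult: "fourier (\<lambda>t. c * f t) x = c * fourier f x"
  by (simp add: fourier_def mult.left_commute)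

lemma fourier_diff: "integrable lebesgue f \<Longrightarrow> integrable lebesgue g \<Longrightarrow>
    fourier (\<lambda>t. f t - g t) x = fourier f x - fourier g x"
  using fourier_add[of f "\<lambda>t. -1 * g t" x] fourier_cmult[of "-1" g x] by simp

lemma fourier_sum: "finite I \<Longrightarrow> (\<And>i. i \<in> I \<Longrightarrow> integrable lebesgue (u i)) \<Longrightarrow>
    fourier (\<lambda>t. \<Sum>i\<in>I. u i t) x = (\<Sum>i\<in>I. fourier (u i) x)"
  by (induction I rule: finite_induct) (auto simp: fourier_add, simp add: fourier_def)

text \<open>The numbers \<open>fourier f (x + k)\<close>, \<open>k \<in> \<int>\<close>, are the Fourier coefficients of \<open>exp(-i x t) f(t)\<close>, whose norm does
not depend on \<open>x\<close>.  So Parseval's identity gives the same value for every \<open>x\<close>, and integrating over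
\<open>x \<in> [0, 1)\<close> collects the whole line.\<close>

lemma plancherel_period:
  assumes f: "f \<in> L2" and supp: "\<And>t. t \<notin> {0..<2*pi} \<Longrightarrow> f t = 0"
  shows "(\<integral>\<^sup>+x. ennreal ((cmod (fourier f x))\<^sup>2) \<partial>lebesgue) = ennreal (L2_sqnorm f)"
proof -
  have fm: "f \<in> borel_measurable lebesgue" using f by (simp add: L2_def)
  have [measurable]: "fourier f \<in> borel_measurable lebesgue" using fm by (rule fourier_measurable)
  have shift: "(\<lambda>x. fourier f (x + of_int k)) \<in> borel_measurable lebesgue" for k
    using measurable_compose[OF measurable_lebesgue_affine \<open>fourier f \<in> _\<close>, of 1 "of_int k"]
    by (simp add: add.commute)
  have sum: "(\<integral>\<^sup>+k. ennreal ((cmod (fourier f (x + of_int k)))\<^sup>2) \<partial>count_space (UNIV :: int set)) = ennreal (L2_sqnorm f)" for x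
  proof -
    define m where "m t = cis (- (x * t)) * f t" for t
    have mL: "m \<in> L2" unfolding m_def[abs_def]
      using borel_measurable_lebesgue_cis[of "- x"] by (intro L2_bounded_mult[OF f]) auto
    have msupp: "m t = 0" if "t \<notin> {0..<2*pi}" for t using supp[OF that] by (simp add: m_def)
    have "L2_sqnorm m = L2_sqnorm f" by (simp add: L2_sqnorm_def m_def norm_mult)
    have "fourier f (x + of_int k) = of_real (1 / sqrt (2*pi)) * (\<integral>t. m t * cis (- (of_int k * t)) \<partial>lebesgue)" for k :: int
    proof -
      have "exp (- \<i> * of_real (t * (x + of_int k))) * f t = m t * cis (- (of_int k * t))" for t
      proof -
        have "cis (- (x * t)) * cis (- (of_int k * t)) = cis (- (t * (x + of_int k)))"
          by (simp add: cis_mult algebra_simps)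
        then show ?thesis by (simp add: m_def cis_conv_exp mult_ac)
      qed
      then show ?thesis unfolding fourier_def by (simp only:)
    qed
    then have "(\<integral>\<^sup>+k. ennreal ((cmod (fourier f (x + of_int k)))\<^sup>2) \<partial>count_space (UNIV :: int set)) =
        (\<integral>\<^sup>+k. ennreal (1 / (2*pi)) * ennreal ((cmod (\<integral>t. m t * cis (- (of_int k * t)) \<partial>lebesgue))\<^sup>2) \<partial>count_space (UNIV :: int set))"
      by (simp add: norm_mult norm_divide power_mult_distrib power_divide flip: ennreal_mult)
    also have "\<dots> = ennreal (1 / (2*pi)) *
        (\<integral>\<^sup>+k. ennreal ((cmod (\<integral>t. m t * cis (- (of_int k * t)) \<partial>lebesgue))\<^sup>2) \<partial>count_space (UNIV :: int set))"
      by (rule nn_integral_cmult) simp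
    also have "(\<integral>\<^sup>+k. ennreal ((cmod (\<integral>t. m t * cis (- (of_int k * t)) \<partial>lebesgue))\<^sup>2) \<partial>count_space (UNIV :: int set)) =
        ennreal (2 * pi * L2_sqnorm m)"
      by (rule parseval_fourier_series[OF mL]) (rule msupp)
    also have "ennreal (1 / (2*pi)) * ennreal (2 * pi * L2_sqnorm m) = ennreal (L2_sqnorm m)"
      by (subst ennreal_mult[symmetric]) auto
    also have "\<dots> = ennreal (L2_sqnorm f)"
      by (simp add: \<open>L2_sqnorm m = L2_sqnorm f\<close>)
    finally show ?thesis .
  qed
  have "(\<integral>\<^sup>+x. ennreal ((cmod (fourier f x))\<^sup>2) \<partial>lebesgue) =
      (\<integral>\<^sup>+k. (\<integral>\<^sup>+x. ennreal ((cmod (fourier f (x + of_int k * 1)))\<^sup>2) * indicator {0..<1} x \<partial>lebesgue) \<partial>count_space (UNIV :: int set))"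
    by (rule nn_integral_split_period) (auto intro: borel_measurable_cmod_sq)
  also have "\<dots> = (\<integral>\<^sup>+x. (\<integral>\<^sup>+k. ennreal ((cmod (fourier f (x + of_int k)))\<^sup>2) * indicator {0..<1} x \<partial>count_space (UNIV :: int set)) \<partial>lebesgue)"
    by (subst nn_integral_count_space_nn_integral)
       (auto intro!: borel_measurable_Ico_lebesgue borel_measurable_cmod_sq shift)
  also have "\<dots> = (\<integral>\<^sup>+x. ennreal (L2_sqnorm f) * indicator {0..<1} (x::real) \<partial>lebesgue)"
    by (intro nn_integral_cong) (subst nn_integral_multc, auto simp: sum)
  also have "\<dots> = ennreal (L2_sqnorm f)"
    by (subst nn_integral_cmult_indicator) auto
  finally show ?thesis .
qed

text \<open>An affine substitution maps the interval to \<open>[0, 2\<pi>)\<close>; the transform is dilated by \<open>c\<close> and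
multiplied by a factor of modulus \<open>c\<close>.\<close>

lemma plancherel_interval:
  assumes f: "f \<in> L2" and supp: "\<And>t. t \<notin> {a..<a + 2*pi*c} \<Longrightarrow> f t = 0" and c: "0 < c"
  shows "(\<integral>\<^sup>+x. ennreal ((cmod (fourier f x))\<^sup>2) \<partial>lebesgue) = ennreal (L2_sqnorm f)"
proof -
  have fm: "f \<in> borel_measurable lebesgue" using f by (simp add: L2_def)
  define g where "g s = f (a + c * s)" for s
  have gm: "g \<in> borel_measurable lebesgue" unfolding g_def[abs_def]
    using measurable_compose[OF measurable_lebesgue_affine fm] c by simp
  have isq: "integrable lebesgue (\<lambda>s. (cmod (g s))\<^sup>2)"
    unfolding g_def using lebesgue_integrable_real_affine[of "\<lambda>t. (cmod (f t))\<^sup>2" c a] f c by (simp add: L2_def)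
  have gL: "g \<in> L2" using gm isq by (simp add: L2_def)
  have gsupp: "g s = 0" if "s \<notin> {0..<2*pi}" for s
  proof -
    have "a + c * s \<notin> {a..<a + 2*pi*c}"
      using that c by (auto simp: zero_le_mult_iff mult.commute[of c])
    then show ?thesis by (simp add: g_def supp)
  qed
  have [measurable]: "fourier g \<in> borel_measurable lebesgue" using gm by (rule fourier_measurable)
  have fou: "fourier f x = of_real c * exp (- \<i> * of_real (a * x)) * fourier g (c * x)" for x
  proof -
    have "(\<integral>t. exp (- \<i> * of_real (t * x)) * f t \<partial>lebesgue) =
        c *\<^sub>R (\<integral>s. exp (- \<i> * of_real ((a + c * s) * x)) * f (a + c * s) \<partial>lebesgue)"
      using lebesgue_integral_real_affine[of c "\<lambda>t. exp (- \<i> * of_real (t * x)) * f t" a] c by simp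
    also have "(\<integral>s. exp (- \<i> * of_real ((a + c * s) * x)) * f (a + c * s) \<partial>lebesgue) =
        (\<integral>s. exp (- \<i> * of_real (a * x)) * (exp (- \<i> * of_real (s * (c * x))) * g s) \<partial>lebesgue)"
      by (rule Bochner_Integration.integral_cong) (auto simp: g_def algebra_simps simp flip: exp_add)
    finally show ?thesis unfolding fourier_def by (simp add: scaleR_conv_of_real)
  qed
  have sq: "L2_sqnorm f = c * L2_sqnorm g"
    unfolding L2_sqnorm_def g_def
    using lebesgue_integral_real_affine[of c "\<lambda>t. (cmod (f t))\<^sup>2" a] c by simp
  have "(\<integral>\<^sup>+x. ennreal ((cmod (fourier f x))\<^sup>2) \<partial>lebesgue) =
      (\<integral>\<^sup>+x. ennreal (c\<^sup>2) * ennreal ((cmod (fourier g (0 + c * x)))\<^sup>2) \<partial>lebesgue)"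
    unfolding fou by (simp add: norm_mult power_mult_distrib ennreal_mult)
  also have "\<dots> = ennreal c * (ennreal \<bar>c\<bar> * (\<integral>\<^sup>+x. ennreal ((cmod (fourier g (0 + c * x)))\<^sup>2) \<partial>lebesgue))"
    using c measurable_compose[OF measurable_lebesgue_affine \<open>fourier g \<in> _\<close>, of c 0]
    by (subst nn_integral_cmult) (auto simp: power2_eq_square ennreal_mult mult.assoc)
  also have "\<dots> = ennreal c * (\<integral>\<^sup>+x. ennreal ((cmod (fourier g x))\<^sup>2) \<partial>lebesgue)"
    using c by (subst nn_integral_real_affine_lebesgue[symmetric]) auto
  also have "(\<integral>\<^sup>+x. ennreal ((cmod (fourier g x))\<^sup>2) \<partial>lebesgue) = ennreal (L2_sqnorm g)"
    by (rule plancherel_period[OF gL]) (rule gsupp)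
  also have "ennreal c * ennreal (L2_sqnorm g) = ennreal (L2_sqnorm f)"
    unfolding sq using c by (simp add: ennreal_mult)
  finally show ?thesis .
qed

lemma L2_sqnorm_add:
  assumes "f \<in> L2" "g \<in> L2"
  shows "L2_sqnorm (\<lambda>t. f t + g t) = L2_sqnorm f + L2_sqnorm g + 2 * Re (L2_inner f g)"
  using L2_sqnorm_diff[OF assms(1) L2_cmult[OF assms(2), of "-1"]]
    L2_inner_cmult_right[of f "-1" g] L2_sqnorm_cmult[of "-1" g] by simp

text \<open>Truncations to growing intervals have converging transforms, so Fatou's lemma yields \<open>\<le>\<close>.  For \<open>\<ge>\<close>,
write \<open>f = s + r\<close> with \<open>s\<close> a truncation: the parallelogram law for the transforms of \<open>s\<close> and \<open>r\<close>, the
bound \<open>\<le>\<close> for \<open>s - r\<close>, and \<open>|s - r| = |f|\<close> together bound the norm of the transform of \<open>f\<close> below by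
\<open>2\<parallel>s\<parallel>\<^sup>2 - \<parallel>f\<parallel>\<^sup>2\<close>.\<close>

theorem plancherel:
  assumes f: "f \<in> L12"
  shows "fourier f \<in> L2" "L2_sqnorm (fourier f) = L2_sqnorm f"
proof -
  have le: "(\<integral>\<^sup>+x. ennreal ((cmod (fourier h x))\<^sup>2) \<partial>lebesgue) \<le> ennreal (L2_sqnorm h)" if h: "h \<in> L12" for h
  proof -
    define s where "s n t = indicator {-real (Suc n)..<real (Suc n)} t * h t" for n t
    have sL: "s n \<in> L12" for n unfolding s_def[abs_def] by (rule L12_indicator_mult[OF h]) auto
    have [measurable]: "fourier (s n) \<in> borel_measurable lebesgue" for n
      using sL[of n] by (intro fourier_measurable) (auto simp: L12_def L2_def)
    have lim: "(\<lambda>n. fourier (s n) x) \<longlonglongrightarrow> fourier h x" for x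
      unfolding fourier_def
    proof (intro tendsto_mult tendsto_const integral_dominated_convergence[where w="\<lambda>t. cmod (h t)"])
      show "(\<lambda>t. exp (- \<i> * of_real (t * x)) * h t) \<in> borel_measurable lebesgue"
        using integrable_exp_mult[OF L12_integrable[OF h]] by auto
      show "(\<lambda>t. exp (- \<i> * of_real (t * x)) * s n t) \<in> borel_measurable lebesgue" for n
        using integrable_exp_mult[OF L12_integrable[OF sL]] by auto
      show "integrable lebesgue (\<lambda>t. cmod (h t))" using L12_integrable[OF h] by simp
      show "AE t in lebesgue. (\<lambda>n. exp (- \<i> * of_real (t * x)) * s n t) \<longlonglongrightarrow> exp (- \<i> * of_real (t * x)) * h t"
      proof (intro always_eventually allI tendsto_mult tendsto_const)
        fix t
        have "eventually (\<lambda>n. s n t = h t) sequentially"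
          using eventually_in_Suc_interval[of t] by eventually_elim (simp add: s_def)
        then show "(\<lambda>n. s n t) \<longlonglongrightarrow> h t" by (rule tendsto_eventually)
      qed
    qed (auto simp: norm_mult s_def indicator_def)
    have pl: "(\<integral>\<^sup>+x. ennreal ((cmod (fourier (s n) x))\<^sup>2) \<partial>lebesgue) \<le> ennreal (L2_sqnorm h)" for n
    proof -
      have "(\<integral>\<^sup>+x. ennreal ((cmod (fourier (s n) x))\<^sup>2) \<partial>lebesgue) = ennreal (L2_sqnorm (s n))"
        by (rule plancherel_interval[OF L12_L2[OF sL], where a="- real (Suc n)" and c="real (Suc n) / pi"])
           (auto simp: s_def)
      also have "L2_sqnorm (s n) \<le> L2_sqnorm h"
        unfolding L2_sqnorm_def
        by (intro integral_mono L2_integrable_sq L12_L2 sL h) (auto simp: s_def indicator_def)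
      finally show ?thesis by (simp add: ennreal_leI)
    qed
    have "(\<integral>\<^sup>+x. ennreal ((cmod (fourier h x))\<^sup>2) \<partial>lebesgue) =
        (\<integral>\<^sup>+x. liminf (\<lambda>n. ennreal ((cmod (fourier (s n) x))\<^sup>2)) \<partial>lebesgue)"
    proof (rule nn_integral_cong)
      fix x
      have "(\<lambda>n. ennreal ((cmod (fourier (s n) x))\<^sup>2)) \<longlonglongrightarrow> ennreal ((cmod (fourier h x))\<^sup>2)"
        by (intro tendsto_ennrealI tendsto_intros lim)
      then show "ennreal ((cmod (fourier h x))\<^sup>2) = liminf (\<lambda>n. ennreal ((cmod (fourier (s n) x))\<^sup>2))"
        by (intro lim_imp_Liminf[symmetric]) auto
    qed
    also have "\<dots> \<le> liminf (\<lambda>n. \<integral>\<^sup>+x. ennreal ((cmod (fourier (s n) x))\<^sup>2) \<partial>lebesgue)"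
      by (rule nn_integral_liminf) auto
    also have "\<dots> \<le> ennreal (L2_sqnorm h)"
      by (intro Liminf_le always_eventually allI pl) auto
    finally show ?thesis .
  qed
  have L: "fourier h \<in> L2" if h: "h \<in> L12" for h
    using le_less_trans[OF le[OF h]] h by (intro L2I fourier_measurable) (auto simp: L12_def L2_def)
  have le': "L2_sqnorm (fourier h) \<le> L2_sqnorm h" if h: "h \<in> L12" for h
    using le[OF h] L2_nn_integral[OF L[OF h]] by simp
  show "fourier f \<in> L2" by (rule L[OF f])
  define s where "s n t = indicator {-real (Suc n)..<real (Suc n)} t * f t" for n t
  have sL: "s n \<in> L12" for n unfolding s_def[abs_def] by (rule L12_indicator_mult[OF f]) auto
  have eq: "L2_sqnorm (fourier (s n)) = L2_sqnorm (s n)" for n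
  proof -
    have "(\<integral>\<^sup>+x. ennreal ((cmod (fourier (s n) x))\<^sup>2) \<partial>lebesgue) = ennreal (L2_sqnorm (s n))"
      by (rule plancherel_interval[OF L12_L2[OF sL], where a="- real (Suc n)" and c="real (Suc n) / pi"])
         (auto simp: s_def)
    then show ?thesis unfolding L2_nn_integral[OF L[OF sL]] by simp
  qed
  have ge: "2 * L2_sqnorm (s n) - L2_sqnorm f \<le> L2_sqnorm (fourier f)" for n
  proof -
    define r where "r t = f t - s n t" for t
    have rL: "r \<in> L12" unfolding r_def[abs_def] by (intro L12_diff f sL)
    have "L2_sqnorm (\<lambda>t. fourier (s n) t + fourier r t) + L2_sqnorm (\<lambda>t. fourier (s n) t - fourier r t) =
        2 * L2_sqnorm (fourier (s n)) + 2 * L2_sqnorm (fourier r)"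
      by (simp add: L2_sqnorm_add L2_sqnorm_diff L sL rL)
    moreover have "fourier (s n) t + fourier r t = fourier f t" for t
      by (subst fourier_add[symmetric]) (auto intro!: L12_integrable sL rL simp: r_def)
    moreover have "fourier (s n) t - fourier r t = fourier (\<lambda>t. s n t - r t) t" for t
      by (subst fourier_diff) (auto intro!: L12_integrable sL rL)
    moreover have "L2_sqnorm (fourier (\<lambda>t. s n t - r t)) \<le> L2_sqnorm (\<lambda>t. s n t - r t)"
      by (intro le' L12_diff sL rL)
    \<comment> \<open>Where \<open>s\<close> is nonzero, \<open>r\<close> vanishes; so \<open>s - r\<close> differs from \<open>f\<close> by a sign only.\<close>
    moreover have "L2_sqnorm (\<lambda>t. s n t - r t) = L2_sqnorm f"
      unfolding L2_sqnorm_def by (intro Bochner_Integration.integral_cong) (auto simp: r_def s_def indicator_def)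
    ultimately show ?thesis using L2_sqnorm_nonneg[of "fourier r"] eq[of n]
      by (simp del: L2_sqnorm_nonneg)
  qed
  have "(\<lambda>n. L2_sqnorm (s n)) \<longlonglongrightarrow> L2_sqnorm f"
    unfolding L2_sqnorm_def
  proof (rule integral_dominated_convergence[where w="\<lambda>t. (cmod (f t))\<^sup>2"])
    show "AE t in lebesgue. (\<lambda>n. (cmod (s n t))\<^sup>2) \<longlonglongrightarrow> (cmod (f t))\<^sup>2"
    proof (intro always_eventually allI tendsto_intros)
      fix t :: real
      have "eventually (\<lambda>n. s n t = f t) sequentially"
        using eventually_in_Suc_interval[of t] by eventually_elim (simp add: s_def)
      then show "(\<lambda>n. s n t) \<longlonglongrightarrow> f t" by (rule tendsto_eventually)
    qed
    show "(\<lambda>t. (cmod (s n t))\<^sup>2) \<in> borel_measurable lebesgue" for n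
      using L2_integrable_sq[OF L12_L2[OF sL]] by auto
    show "(\<lambda>t. (cmod (f t))\<^sup>2) \<in> borel_measurable lebesgue" "integrable lebesgue (\<lambda>t. (cmod (f t))\<^sup>2)"
      using L2_integrable_sq[OF L12_L2[OF f]] by auto
  qed (auto simp: s_def indicator_def)
  then have "(\<lambda>n. 2 * L2_sqnorm (s n) - L2_sqnorm f) \<longlonglongrightarrow> 2 * L2_sqnorm f - L2_sqnorm f"
    by (intro tendsto_intros)
  then have "2 * L2_sqnorm f - L2_sqnorm f \<le> L2_sqnorm (fourier f)"
    by (rule LIMSEQ_le_const2) (use ge in auto)
  then show "L2_sqnorm (fourier f) = L2_sqnorm f" using le'[OF f] by simp
qed

section \<open>The inverse transform and orthonormal bases\<close>

lemma L2_reflect: 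
  assumes "f \<in> L2" 
  shows "(\<lambda>t. f (- t)) \<in> L2" "L2_sqnorm (\<lambda>t. f (- t)) = L2_sqnorm f"
proof -
  have fm: "f \<in> borel_measurable lebesgue" using assms by (simp add: L2_def)
  have "(\<lambda>t. f (- t)) \<in> borel_measurable lebesgue"
    using measurable_compose[OF measurable_lebesgue_affine fm, of "-1" 0] by simp
  moreover have "integrable lebesgue (\<lambda>t. (cmod (f (- t)))\<^sup>2)"
    using lebesgue_integrable_real_affine[of "\<lambda>t. (cmod (f t))\<^sup>2" "-1" 0] assms by (simp add: L2_def)
  ultimately show "(\<lambda>t. f (- t)) \<in> L2" by (simp add: L2_def)
  show "L2_sqnorm (\<lambda>t. f (- t)) = L2_sqnorm f"
    unfolding L2_sqnorm_def using lebesgue_integral_real_affine[of "-1" "\<lambda>t. (cmod (f t))\<^sup>2" 0] by simp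
qed

text \<open>The inverse transform is the transform followed by a reflection, so it inherits the isometry.\<close>

definition cofourier :: "(real \<Rightarrow> complex) \<Rightarrow> real \<Rightarrow> complex" where
  "cofourier g t = fourier g (- t)"

lemma cofourier_L2: "g \<in> L12 \<Longrightarrow> cofourier g \<in> L2"
  unfolding cofourier_def[abs_def] by (rule L2_reflect(1)[OF plancherel(1)])

lemma cofourier_sqnorm: "g \<in> L12 \<Longrightarrow> L2_sqnorm (cofourier g) = L2_sqnorm g"
  unfolding cofourier_def[abs_def] by (simp add: L2_reflect(2)[OF plancherel(1)] plancherel(2))

lemma cofourier_diff: "f \<in> L12 \<Longrightarrow> g \<in> L12 \<Longrightarrow>
    cofourier (\<lambda>t. f t - g t) x = cofourier f x - cofourier g x"
  by (simp add: cofourier_def fourier_diff L12_integrable)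

lemma cofourier_lincomb: "finite I \<Longrightarrow> (\<And>i. i \<in> I \<Longrightarrow> u i \<in> L12) \<Longrightarrow>
    cofourier (\<lambda>t. \<Sum>i\<in>I. c i * u i t) x = (\<Sum>i\<in>I. c i * cofourier (u i) x)"
  by (simp add: cofourier_def fourier_sum fourier_cmult L12_integrable)

lemma cofourier_sqdist:
  assumes "f \<in> L12" "g \<in> L12"
  shows "L2_sqdist (cofourier f) (cofourier g) = L2_sqdist f g"
proof -
  have "(\<lambda>t. cofourier f t - cofourier g t) = cofourier (\<lambda>t. f t - g t)"
    using assms by (simp add: cofourier_diff fun_eq_iff)
  then have "L2_sqdist (cofourier f) (cofourier g) = ennreal (L2_sqnorm (cofourier (\<lambda>t. f t - g t)))"
    using assms by (simp add: L2_sqdist_eq cofourier_L2)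
  also have "\<dots> = L2_sqdist f g"
    using assms by (simp add: cofourier_sqnorm L12_diff L2_sqdist_eq L12_L2)
  finally show ?thesis .
qed

text \<open>The inner product is determined by norms.\<close>

lemma L2_inner_polarization:
  assumes "f \<in> L2" "g \<in> L2" "f' \<in> L2" "g' \<in> L2"
    and "L2_sqnorm f = L2_sqnorm f'" "L2_sqnorm g = L2_sqnorm g'"
    and "L2_sqnorm (\<lambda>t. f t - g t) = L2_sqnorm (\<lambda>t. f' t - g' t)"
    and "L2_sqnorm (\<lambda>t. f t - \<i> * g t) = L2_sqnorm (\<lambda>t. f' t - \<i> * g' t)"
  shows "L2_inner f g = L2_inner f' g'"
proof (rule complex_eqI)
  show "Re (L2_inner f g) = Re (L2_inner f' g')"
    using assms by (simp add: L2_sqnorm_diff)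
  have "Re (L2_inner f (\<lambda>t. \<i> * g t)) = Re (L2_inner f' (\<lambda>t. \<i> * g' t))"
    using assms by (simp add: L2_sqnorm_diff L2_cmult L2_sqnorm_cmult)
  then show "Im (L2_inner f g) = Im (L2_inner f' g')"
    by (simp add: L2_inner_cmult_right)
qed

lemma cofourier_inner:
  assumes f: "f \<in> L12" and g: "g \<in> L12"
  shows "L2_inner (cofourier f) (cofourier g) = L2_inner f g"
proof -
  have ig: "(\<lambda>t. \<i> * g t) \<in> L12" using g by (rule L12_cmult)
  have "cofourier (\<lambda>t. \<i> * g t) x = \<i> * cofourier g x" for x by (simp add: cofourier_def fourier_cmult)
  then have "L2_sqnorm (\<lambda>t. cofourier f t - \<i> * cofourier g t) = L2_sqnorm (cofourier (\<lambda>t. f t - \<i> * g t))"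
    by (simp add: cofourier_diff[OF f ig, abs_def])
  moreover have "L2_sqnorm (\<lambda>t. cofourier f t - cofourier g t) = L2_sqnorm (cofourier (\<lambda>t. f t - g t))"
    by (simp add: cofourier_diff[OF f g, abs_def])
  ultimately show ?thesis
    by (intro L2_inner_polarization)
       (simp_all add: f g ig L12_L2 L12_diff cofourier_L2 cofourier_sqnorm)
qed

text \<open>Fubini's theorem for \<open>exp(-i t x) s(t) cnj (g x)\<close>: on integrable functions \<^const>\<open>cofourier\<close> is adjoint to
\<^const>\<open>fourier\<close>.\<close>

lemma L2_inner_cofourier:
  assumes s: "s \<in> L12" and g: "g \<in> L12"
  shows "L2_inner s (cofourier g) = L2_inner (fourier s) g"
proof -
  define K where "K x t = exp (- \<i> * of_real (t * x)) * s t * cnj (g x)" for x t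
  have sm [measurable]: "s \<in> borel_measurable lebesgue" and gm [measurable]: "g \<in> borel_measurable lebesgue"
    using s g by (auto simp: L12_def L2_def)
  have cg: "(\<lambda>x. cnj (g x)) \<in> borel_measurable lebesgue" by measurable
  have "(\<lambda>p. cnj (g (fst p))) \<in> borel_measurable (lebesgue \<Otimes>\<^sub>M lebesgue :: (real \<times> real) measure)"
    by (rule measurable_compose[OF measurable_fst cg])
  from borel_measurable_times[OF fourier_kernel_measurable[OF sm] this]
  have Km: "case_prod K \<in> borel_measurable (lebesgue \<Otimes>\<^sub>M lebesgue)"
    by (simp add: K_def split_beta')
  have nK: "norm (K x t) = cmod (s t) * cmod (g x)" for x t by (simp add: K_def norm_mult)
  have iK: "integrable (lebesgue \<Otimes>\<^sub>M lebesgue) (case_prod K)"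
  proof (rule lebesgue_pair.Fubini_integrable[OF Km])
    show "integrable lebesgue (\<lambda>x. \<integral>t. norm (case (x, t) of (x, t) \<Rightarrow> K x t) \<partial>lebesgue)"
      using L12_integrable[OF g] by (simp add: nK)
    show "AE x in lebesgue. integrable lebesgue (\<lambda>t. case (x, t) of (x, t) \<Rightarrow> K x t)"
    proof (intro always_eventually allI)
      fix x
      have "integrable lebesgue (\<lambda>t. exp (- \<i> * of_real (t * x)) * s t * cnj (g x))"
        by (intro integrable_mult_left integrable_exp_mult L12_integrable s)
      then show "integrable lebesgue (\<lambda>t. case (x, t) of (x, t) \<Rightarrow> K x t)" by (simp add: K_def)
    qed
  qed
  let ?c = "complex_of_real (1 / sqrt (2 * pi))"
  have "L2_inner s (cofourier g) = (\<integral>t. ?c * (\<integral>x. K x t \<partial>lebesgue) \<partial>lebesgue)"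
    unfolding L2_inner_def
  proof (rule Bochner_Integration.integral_cong[OF refl])
    fix t
    have "cnj (cofourier g t) = ?c * (\<integral>x. cnj (exp (- \<i> * of_real (x * - t)) * g x) \<partial>lebesgue)"
      unfolding cofourier_def fourier_def by (subst Bochner_Integration.integral_cnj) simp
    also have "(\<integral>x. cnj (exp (- \<i> * of_real (x * - t)) * g x) \<partial>lebesgue) =
        (\<integral>x. exp (- \<i> * of_real (t * x)) * cnj (g x) \<partial>lebesgue)"
      by (rule Bochner_Integration.integral_cong[OF refl]) (simp add: exp_cnj mult.commute)
    finally have "s t * cnj (cofourier g t) = ?c * (\<integral>x. s t * (exp (- \<i> * of_real (t * x)) * cnj (g x)) \<partial>lebesgue)"
      by simp
    also have "(\<integral>x. s t * (exp (- \<i> * of_real (t * x)) * cnj (g x)) \<partial>lebesgue) = (\<integral>x. K x t \<partial>lebesgue)"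
      by (rule Bochner_Integration.integral_cong[OF refl]) (simp add: K_def)
    finally show "s t * cnj (cofourier g t) = ?c * (\<integral>x. K x t \<partial>lebesgue)" .
  qed
  also have "\<dots> = ?c * (\<integral>t. (\<integral>x. K x t \<partial>lebesgue) \<partial>lebesgue)" by simp
  also have "(\<integral>t. (\<integral>x. K x t \<partial>lebesgue) \<partial>lebesgue) = (\<integral>x. (\<integral>t. K x t \<partial>lebesgue) \<partial>lebesgue)"
    by (rule lebesgue_pair.Fubini_integral[OF iK])
  also have "?c * \<dots> = (\<integral>x. ?c * (\<integral>t. K x t \<partial>lebesgue) \<partial>lebesgue)" by simp
  also have "\<dots> = L2_inner (fourier s) g"
    unfolding L2_inner_def fourier_def K_def by simp
  finally show ?thesis .
qed

text \<open>Expanding both squares, the norms agree by Plancherel's identity and the mixed terms by adjointness.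
This transfers approximation between time and frequency and replaces Fourier inversion.\<close>

lemma sqdist_cofourier:
  assumes s: "s \<in> L12" and g: "g \<in> L12"
  shows "L2_sqdist s (cofourier g) = L2_sqdist (fourier s) g"
  using assms
  by (simp add: L2_sqdist_eq L12_L2 cofourier_L2 plancherel L2_sqnorm_diff cofourier_sqnorm L2_inner_cofourier)

lemma is_L2_fourier_cofourier:
  assumes g: "g \<in> L12"
  shows "is_L2_fourier (cofourier g) g"
  unfolding is_L2_fourier_def
proof (intro conjI exI allI)
  define s where "s n t = indicator {-real n..<real n} t * cofourier g t" for n t
  have sL: "s n \<in> L12" for n
    unfolding s_def[abs_def] by (intro L2_restrict_L12 cofourier_L2 g lmeasurable_Ico)
  show "s n \<in> L2" "integrable lebesgue (s n)" for n using sL by (auto simp: L12_def)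
  show conv: "(\<lambda>n. L2_sqdist (s n) (cofourier g)) \<longlonglongrightarrow> 0"
    unfolding s_def[abs_def] by (rule L2_truncate_tendsto[OF cofourier_L2[OF g] _ eventually_in_interval]) auto
  then show "(\<lambda>n. L2_sqdist (fourier (s n)) g) \<longlonglongrightarrow> 0"
    by (simp add: sqdist_cofourier sL g)
qed (use g in \<open>auto intro: cofourier_L2 L12_L2\<close>)

text \<open>The approximants of \<open>w\<close> are as close to \<open>cofourier g\<close> as their transforms are to \<open>g\<close>.\<close>

lemma is_L2_fourier_unique:
  assumes w: "is_L2_fourier w g" and g: "g \<in> L12"
  shows "AE t in lebesgue. w t = cofourier g t"
proof -
  from w obtain s where wL: "w \<in> L2" and sL: "\<And>n::nat. s n \<in> L12"
    and s1: "(\<lambda>n. L2_sqdist (s n) w) \<longlonglongrightarrow> 0" and s2: "(\<lambda>n. L2_sqdist (fourier (s n)) g) \<longlonglongrightarrow> 0"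
    unfolding is_L2_fourier_def L12_def by auto
  have le: "L2_sqdist w (cofourier g) \<le> 2 * L2_sqdist (s n) w + 2 * L2_sqdist (fourier (s n)) g" for n
    using L2_sqdist_triangle[OF wL L12_L2[OF sL[of n]] cofourier_L2[OF g]]
    by (simp add: L2_sqdist_commute[of w] sqdist_cofourier sL g)
  have "(\<lambda>n. 2 * L2_sqdist (s n) w + 2 * L2_sqdist (fourier (s n)) g) \<longlonglongrightarrow> 2 * 0 + 2 * 0"
    by (intro tendsto_add ennreal_tendsto_cmult s1 s2) auto
  then have "L2_sqdist w (cofourier g) \<le> 2 * 0 + 2 * 0"
    by (rule LIMSEQ_le_const) (use le in auto)
  then show ?thesis by (intro L2_sqdist_eq_0_AE wL cofourier_L2 g) simp
qed

lemma orthonormal_basis_L2_alt: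
  "orthonormal_basis_L2 u \<longleftrightarrow> orthonormal_L2 u \<and>
    (\<forall>f\<in>L2. \<forall>e>0. \<exists>I c. finite I \<and> L2_sqdist f (\<lambda>t. \<Sum>i\<in>I. c i * u i t) < e)"
  by (auto simp: orthonormal_basis_L2_def orthonormal_L2_def)

lemma L2_approx_chain3:
  assumes "f \<in> L2" "g \<in> L2" "h \<in> L2" "0 < e" "ennreal d \<le> e" "0 < d"
    "L2_sqdist f g < ennreal (d / 4)" "L2_sqdist g h < ennreal (d / 4)"
  shows "L2_sqdist f h < e"
  using L2_approx_chain[OF assms(1-3) assms(7,8,6)] assms(5) by (rule less_le_trans)

text \<open>In both directions the function to be approximated is first truncated to \<^const>\<open>L12\<close>, then moved to
the other side, approximated there, and moved back by \<open>sqdist_cofourier\<close> or \<open>cofourier_sqdist\<close>.\<close>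

theorem orthonormal_basis_cofourier_iff:
  assumes g: "\<And>i. g i \<in> L12"
  shows "orthonormal_basis_L2 (\<lambda>i. cofourier (g i)) \<longleftrightarrow> orthonormal_basis_L2 g"
proof -
  have lc: "(\<lambda>t. \<Sum>i\<in>I. c i * g i t) \<in> L12" for I c by (intro L12_sum L12_cmult g)
  have clc: "(\<lambda>t. \<Sum>i\<in>I. c i * cofourier (g i) t) = cofourier (\<lambda>t. \<Sum>i\<in>I. c i * g i t)" if "finite I" for I c
    by (rule ext) (simp add: cofourier_lincomb that g)
  have "orthonormal_L2 (\<lambda>i. cofourier (g i)) \<longleftrightarrow> orthonormal_L2 g"
    by (simp add: orthonormal_L2_def cofourier_inner cofourier_L2 L12_L2 g)
  moreover have "\<exists>I c. finite I \<and> L2_sqdist f (\<lambda>t. \<Sum>i\<in>I. c i * cofourier (g i) t) < e"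
    if H: "\<forall>f\<in>L2. \<forall>e>0. \<exists>I c. finite I \<and> L2_sqdist f (\<lambda>t. \<Sum>i\<in>I. c i * g i t) < e"
      and f: "f \<in> L2" and e: "0 < e" for f e
  proof -
    obtain d where d: "0 < d" "ennreal d \<le> e" by (rule ennreal_pos_real_below[OF e])
    obtain f' where f': "f' \<in> L12" "L2_sqdist f f' < ennreal (d / 4)"
      using L2_approx_L12[OF f, of "ennreal (d / 4)"] d by auto
    obtain I c where I: "finite I" "L2_sqdist (fourier f') (\<lambda>t. \<Sum>i\<in>I. c i * g i t) < ennreal (d / 4)"
      using H[rule_format, OF plancherel(1)[OF f'(1)], of "ennreal (d / 4)"] d by auto
    have "L2_sqdist f' (\<lambda>t. \<Sum>i\<in>I. c i * cofourier (g i) t) < ennreal (d / 4)"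
      unfolding clc[OF I(1)] sqdist_cofourier[OF f'(1) lc] by (rule I(2))
    note near = this
    have "L2_sqdist f (\<lambda>t. \<Sum>i\<in>I. c i * cofourier (g i) t) < e"
      by (rule L2_approx_chain3[OF f L12_L2[OF f'(1)] _ e d(2,1) f'(2) near])
         (auto simp: clc[OF I(1)] intro!: cofourier_L2 lc)
    then show ?thesis using I(1) by blast
  qed
  moreover have "\<exists>I c. finite I \<and> L2_sqdist f (\<lambda>t. \<Sum>i\<in>I. c i * g i t) < e"
    if H: "\<forall>f\<in>L2. \<forall>e>0. \<exists>I c. finite I \<and> L2_sqdist f (\<lambda>t. \<Sum>i\<in>I. c i * cofourier (g i) t) < e"
      and f: "f \<in> L2" and e: "0 < e" for f e
  proof -
    obtain d where d: "0 < d" "ennreal d \<le> e" by (rule ennreal_pos_real_below[OF e])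
    obtain f' where f': "f' \<in> L12" "L2_sqdist f f' < ennreal (d / 4)"
      using L2_approx_L12[OF f, of "ennreal (d / 4)"] d by auto
    obtain I c where I: "finite I" "L2_sqdist (cofourier f') (\<lambda>t. \<Sum>i\<in>I. c i * cofourier (g i) t) < ennreal (d / 4)"
      using H[rule_format, OF cofourier_L2[OF f'(1)], of "ennreal (d / 4)"] d by auto
    have "L2_sqdist f' (\<lambda>t. \<Sum>i\<in>I. c i * g i t) < ennreal (d / 4)"
      using I(2) unfolding clc[OF I(1)] cofourier_sqdist[OF f'(1) lc] .
    note near = this
    have "L2_sqdist f (\<lambda>t. \<Sum>i\<in>I. c i * g i t) < e"
      by (rule L2_approx_chain3[OF f L12_L2[OF f'(1)] L12_L2[OF lc] e d(2,1) f'(2) near])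
    then show ?thesis using I(1) by blast
  qed
  ultimately show ?thesis unfolding orthonormal_basis_L2_alt by blast
qed

lemma orthonormal_basis_L2_cong_AE:
  assumes ae: "\<And>i. AE t in lebesgue. u i t = v i t" and u: "\<And>i. u i \<in> L2" and v: "\<And>i. v i \<in> L2"
    and basis: "orthonormal_basis_L2 u"
  shows "orthonormal_basis_L2 v"
  unfolding orthonormal_basis_L2_def
proof (intro conjI allI ballI impI)
  show "v i \<in> L2" for i by (rule v)
  show "L2_inner (v i) (v i') = (if i = i' then 1 else 0)" for i i'
    using basis L2_inner_cong_AE[OF ae ae u u v v, of i i'] by (simp add: orthonormal_basis_L2_def)
  fix f :: "real \<Rightarrow> complex" and e :: ennreal assume "f \<in> L2" "0 < e"
  then obtain I c where I: "finite I" "L2_sqdist f (\<lambda>t. \<Sum>i\<in>I. c i * u i t) < e"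
    using basis unfolding orthonormal_basis_L2_def by blast
  have "AE t in lebesgue. \<forall>i\<in>I. u i t = v i t"
    using I(1) ae by (intro AE_finite_allI)
  then have "AE t in lebesgue. (\<Sum>i\<in>I. c i * u i t) = (\<Sum>i\<in>I. c i * v i t)"
    by eventually_elim (simp cong: sum.cong)
  from L2_sqdist_cong_AE[OF _ this, of f f] I show "\<exists>I c. finite I \<and> L2_sqdist f (\<lambda>t. \<Sum>i\<in>I. c i * v i t) < e"
    by auto
qed

section \<open>Reduction modulo a period\<close>

text \<open>Stated for preimages, so that it yields measurability of affine images as well.\<close>

lemma emeasure_affine_vimage:
  assumes "c \<noteq> 0" and S: "S \<in> sets lebesgue"
  shows "emeasure lebesgue S = ennreal \<bar>c\<bar> * emeasure lebesgue {x::real. a + c * x \<in> S}"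
    and "{x::real. a + c * x \<in> S} \<in> sets lebesgue"
proof -
  show m: "{x. a + c * x \<in> S} \<in> sets lebesgue"
    using measurable_sets[OF measurable_lebesgue_affine[OF assms(1)] S, of a] by (simp add: vimage_def)
  have "(\<integral>\<^sup>+x. indicator S x \<partial>lebesgue) = ennreal \<bar>c\<bar> * (\<integral>\<^sup>+x. indicator S (a + c * x) \<partial>lebesgue)"
    using assms by (intro nn_integral_real_affine_lebesgue) auto
  also have "(\<integral>\<^sup>+x. indicator S (a + c * x) \<partial>lebesgue) = (\<integral>\<^sup>+x. indicator {x. a + c * x \<in> S} x \<partial>lebesgue)"
    by (intro nn_integral_cong) (auto simp: indicator_def)
  finally show "emeasure lebesgue S = ennreal \<bar>c\<bar> * emeasure lebesgue {x::real. a + c * x \<in> S}"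
    using m S by simp
qed

lemma null_sets_affine_vimage:
  assumes "c \<noteq> 0" and S: "S \<in> null_sets lebesgue"
  shows "{x::real. a + c * x \<in> S} \<in> null_sets lebesgue"
  using emeasure_affine_vimage[of c S a] assms by (auto simp: null_sets_def)

lemma AE_lebesgue_affine:
  assumes "c \<noteq> 0" and P: "AE x in lebesgue. P (x::real)"
  shows "AE x in lebesgue. P (a + c * x)"
proof -
  from P obtain N where N: "{x. \<not> P x} \<subseteq> N" "N \<in> null_sets lebesgue"
    by (auto simp: eventually_ae_filter)
  show ?thesis
    using N by (intro AE_I'[OF null_sets_affine_vimage[OF assms(1) N(2)]]) auto
qed

definition periodic_injective :: "real set \<Rightarrow> bool" where
  "periodic_injective T \<longleftrightarrow> (\<forall>x\<in>T. \<forall>j::int. x + of_int j * (2*pi) \<in> T \<longrightarrow> j = 0)"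

text \<open>The representatives in \<open>[0, 2\<pi>)\<close> of the classes modulo \<open>2\<pi>\<close> that \<open>T\<close> meets.\<close>

definition folded :: "real set \<Rightarrow> real set" where
  "folded T = {x \<in> {0..<2*pi}. \<exists>j::int. x + of_int j * (2*pi) \<in> T}"

text \<open>Sends a representative back to a point of \<open>T\<close> in its class.  For \<^const>\<open>periodic_injective\<close> \<open>T\<close> this point
is unique, and the map is the inverse of reduction modulo \<open>2\<pi>\<close>.\<close>

definition unroll :: "real set \<Rightarrow> real \<Rightarrow> real" where
  "unroll T x = x + of_int (SOME j. x + of_int j * (2*pi) \<in> T) * (2*pi)"

lemma unroll_in: "x \<in> folded T \<Longrightarrow> unroll T x \<in> T"
  unfolding folded_def unroll_def by (auto intro: someI)

lemma unroll_eq: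
  assumes "periodic_injective T" "x + of_int j * (2*pi) \<in> T"
  shows "unroll T x = x + of_int j * (2*pi)"
proof -
  have "(SOME j. x + of_int j * (2*pi) \<in> T) = j"
  proof (rule some_equality)
    fix i :: int assume "x + of_int i * (2*pi) \<in> T"
    then have "(x + of_int j * (2*pi)) + of_int (i - j) * (2*pi) \<in> T" by (simp add: algebra_simps)
    then have "i - j = 0" using assms unfolding periodic_injective_def by blast
    then show "i = j" by simp
  qed (rule assms(2))
  then show ?thesis by (simp add: unroll_def)
qed

lemma cis_unroll: "cis (of_int k * unroll T x) = cis (of_int k * x)"
proof -
  have "cis (of_int k * (x + of_int n * (2*pi))) = cis (of_int k * x) * cis (2 * pi * of_int (k * n))" for n
    by (simp add: cis_mult algebra_simps)
  then show ?thesis unfolding unroll_def by (simp add: cis_multiple_2pi)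
qed

lemma unroll_vimage:
  assumes "periodic_injective T" "A \<subseteq> T"
  shows "unroll T -` A \<inter> folded T = (\<Union>j::int. {0..<2*pi} \<inter> {x. of_int j * (2*pi) + 1 * x \<in> A})"
proof (intro set_eqI iffI)
  fix x assume x: "x \<in> unroll T -` A \<inter> folded T"
  then obtain j :: int where j: "x + of_int j * (2*pi) \<in> T" by (auto simp: folded_def)
  from unroll_eq[OF assms(1) j] x show "x \<in> (\<Union>j::int. {0..<2*pi} \<inter> {x. of_int j * (2*pi) + 1 * x \<in> A})"
    by (auto simp: folded_def add.commute intro!: exI[of _ j])
next
  fix x assume "x \<in> (\<Union>j::int. {0..<2*pi} \<inter> {x. of_int j * (2*pi) + 1 * x \<in> A})"
  then obtain j :: int where x: "x \<in> {0..<2*pi}" and j: "x + of_int j * (2*pi) \<in> A" by (auto simp: add.commute)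
  then have "x + of_int j * (2*pi) \<in> T" using assms(2) by auto
  with unroll_eq[OF assms(1) this] x j show "x \<in> unroll T -` A \<inter> folded T" by (auto simp: folded_def)
qed

lemma fold_piece_sets:
  "A \<in> sets lebesgue \<Longrightarrow> {0..<2*pi} \<inter> {x. of_int j * (2*pi) + 1 * x \<in> A} \<in> sets lebesgue"
  by (rule sets.Int[OF _ emeasure_affine_vimage(2)]) auto

lemma folded_sets:
  assumes "T \<in> sets lebesgue" shows "folded T \<in> sets lebesgue"
proof -
  have "folded T = (\<Union>j::int. {0..<2*pi} \<inter> {x. of_int j * (2*pi) + 1 * x \<in> T})"
    by (auto simp: folded_def add.commute)
  also have "\<dots> \<in> sets lebesgue"
    by (intro sets.countable_UN'' fold_piece_sets assms) simp
  finally show ?thesis .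
qed

text \<open>Reduction modulo \<open>2\<pi>\<close> is a translation on each of countably many pieces, hence preserves measure as soon
as it is injective.\<close>

lemma distr_unroll:
  assumes T: "T \<in> sets lebesgue" and inj: "periodic_injective T"
  shows "unroll T \<in> lebesgue_on (folded T) \<rightarrow>\<^sub>M lebesgue_on T"
    and "distr (lebesgue_on (folded T)) (lebesgue_on T) (unroll T) = lebesgue_on T"
proof -
  have V: "folded T \<in> sets lebesgue" by (rule folded_sets[OF T])
  have pre: "unroll T -` A \<inter> folded T \<in> sets lebesgue" if A: "A \<in> sets lebesgue" "A \<subseteq> T" for A
    unfolding unroll_vimage[OF inj A(2)]
    by (intro sets.countable_UN'' fold_piece_sets A) simp
  show m: "unroll T \<in> lebesgue_on (folded T) \<rightarrow>\<^sub>M lebesgue_on T"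
  proof (rule measurableI)
    fix A assume "A \<in> sets (lebesgue_on T)"
    then have "A \<in> sets lebesgue" "A \<subseteq> T" using T by (auto simp: sets_restrict_space_iff)
    from pre[OF this] show "unroll T -` A \<inter> space (lebesgue_on (folded T)) \<in> sets (lebesgue_on (folded T))"
      using V by (auto simp: sets_restrict_space_iff)
  qed (auto intro: unroll_in)
  show "distr (lebesgue_on (folded T)) (lebesgue_on T) (unroll T) = lebesgue_on T"
  proof (rule measure_eqI)
    fix A assume "A \<in> sets (distr (lebesgue_on (folded T)) (lebesgue_on T) (unroll T))"
    then have AT: "A \<in> sets (lebesgue_on T)" by simp
    then have A: "A \<in> sets lebesgue" "A \<subseteq> T" using T by (auto simp: sets_restrict_space_iff)
    have "emeasure (distr (lebesgue_on (folded T)) (lebesgue_on T) (unroll T)) A =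
        emeasure (lebesgue_on (folded T)) (unroll T -` A \<inter> folded T)"
      by (subst emeasure_distr[OF m AT]) simp
    also have "\<dots> = emeasure lebesgue (\<Union>j::int. {0..<2*pi} \<inter> {x. of_int j * (2*pi) + 1 * x \<in> A})"
      unfolding unroll_vimage[OF inj A(2), symmetric]
      using V by (subst emeasure_restrict_space) auto
    also have "\<dots> = (\<integral>\<^sup>+j. emeasure lebesgue ({0..<2*pi} \<inter> {x. of_int j * (2*pi) + 1 * x \<in> A}) \<partial>count_space (UNIV :: int set))"
    proof (rule emeasure_UN_countable)
      show "{0..<2*pi} \<inter> {x. of_int j * (2*pi) + 1 * x \<in> A} \<in> sets lebesgue" for j :: int
        by (rule fold_piece_sets[OF A(1)])
      show "disjoint_family_on (\<lambda>j::int. {0..<2*pi} \<inter> {x. of_int j * (2*pi) + 1 * x \<in> A}) UNIV"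
      proof (unfold disjoint_family_on_def, intro ballI impI)
        fix i j :: int assume "i \<noteq> j"
        show "({0..<2*pi} \<inter> {x. of_int i * (2*pi) + 1 * x \<in> A}) \<inter> ({0..<2*pi} \<inter> {x. of_int j * (2*pi) + 1 * x \<in> A}) = {}"
        proof (rule ccontr)
          assume "\<not> ?thesis"
          then obtain x where "x + of_int i * (2*pi) \<in> T" "x + of_int j * (2*pi) \<in> T"
            using A(2) by (auto simp: add.commute)
          then have "of_int i * (2*pi) = of_int j * (2*pi)"
            using unroll_eq[OF inj] by (metis add_left_cancel)
          then show False using \<open>i \<noteq> j\<close> by simp
        qed
      qed
    qed auto
    also have "\<dots> = (\<integral>\<^sup>+j. (\<integral>\<^sup>+x. indicator A (x + of_int j * (2*pi)) * indicator {0..<2*pi} x \<partial>lebesgue) \<partial>count_space (UNIV :: int set))"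
    proof (rule nn_integral_cong)
      fix j :: int
      have "{0..<2*pi} \<inter> {x. of_int j * (2*pi) + 1 * x \<in> A} \<in> sets lebesgue"
        by (rule fold_piece_sets[OF A(1)])
      then have "emeasure lebesgue ({0..<2*pi} \<inter> {x. of_int j * (2*pi) + 1 * x \<in> A}) =
          (\<integral>\<^sup>+x. indicator ({0..<2*pi} \<inter> {x. of_int j * (2*pi) + 1 * x \<in> A}) x \<partial>lebesgue)" by simp
      also have "\<dots> = (\<integral>\<^sup>+x. indicator A (x + of_int j * (2*pi)) * indicator {0..<2*pi} x \<partial>lebesgue)"
        by (intro nn_integral_cong) (auto simp: indicator_def add.commute)
      finally show "emeasure lebesgue ({0..<2*pi} \<inter> {x. of_int j * (2*pi) + 1 * x \<in> A}) = \<dots>" .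
    qed
    also have "\<dots> = (\<integral>\<^sup>+x. indicator A x \<partial>lebesgue)"
      by (rule nn_integral_split_period[symmetric]) (use A in auto)
    also have "\<dots> = emeasure (lebesgue_on T) A"
      using A T by (subst emeasure_restrict_space) auto
    finally show "emeasure (distr (lebesgue_on (folded T)) (lebesgue_on T) (unroll T)) A = emeasure (lebesgue_on T) A" .
  qed simp
qed

lemma integral_unroll:
  fixes f :: "real \<Rightarrow> 'a::euclidean_space"
  assumes T: "T \<in> sets lebesgue" and inj: "periodic_injective T"
    and f: "f \<in> borel_measurable lebesgue" and supp: "\<And>x. x \<notin> T \<Longrightarrow> f x = 0"
  shows "(\<integral>x. (if x \<in> folded T then f (unroll T x) else 0) \<partial>lebesgue) = (\<integral>x. f x \<partial>lebesgue)"
    and "integrable lebesgue f \<Longrightarrow> integrable lebesgue (\<lambda>x. if x \<in> folded T then f (unroll T x) else 0)"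
    and "(\<lambda>x. if x \<in> folded T then f (unroll T x) else 0) \<in> borel_measurable lebesgue"
proof -
  note V = folded_sets[OF T]
  note D = distr_unroll[OF T inj]
  have fT: "f \<in> borel_measurable (lebesgue_on T)" using f by (rule measurable_restrict_space1)
  have f_if: "(\<lambda>x. if x \<in> T then f x else 0) = f" using supp by auto
  have "(\<integral>x. (if x \<in> folded T then f (unroll T x) else 0) \<partial>lebesgue) = (\<integral>x. f (unroll T x) \<partial>lebesgue_on (folded T))"
    using V by (rule Lebesgue_Measure.integral_restrict_UNIV)
  also have "\<dots> = (\<integral>x. f x \<partial>distr (lebesgue_on (folded T)) (lebesgue_on T) (unroll T))"
    by (rule integral_distr[symmetric, OF D(1) fT])
  also have "\<dots> = (\<integral>x. (if x \<in> T then f x else 0) \<partial>lebesgue)"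
    unfolding D(2) using T by (rule Lebesgue_Measure.integral_restrict_UNIV[symmetric])
  finally show "(\<integral>x. (if x \<in> folded T then f (unroll T x) else 0) \<partial>lebesgue) = (\<integral>x. f x \<partial>lebesgue)"
    by (simp only: f_if)
  show "(\<lambda>x. if x \<in> folded T then f (unroll T x) else 0) \<in> borel_measurable lebesgue"
    using measurable_compose[OF D(1) fT] V by (rule borel_measurable_if_I)
  assume "integrable lebesgue f"
  then have "integrable (lebesgue_on T) f"
    using T by (subst (asm) f_if[symmetric]) (simp add: Lebesgue_Measure.integrable_restrict_UNIV)
  then have "integrable (distr (lebesgue_on (folded T)) (lebesgue_on T) (unroll T)) f" by (simp add: D(2))
  then have "integrable (lebesgue_on (folded T)) (\<lambda>x. f (unroll T x))"
    by (subst (asm) integrable_distr_eq[OF D(1) fT])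
  then show "integrable lebesgue (\<lambda>x. if x \<in> folded T then f (unroll T x) else 0)"
    using V by (simp add: Lebesgue_Measure.integrable_restrict_UNIV)
qed

lemma emeasure_folded:
  assumes T: "T \<in> sets lebesgue" and inj: "periodic_injective T"
  shows "emeasure lebesgue (folded T) = emeasure lebesgue T"
proof -
  note D = distr_unroll[OF T inj]
  have "emeasure (lebesgue_on T) T = emeasure (distr (lebesgue_on (folded T)) (lebesgue_on T) (unroll T)) T"
    by (simp add: D(2))
  also have "\<dots> = emeasure (lebesgue_on (folded T)) (unroll T -` T \<inter> folded T)"
    by (subst emeasure_distr[OF D(1)]) auto
  also have "unroll T -` T \<inter> folded T = folded T" by (auto intro: unroll_in)
  finally show ?thesis using T folded_sets[OF T] by (simp add: emeasure_restrict_space)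
qed

text \<open>The exponentials are constant on classes modulo \<open>2\<pi>\<close>, so transporting \<open>f\<close> to \<open>[0, 2\<pi>)\<close> along
\<^const>\<open>unroll\<close> changes neither its norm nor its Fourier coefficients.\<close>

theorem parseval_periodic_injective:
  assumes T: "T \<in> sets lebesgue" and inj: "periodic_injective T"
    and f: "f \<in> L2" and supp: "\<And>x. x \<notin> T \<Longrightarrow> f x = 0"
  shows "(\<integral>\<^sup>+k. ennreal ((cmod (\<integral>y. f y * cis (of_int k * y) \<partial>lebesgue))\<^sup>2) \<partial>count_space (UNIV :: int set)) =
    ennreal (2 * pi * L2_sqnorm f)"
proof -
  have fm: "f \<in> borel_measurable lebesgue" using f by (simp add: L2_def)
  define H where "H x = (if x \<in> folded T then f (unroll T x) else 0)" for x
  have Hm: "H \<in> borel_measurable lebesgue"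
    unfolding H_def[abs_def] by (rule integral_unroll(3)[OF T inj fm supp])
  have sq: "(cmod (H x))\<^sup>2 = (if x \<in> folded T then (cmod (f (unroll T x)))\<^sup>2 else 0)" for x
    by (simp add: H_def)
  have sqm: "(\<lambda>x. (cmod (f x))\<^sup>2) \<in> borel_measurable lebesgue" using L2_integrable_sq[OF f] by auto
  have HL: "H \<in> L2"
    unfolding L2_def mem_Collect_eq sq
    by (intro conjI Hm integral_unroll(2)[OF T inj sqm] L2_integrable_sq f) (simp add: supp)
  have nH: "L2_sqnorm H = L2_sqnorm f"
    unfolding L2_sqnorm_def sq by (rule integral_unroll(1)[OF T inj sqm]) (simp add: supp)
  have coeff: "(\<integral>y. f y * cis (of_int k * y) \<partial>lebesgue) = cnj (\<integral>x. cnj (H x) * cis (- (of_int k * x)) \<partial>lebesgue)" for k :: int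
  proof -
    have m: "(\<lambda>y. f y * cis (of_int k * y)) \<in> borel_measurable lebesgue"
      by (intro borel_measurable_times fm borel_measurable_lebesgue_cis)
    have "(\<integral>y. f y * cis (of_int k * y) \<partial>lebesgue) =
        (\<integral>x. (if x \<in> folded T then f (unroll T x) * cis (of_int k * unroll T x) else 0) \<partial>lebesgue)"
      by (rule integral_unroll(1)[OF T inj m, symmetric]) (simp add: supp)
    also have "\<dots> = (\<integral>x. cnj (cnj (H x) * cis (- (of_int k * x))) \<partial>lebesgue)"
      by (rule Bochner_Integration.integral_cong[OF refl]) (simp add: H_def cis_unroll cis_cnj)
    finally show ?thesis by (simp only: Bochner_Integration.integral_cnj)
  qed
  have "(\<integral>\<^sup>+k. ennreal ((cmod (\<integral>x. cnj (H x) * cis (- (of_int k * x)) \<partial>lebesgue))\<^sup>2) \<partial>count_space (UNIV :: int set)) =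
      ennreal (2 * pi * L2_sqnorm (\<lambda>x. cnj (H x)))"
  proof (rule parseval_fourier_series[OF L2_cnj[OF HL]])
    fix x :: real assume "x \<notin> {0..<2*pi}"
    then have "x \<notin> folded T" unfolding folded_def by blast
    then show "cnj (H x) = 0" by (simp add: H_def)
  qed
  then show ?thesis unfolding coeff complex_mod_cnj by (simp add: L2_sqnorm_def nH[unfolded L2_sqnorm_def])
qed

section \<open>The wavelet system in frequency\<close>

text \<open>The Fourier transforms of the wavelet family of a function whose transform is \<open>g\<close>; see
\<open>wavelet_family_cofourier\<close>.\<close>

definition dilated_modes :: "(real \<Rightarrow> complex) \<Rightarrow> int \<times> int \<Rightarrow> real \<Rightarrow> complex" where
  "dilated_modes g = (\<lambda>(j, k) y. of_real (2 powr (- of_int j / 2)) *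
      (cis (- (of_int k * (2 powi (- j) * y))) * g (2 powi (- j) * y)))"

lemma wavelet_family_cofourier:
  "wavelet_family (cofourier g) i = cofourier (dilated_modes g i)"
proof (cases i)
  case (Pair j k)
  define c :: real where "c = 2 powi (- j)"
  have c: "0 < c" by (simp add: c_def)
  have cj: "2 powi j = 1 / c" by (simp add: c_def power_int_minus field_simps)
  have pw: "2 powr (of_int j / 2) * c = 2 powr (- of_int j / 2)"
  proof -
    have "c = 2 powr (- of_int j)" by (simp add: c_def powr_real_of_int' flip: of_int_minus)
    then show ?thesis by (simp flip: powr_add)
  qed
  show ?thesis
  proof (rule ext)
    fix t
    have "cofourier g (2 powi j * t - of_int k) =
        of_real (1 / sqrt (2 * pi)) * (\<integral>x. exp (- \<i> * of_real (x * - (t / c - of_int k))) * g x \<partial>lebesgue)"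
      by (simp add: cofourier_def fourier_def cj)
    also have "(\<integral>x. exp (- \<i> * of_real (x * - (t / c - of_int k))) * g x \<partial>lebesgue) =
        c *\<^sub>R (\<integral>y. exp (- \<i> * of_real ((0 + c * y) * - (t / c - of_int k))) * g (0 + c * y) \<partial>lebesgue)"
      using c by (subst lebesgue_integral_real_affine[of c _ 0]) auto
    also have "(\<integral>y. exp (- \<i> * of_real ((0 + c * y) * - (t / c - of_int k))) * g (0 + c * y) \<partial>lebesgue) =
        (\<integral>y. exp (- \<i> * of_real (y * - t)) * (cis (- (of_int k * (c * y))) * g (c * y)) \<partial>lebesgue)"
    proof (rule Bochner_Integration.integral_cong[OF refl])
      fix y
      have "(0 + c * y) * - (t / c - of_int k) = y * - t + of_int k * (c * y)"
        using c by (simp add: field_simps)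
      then have "exp (- \<i> * of_real ((0 + c * y) * - (t / c - of_int k))) =
          exp (- \<i> * of_real (y * - t)) * cis (- (of_int k * (c * y)))"
        by (simp only: cis_conv_exp exp_add[symmetric]) (simp add: algebra_simps)
      then show "exp (- \<i> * of_real ((0 + c * y) * - (t / c - of_int k))) * g (0 + c * y) =
          exp (- \<i> * of_real (y * - t)) * (cis (- (of_int k * (c * y))) * g (c * y))" by simp
    qed
    finally have "wavelet_family (cofourier g) i t = of_real (1 / sqrt (2 * pi)) * (of_real (2 powr (of_int j / 2) * c) *
        (\<integral>y. exp (- \<i> * of_real (y * - t)) * (cis (- (of_int k * (c * y))) * g (c * y)) \<partial>lebesgue))"
      by (simp add: wavelet_family_def Pair scaleR_conv_of_real)
    also have "\<dots> = of_real (1 / sqrt (2 * pi)) *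
        (\<integral>y. exp (- \<i> * of_real (y * - t)) * dilated_modes g i y \<partial>lebesgue)"
    proof -
      have "exp (- \<i> * of_real (y * - t)) * dilated_modes g i y = of_real (2 powr (of_int j / 2) * c) *
          (exp (- \<i> * of_real (y * - t)) * (cis (- (of_int k * (c * y))) * g (c * y)))" for y
        unfolding pw by (simp add: dilated_modes_def Pair c_def)
      then show ?thesis by (simp only: integral_mult_right_zero)
    qed
    finally show "wavelet_family (cofourier g) i t = cofourier (dilated_modes g i) t"
      by (simp add: cofourier_def fourier_def)
  qed
qed

lemma L12_affine:
  assumes g: "g \<in> L12" and c: "c \<noteq> 0"
  shows "(\<lambda>x. g (a + c * x)) \<in> L12"
proof -
  have "g \<in> borel_measurable lebesgue" using g by (simp add: L12_def L2_def)
  from measurable_compose[OF measurable_lebesgue_affine[OF c] this, of a]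
  show ?thesis
    using g c lebesgue_integrable_real_affine[of "\<lambda>t. (cmod (g t))\<^sup>2" c a] lebesgue_integrable_real_affine[of g c a]
    by (simp add: L12_def L2_def)
qed

lemma L12_cis_mult:
  assumes g: "g \<in> L12"
  shows "(\<lambda>x. cis (a * x) * g x) \<in> L12"
proof -
  have gm: "g \<in> borel_measurable lebesgue" using g by (simp add: L12_def L2_def)
  have "(\<lambda>x. cis (a * x) * g x) \<in> borel_measurable lebesgue"
    by (intro borel_measurable_times gm borel_measurable_lebesgue_cis)
  moreover from this have "integrable lebesgue (\<lambda>x. cis (a * x) * g x)"
    by (intro Bochner_Integration.integrable_bound[OF L12_integrable[OF g]]) (auto simp: norm_mult)
  ultimately show ?thesis
    using L2_integrable_sq[OF L12_L2[OF g]] by (simp add: L12_def L2_def norm_mult)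
qed

lemma dilated_modes_L12:
  assumes g: "g \<in> L12" shows "dilated_modes g i \<in> L12"
proof (cases i)
  case (Pair j k)
  have "(\<lambda>y. cis (- of_int k * 2 powi (- j) * y) * g (0 + 2 powi (- j) * y)) \<in> L12"
    by (intro L12_cis_mult L12_affine g) simp
  from L12_cmult[OF this, of "of_real (2 powr (- of_int j / 2))"] show ?thesis
    by (simp add: dilated_modes_def Pair mult.assoc)
qed

definition wavelet_spectrum :: "real set \<Rightarrow> real \<Rightarrow> complex" where
  "wavelet_spectrum W x = of_real (1 / sqrt (measure lebesgue W) * indicator W x)"

lemma lmeasurable_of_measure_nonzero:
  assumes "measure lebesgue W \<noteq> 0" "W \<in> sets lebesgue"
  shows "W \<in> lmeasurable"
proof (rule fmeasurableI[OF assms(2)])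
  show "emeasure lebesgue W < \<infinity>"
  proof (rule ccontr)
    assume "\<not> emeasure lebesgue W < \<infinity>"
    then have "emeasure lebesgue W = \<infinity>" by (simp only: infinity_ennreal_def less_top[symmetric] not_not)
    then have "measure lebesgue W = 0" by (simp only: measure_def infinity_ennreal_def enn2real_top)
    with assms(1) show False by simp
  qed
qed

text \<open>If \<open>W\<close> has infinite measure, then \<open>measure lebesgue W = 0\<close> and the function is zero.\<close>

lemma wavelet_spectrum_L12:
  assumes "W \<in> sets lebesgue" shows "wavelet_spectrum W \<in> L12"
proof (cases "measure lebesgue W = 0")
  case True
  then have "wavelet_spectrum W = (\<lambda>_. 0)" by (auto simp: wavelet_spectrum_def)
  then show ?thesis by (simp add: L12_def)
next
  case False
  then have W: "W \<in> lmeasurable"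
    using assms by (rule lmeasurable_of_measure_nonzero)
  have "wavelet_spectrum W = (\<lambda>x. indicator W x * (indicator W x * of_real (1 / sqrt (measure lebesgue W))))"
    by (auto simp: wavelet_spectrum_def indicator_def)
  moreover have "(\<lambda>x. indicator W x * complex_of_real (1 / sqrt (measure lebesgue W))) \<in> L2"
    by (rule L2_indicator_bounded[OF W]) auto
  ultimately show ?thesis using L2_restrict_L12[OF _ W] by (simp only:)
qed

text \<open>The transform of a wavelet is prescribed, so the wavelet is the inverse transform of the normalized
indicator of \<open>W\<close> almost everywhere, and the basis property moves to frequency.\<close>

theorem wavelet_set_iff_basis:
  "wavelet_set W \<longleftrightarrow> W \<in> sets lebesgue \<and> orthonormal_basis_L2 (dilated_modes (wavelet_spectrum W))"
proof
  assume R: "W \<in> sets lebesgue \<and> orthonormal_basis_L2 (dilated_modes (wavelet_spectrum W))"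
  then have g: "wavelet_spectrum W \<in> L12" by (simp add: wavelet_spectrum_L12)
  have "orthonormal_basis_L2 (\<lambda>i. cofourier (dilated_modes (wavelet_spectrum W) i))"
    using R by (subst orthonormal_basis_cofourier_iff) (auto intro: dilated_modes_L12 g)
  then have "orthonormal_wavelet (cofourier (wavelet_spectrum W))"
    unfolding orthonormal_wavelet_def wavelet_family_cofourier[abs_def, symmetric]
    by (simp add: cofourier_L2 g)
  moreover have "is_L2_fourier (cofourier (wavelet_spectrum W)) (wavelet_spectrum W)"
    by (rule is_L2_fourier_cofourier[OF g])
  ultimately show "wavelet_set W" using R unfolding wavelet_set_def wavelet_spectrum_def[abs_def] by blast
next
  assume "wavelet_set W"
  then obtain w where W: "W \<in> sets lebesgue" and w: "orthonormal_wavelet w" "is_L2_fourier w (wavelet_spectrum W)"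
    unfolding wavelet_set_def wavelet_spectrum_def[abs_def] by blast
  have g: "wavelet_spectrum W \<in> L12" by (rule wavelet_spectrum_L12[OF W])
  have ae: "AE t in lebesgue. w t = cofourier (wavelet_spectrum W) t"
    by (rule is_L2_fourier_unique[OF w(2) g])
  have "orthonormal_basis_L2 (\<lambda>i. cofourier (dilated_modes (wavelet_spectrum W) i))"
  proof (rule orthonormal_basis_L2_cong_AE)
    show B: "orthonormal_basis_L2 (wavelet_family w)" using w by (simp add: orthonormal_wavelet_def)
    show "wavelet_family w i \<in> L2" for i using B unfolding orthonormal_basis_L2_def by blast
    show "cofourier (dilated_modes (wavelet_spectrum W) i) \<in> L2" for i
      by (intro cofourier_L2 dilated_modes_L12 g)
    show "AE t in lebesgue. wavelet_family w i t = cofourier (dilated_modes (wavelet_spectrum W) i) t" for i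
    proof (cases i)
      case (Pair j k)
      have "AE t in lebesgue. w (- of_int k + 2 powi j * t) = cofourier (wavelet_spectrum W) (- of_int k + 2 powi j * t)"
        by (rule AE_lebesgue_affine[OF _ ae]) simp
      then show ?thesis
        unfolding wavelet_family_cofourier[symmetric] by eventually_elim (simp add: wavelet_family_def Pair)
    qed
  qed
  then have "orthonormal_basis_L2 (dilated_modes (wavelet_spectrum W))"
    by (subst (asm) orthonormal_basis_cofourier_iff) (auto intro: dilated_modes_L12 g)
  then show "W \<in> sets lebesgue \<and> orthonormal_basis_L2 (dilated_modes (wavelet_spectrum W))" using W by simp
qed

section \<open>Tilings yield wavelet sets\<close>

lemma L2_inner_eq_0: "(\<And>x. f x * cnj (g x) = 0) \<Longrightarrow> L2_inner f g = 0"
  by (simp only: L2_inner_def Bochner_Integration.integral_zero)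

lemma powi_neg_mult [simp]: "(2::real) powi (- j) * (2 powi j * x) = x" "(2::real) powi j * (2 powi (- j) * x) = x"
  by (simp_all add: power_int_minus)

lemma powr_half_powi: "(2::real) powr (of_int j / 2) * 2 powr (of_int j / 2) = 2 powi j"
  "(2::real) powi j * 2 powr (- of_int j / 2) = 2 powr (of_int j / 2)"
  by (simp_all flip: powr_add powr_real_of_int')

text \<open>The unitary dilation by \<open>2\<^sup>j\<close> followed by restriction to \<open>W\<close>: it turns the coefficients of \<open>F\<close> at scale \<open>j\<close>
into Fourier coefficients on \<open>W\<close>.\<close>

definition scaled_restriction :: "real set \<Rightarrow> (real \<Rightarrow> complex) \<Rightarrow> int \<Rightarrow> real \<Rightarrow> complex" where
  "scaled_restriction W F j x = of_real (2 powr (of_int j / 2)) * (indicator W x * F (2 powi j * x))"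

lemma L2_affine: assumes "F \<in> L2" "c \<noteq> 0" shows "(\<lambda>x. F (a + c * x)) \<in> L2"
proof -
  have Fm: "F \<in> borel_measurable lebesgue" using assms by (simp add: L2_def)
  from measurable_compose[OF measurable_lebesgue_affine[OF assms(2)] this, of a]
  show ?thesis
    using assms lebesgue_integrable_real_affine[of "\<lambda>t. (cmod (F t))\<^sup>2" c a] by (simp add: L2_def)
qed

lemma scaled_restriction_L2:
  assumes "F \<in> L2" "W \<in> sets lebesgue" shows "scaled_restriction W F j \<in> L2"
  unfolding scaled_restriction_def[abs_def]
  using L2_affine[OF assms(1), of "2 powi j" 0]
  by (intro L2_cmult L2_indicator_mult[OF _ assms(2)]) simp

lemma L2_inner_dilated_modes:
  "L2_inner F (dilated_modes (wavelet_spectrum W) (j, k)) =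
    of_real (1 / sqrt (measure lebesgue W)) * (\<integral>x. scaled_restriction W F j x * cis (of_int k * x) \<partial>lebesgue)"
proof -
  let ?C = "complex_of_real (1 / sqrt (measure lebesgue W))"
  let ?u = "dilated_modes (wavelet_spectrum W) (j, k)"
  have "L2_inner F ?u = 2 powi j *\<^sub>R (\<integral>x. F (0 + 2 powi j * x) * cnj (?u (0 + 2 powi j * x)) \<partial>lebesgue)"
    unfolding L2_inner_def by (subst lebesgue_integral_real_affine[of "2 powi j" _ 0]) auto
  also have "\<dots> = (\<integral>x. of_real (2 powi j) * (F (0 + 2 powi j * x) * cnj (?u (0 + 2 powi j * x))) \<partial>lebesgue)"
    by (simp add: scaleR_conv_of_real)
  also have "\<dots> = (\<integral>x. ?C * (scaled_restriction W F j x * cis (of_int k * x)) \<partial>lebesgue)"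
  proof (rule Bochner_Integration.integral_cong[OF refl])
    fix x
    have "cnj (?u (0 + 2 powi j * x)) = of_real (2 powr (- of_int j / 2)) * (cis (of_int k * x) * (?C * indicator W x))"
      by (simp add: dilated_modes_def wavelet_spectrum_def cis_cnj indicator_def)
    then have "of_real (2 powi j) * (F (0 + 2 powi j * x) * cnj (?u (0 + 2 powi j * x))) =
        of_real (2 powi j * 2 powr (- of_int j / 2)) * (F (2 powi j * x) * (cis (of_int k * x) * (?C * indicator W x)))"
      by (simp only: of_real_mult) (simp add: mult_ac)
    also have "\<dots> = ?C * (scaled_restriction W F j x * cis (of_int k * x))"
      unfolding powr_half_powi by (simp add: scaled_restriction_def mult_ac)
    finally show "of_real (2 powi j) * (F (0 + 2 powi j * x) * cnj (?u (0 + 2 powi j * x))) = \<dots>" .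
  qed
  finally show ?thesis by (simp only: integral_mult_right_zero)
qed

lemma sqnorm_scaled_restriction:
  assumes F: "F \<in> L2" and W: "W \<in> sets lebesgue"
  shows "ennreal (L2_sqnorm (scaled_restriction W F j)) =
    (\<integral>\<^sup>+y. ennreal ((cmod (F y))\<^sup>2) * indicator {y. 2 powi (- j) * y \<in> W} y \<partial>lebesgue)"
proof -
  have Fm: "F \<in> borel_measurable lebesgue" using F by (simp add: L2_def)
  have S: "{y. 2 powi (- j) * y \<in> W} \<in> sets lebesgue"
    using emeasure_affine_vimage(2)[OF _ W, of "2 powi (- j)" 0] by simp
  have m: "(\<lambda>y. ennreal ((cmod (F y))\<^sup>2) * indicator {y. 2 powi (- j) * y \<in> W} y) \<in> borel_measurable lebesgue"
    by (intro borel_measurable_times_ennreal borel_measurable_cmod_sq Fm borel_measurable_indicator S)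
  have Fm2: "(\<lambda>x. F (0 + 2 powi j * x)) \<in> borel_measurable lebesgue"
    by (rule measurable_compose[OF measurable_lebesgue_affine Fm]) simp
  have "(\<integral>\<^sup>+y. ennreal ((cmod (F y))\<^sup>2) * indicator {y. 2 powi (- j) * y \<in> W} y \<partial>lebesgue) =
      ennreal (2 powi j) * (\<integral>\<^sup>+x. ennreal ((cmod (F (0 + 2 powi j * x)))\<^sup>2) * indicator {y. 2 powi (- j) * y \<in> W} (0 + 2 powi j * x) \<partial>lebesgue)"
    using nn_integral_real_affine_lebesgue[OF m, of "2 powi j" 0] by simp
  also have "(\<integral>\<^sup>+x. ennreal ((cmod (F (0 + 2 powi j * x)))\<^sup>2) * indicator {y. 2 powi (- j) * y \<in> W} (0 + 2 powi j * x) \<partial>lebesgue) =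
      (\<integral>\<^sup>+x. ennreal ((cmod (F (0 + 2 powi j * x)))\<^sup>2) * indicator W x \<partial>lebesgue)"
    by (intro nn_integral_cong) (simp add: indicator_def)
  also have "ennreal (2 powi j) * \<dots> = (\<integral>\<^sup>+x. ennreal (2 powi j) * (ennreal ((cmod (F (0 + 2 powi j * x)))\<^sup>2) * indicator W x) \<partial>lebesgue)"
    by (rule nn_integral_cmult[symmetric])
       (intro borel_measurable_times_ennreal borel_measurable_cmod_sq Fm2 borel_measurable_indicator W)
  also have "\<dots> = (\<integral>\<^sup>+x. ennreal ((cmod (scaled_restriction W F j x))\<^sup>2) \<partial>lebesgue)"
  proof (rule nn_integral_cong)
    fix x
    have "(2 powr (of_int j / 2))\<^sup>2 = (2 powi j :: real)" by (simp add: power2_eq_square powr_half_powi)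
    then show "ennreal (2 powi j) * (ennreal ((cmod (F (0 + 2 powi j * x)))\<^sup>2) * indicator W x) =
        ennreal ((cmod (scaled_restriction W F j x))\<^sup>2)"
      by (simp add: scaled_restriction_def norm_mult power_mult_distrib indicator_def flip: ennreal_mult)
  qed
  also have "\<dots> = ennreal (L2_sqnorm (scaled_restriction W F j))"
    by (rule L2_nn_integral[OF scaled_restriction_L2[OF F W]])
  finally show ?thesis by simp
qed

lemma integral_indicator_cis:
  assumes W: "W \<in> sets lebesgue" and inj: "periodic_injective W"
  shows "(\<integral>y. indicator W y * cis (of_int k * y) \<partial>lebesgue) =
    (\<integral>x. indicator (folded W) x * cis (of_int k * x) \<partial>lebesgue)"
proof -
  have m: "(\<lambda>y. indicator W y * cis (of_int k * y)) \<in> borel_measurable lebesgue"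
    by (intro borel_measurable_times borel_measurable_indicator borel_measurable_lebesgue_cis W)
  have "(\<integral>y. indicator W y * cis (of_int k * y) \<partial>lebesgue) =
      (\<integral>x. (if x \<in> folded W then indicator W (unroll W x) * cis (of_int k * unroll W x) else 0) \<partial>lebesgue)"
    by (rule integral_unroll(1)[OF W inj m, symmetric]) simp
  also have "\<dots> = (\<integral>x. indicator (folded W) x * cis (of_int k * x) \<partial>lebesgue)"
    by (rule Bochner_Integration.integral_cong[OF refl]) (simp add: indicator_def cis_unroll unroll_in)
  finally show ?thesis .
qed

definition exact_tiling :: "real set \<Rightarrow> bool" where
  "exact_tiling W \<longleftrightarrow> W \<in> sets lebesgue \<and> 0 \<notin> W \<and> (\<forall>x. \<exists>!j::int. x + of_int j * (2*pi) \<in> W) \<and>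
    (\<forall>x. x \<noteq> 0 \<longrightarrow> (\<exists>!k::int. 2 powi k * x \<in> W))"

text \<open>Parseval's identity on \<open>W\<close> evaluates the sum of the squared coefficients at scale \<open>j\<close> to the mass of
\<open>F\<close> on \<open>2\<^sup>j W\<close>.  These sets partition the line without \<open>0\<close>, so the double sum is the
squared norm of \<open>F\<close>.\<close>

theorem exact_tiling_wavelet_set:
  assumes "exact_tiling W"
  shows "wavelet_set W"
proof -
  have W: "W \<in> sets lebesgue" and W0: "0 \<notin> W"
    and trans: "\<And>x. \<exists>!j::int. x + of_int j * (2*pi) \<in> W"
    and dil: "\<And>x. x \<noteq> 0 \<Longrightarrow> \<exists>!k::int. 2 powi k * x \<in> W"
    using assms by (auto simp: exact_tiling_def)
  have inj: "periodic_injective W"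
    unfolding periodic_injective_def
  proof (intro ballI allI impI)
    fix x and j :: int assume "x \<in> W" "x + of_int j * (2*pi) \<in> W"
    then have "x + of_int 0 * (2*pi) \<in> W" by simp
    then show "j = 0" using \<open>x + of_int j * (2*pi) \<in> W\<close> trans[of x] by blast
  qed
  have fold: "folded W = {0..<2*pi}" using ex1_implies_ex[OF trans] by (auto simp: folded_def)
  have "emeasure lebesgue W = ennreal (2*pi)"
    using emeasure_folded[OF W inj] by (simp add: fold)
  then have mW: "measure lebesgue W = 2*pi" by (simp add: measure_def del: emeasure_completion)
  have g: "wavelet_spectrum W \<in> L12" by (rule wavelet_spectrum_L12[OF W])
  let ?u = "dilated_modes (wavelet_spectrum W)"
  let ?C = "1 / sqrt (measure lebesgue W)"
  have uL: "?u i \<in> L2" for i by (rule L12_L2[OF dilated_modes_L12[OF g]])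
  have disj: "j = j'" if "2 powi (- j) * y \<in> W" "2 powi (- j') * y \<in> W" for j j' and y :: real
  proof -
    have "y \<noteq> 0" using that(1) W0 by auto
    from dil[OF this] that have "- j = - j'" by blast
    then show ?thesis by simp
  qed
  have on: "orthonormal_L2 ?u"
    unfolding orthonormal_L2_def
  proof (intro conjI allI uL)
    fix i i' :: "int \<times> int"
    obtain j k j' k' where i: "i = (j, k)" and i': "i' = (j', k')" by (cases i, cases i')
    show "L2_inner (?u i) (?u i') = (if i = i' then 1 else 0)"
    proof (cases "j = j'")
      case False
      have "?u i y * cnj (?u i' y) = 0" for y
        using disj[of j y j'] False by (auto simp: i i' dilated_modes_def wavelet_spectrum_def indicator_def)
      then have "L2_inner (?u i) (?u i') = 0" by (rule L2_inner_eq_0)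
      then show ?thesis using False by (simp add: i i')
    next
      case True
      have "scaled_restriction W (?u i) j x * cis (of_int k' * x) =
          of_real ?C * (indicator W x * cis (of_int (k' - k) * x))" for x
      proof -
        let ?p = "complex_of_real (2 powr (of_int j / 2))" and ?q = "complex_of_real (2 powr (- of_int j / 2))"
        have pq: "?p * ?q = 1" by (simp flip: of_real_mult powr_add)
        have "scaled_restriction W (?u i) j x * cis (of_int k' * x) =
            ?p * (indicator W x * (?q * (cis (- (of_int k * x)) * (of_real ?C * indicator W x)))) * cis (of_int k' * x)"
          by (simp add: scaled_restriction_def i dilated_modes_def wavelet_spectrum_def indicator_def)
        also have "\<dots> = (?p * ?q) * (of_real ?C * (indicator W x * (cis (- (of_int k * x)) * cis (of_int k' * x))))"
          by (simp add: indicator_def mult_ac)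
        finally have "scaled_restriction W (?u i) j x * cis (of_int k' * x) =
            of_real ?C * (indicator W x * (cis (- (of_int k * x)) * cis (of_int k' * x)))"
          by (simp only: pq mult_1_left)
        then show ?thesis by (simp add: cis_mult algebra_simps)
      qed
      then have "L2_inner (?u i) (?u i') =
          of_real ?C * (of_real ?C * (\<integral>x. indicator W x * cis (of_int (k' - k) * x) \<partial>lebesgue))"
        unfolding i' True[symmetric] L2_inner_dilated_modes by (simp only: integral_mult_right_zero)
      also have "(\<integral>x. indicator W x * cis (of_int (k' - k) * x) \<partial>lebesgue) = (if k' - k = 0 then 2 * of_real pi else 0)"
        unfolding integral_indicator_cis[OF W inj] fold by (rule integral_period_cis)
      also have "of_real ?C * (of_real ?C * \<dots>) = (if i = i' then 1 else 0)"
      proof -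
        have "?C * (?C * (2 * pi)) = 1" by (simp add: mW)
        then have "complex_of_real (?C * (?C * (2 * pi))) = 1" by (simp only: of_real_1)
        then have "complex_of_real ?C * (of_real ?C * (2 * of_real pi)) = 1"
          by (simp only: of_real_mult of_real_numeral)
        then show ?thesis by (cases "k = k'") (simp_all only: i i' True, simp_all)
      qed
      finally show ?thesis .
    qed
  qed
  have "\<exists>I c. finite I \<and> L2_sqdist F (\<lambda>t. \<Sum>i\<in>I. c i * ?u i t) < e" if F: "F \<in> L2" and e: "0 < e" for F e
  proof (rule approx_of_parseval[OF on F e])
    have Fm: "F \<in> borel_measurable lebesgue" using F by (simp add: L2_def)
    have S: "{y. 2 powi (- j) * y \<in> W} \<in> sets lebesgue" for j
      using emeasure_affine_vimage(2)[OF _ W, of "2 powi (- j)" 0] by simp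
    have row: "(\<integral>\<^sup>+k. ennreal ((cmod (L2_inner F (?u (j, k))))\<^sup>2) \<partial>count_space UNIV) =
        (\<integral>\<^sup>+y. ennreal ((cmod (F y))\<^sup>2) * indicator {y. 2 powi (- j) * y \<in> W} y \<partial>lebesgue)" for j
    proof -
      let ?S = "scaled_restriction W F j"
      have "(\<integral>\<^sup>+k. ennreal ((cmod (L2_inner F (?u (j, k))))\<^sup>2) \<partial>count_space UNIV) =
          (\<integral>\<^sup>+k. ennreal (1 / (2*pi)) * ennreal ((cmod (\<integral>x. ?S x * cis (of_int k * x) \<partial>lebesgue))\<^sup>2) \<partial>count_space UNIV)"
        unfolding L2_inner_dilated_modes
        by (simp add: mW norm_mult norm_divide power_mult_distrib power_divide flip: ennreal_mult)
      also have "\<dots> = ennreal (1 / (2*pi)) * (\<integral>\<^sup>+k. ennreal ((cmod (\<integral>x. ?S x * cis (of_int k * x) \<partial>lebesgue))\<^sup>2) \<partial>count_space UNIV)"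
        by (rule nn_integral_cmult) simp
      also have "(\<integral>\<^sup>+k. ennreal ((cmod (\<integral>x. ?S x * cis (of_int k * x) \<partial>lebesgue))\<^sup>2) \<partial>count_space UNIV) =
          ennreal (2 * pi * L2_sqnorm ?S)"
        by (rule parseval_periodic_injective[OF W inj scaled_restriction_L2[OF F W]]) (simp add: scaled_restriction_def)
      also have "ennreal (1 / (2*pi)) * ennreal (2 * pi * L2_sqnorm ?S) = ennreal (L2_sqnorm ?S)"
        by (subst ennreal_mult[symmetric]) auto
      finally show ?thesis by (simp only: sqnorm_scaled_restriction[OF F W])
    qed
    have "ennreal (L2_sqnorm F) = (\<integral>\<^sup>+y. ennreal ((cmod (F y))\<^sup>2) \<partial>lebesgue)"
      by (rule L2_nn_integral[OF F, symmetric])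
    also have "\<dots> = (\<integral>\<^sup>+y. (\<integral>\<^sup>+j. ennreal ((cmod (F y))\<^sup>2) * indicator {y. 2 powi (- j) * y \<in> W} y \<partial>count_space (UNIV :: int set)) \<partial>lebesgue)"
    proof (rule nn_integral_cong_AE)
      have "AE y in lebesgue. (y::real) \<noteq> 0" by (rule AE_I[where N="{0}"]) auto
      then show "AE y in lebesgue. ennreal ((cmod (F y))\<^sup>2) =
          (\<integral>\<^sup>+j. ennreal ((cmod (F y))\<^sup>2) * indicator {y. 2 powi (- j) * y \<in> W} y \<partial>count_space (UNIV :: int set))"
      proof eventually_elim
        case (elim y)
        then obtain k where k: "2 powi k * y \<in> W" using dil by blast
        have "(\<integral>\<^sup>+j. ennreal ((cmod (F y))\<^sup>2) * indicator {y. 2 powi (- j) * y \<in> W} y \<partial>count_space (UNIV :: int set)) =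
            (\<integral>\<^sup>+j. ennreal ((cmod (F y))\<^sup>2) * indicator {- k} j \<partial>count_space UNIV)"
          using disj[of "- k" y] k by (intro nn_integral_cong) (auto simp: indicator_def)
        also have "\<dots> = ennreal ((cmod (F y))\<^sup>2)" by (subst nn_integral_cmult_indicator) auto
        finally show ?case by simp
      qed
    qed
    also have "\<dots> = (\<integral>\<^sup>+j. (\<integral>\<^sup>+y. ennreal ((cmod (F y))\<^sup>2) * indicator {y. 2 powi (- j) * y \<in> W} y \<partial>lebesgue) \<partial>count_space (UNIV :: int set))"
      by (rule nn_integral_count_space_nn_integral)
         (auto intro!: borel_measurable_times_ennreal borel_measurable_cmod_sq Fm borel_measurable_indicator S)
    also have "\<dots> = (\<integral>\<^sup>+j. (\<integral>\<^sup>+k. ennreal ((cmod (L2_inner F (?u (j, k))))\<^sup>2) \<partial>count_space UNIV) \<partial>count_space UNIV)"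
      by (simp only: row)
    also have "\<dots> = (\<integral>\<^sup>+i. ennreal ((cmod (L2_inner F (?u i)))\<^sup>2) \<partial>count_space UNIV)"
      by (rule nn_integral_fst_count_space)
    finally show "ennreal (L2_sqnorm F) \<le> (\<integral>\<^sup>+i. ennreal ((cmod (L2_inner F (?u i)))\<^sup>2) \<partial>count_space UNIV)" by simp
  qed
  then show ?thesis using on W by (simp add: wavelet_set_iff_basis orthonormal_basis_L2_alt)
qed

section \<open>Wavelet sets tile almost everywhere\<close>

text \<open>The form in which completeness is used below.\<close>

lemma L2_sqnorm_zero_of_orthogonal:
  assumes on: "orthonormal_basis_L2 u" and f: "f \<in> L2" and orth: "\<And>i. L2_inner f (u (i :: 'i::countable)) = 0"
  shows "L2_sqnorm f = 0"
proof -
  have "orthonormal_L2 u" using on by (simp add: orthonormal_basis_L2_alt)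
  from parseval_of_approx[OF this f] on f
  have "(\<integral>\<^sup>+i. ennreal ((cmod (L2_inner f (u i)))\<^sup>2) \<partial>count_space UNIV) = ennreal (L2_sqnorm f)"
    unfolding orthonormal_basis_L2_def by blast
  then show ?thesis by (simp add: orth)
qed

lemma L2_indicator_set:
  assumes "A \<in> lmeasurable"
  shows "(indicator A :: real \<Rightarrow> complex) \<in> L2" "L2_sqnorm (indicator A) = measure lebesgue A"
proof -
  have "(\<lambda>x. indicator A x * (1::complex)) \<in> L2" by (rule L2_indicator_bounded[OF assms, of _ 1]) auto
  then show "(indicator A :: real \<Rightarrow> complex) \<in> L2" by simp
  have "(\<lambda>t. (cmod (indicator A t))\<^sup>2) = (indicator A :: real \<Rightarrow> real)" by (auto simp: indicator_def)
  then show "L2_sqnorm (indicator A) = measure lebesgue A"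
    using assms by (simp add: L2_sqnorm_def fmeasurableD)
qed

lemma null_sets_of_measure_zero:
  assumes "A \<in> lmeasurable" "measure lebesgue A = 0"
  shows "A \<in> null_sets lebesgue"
  using assms by (auto simp: null_sets_def fmeasurableD emeasure_eq_measure2 simp del: emeasure_completion)

lemma null_sets_of_sqnorm_zero:
  assumes "A \<in> lmeasurable" "f \<in> L2" "L2_sqnorm f = 0" "\<And>x. x \<in> A \<Longrightarrow> cmod (f x) = 1"
  shows "A \<in> null_sets lebesgue"
proof (rule null_sets_of_measure_zero[OF assms(1)])
  have "measure lebesgue A = L2_sqnorm (indicator A)" by (simp add: L2_indicator_set(2)[OF assms(1)])
  also have "\<dots> \<le> L2_sqnorm f"
    unfolding L2_sqnorm_def
    by (intro integral_mono L2_integrable_sq assms L2_indicator_set) (auto simp: indicator_def assms(4))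
  finally show "measure lebesgue A = 0" using assms(3) by (simp add: measure_le_0_iff)
qed

lemma period_floor: "x \<in> {of_int \<lfloor>x / (2*pi)\<rfloor> * (2*pi)..<of_int \<lfloor>x / (2*pi)\<rfloor> * (2*pi) + 2*pi}"
proof -
  have lower: "a * p \<le> x" if "a \<le> x / p" "0 < p" for a p :: real
    using that by (simp add: pos_le_divide_eq)
  have upper: "x < a * p + p" if "x / p < a + 1" "0 < p" for a p :: real
    using that by (simp add: pos_divide_less_eq distrib_right)
  show ?thesis
    using lower[of "of_int \<lfloor>x / (2*pi)\<rfloor>" "2*pi"] upper[of "2*pi" "of_int \<lfloor>x / (2*pi)\<rfloor>"]
    by (simp add: floor_correct)
qed

locale wavelet_set_in_frequency =
  fixes W :: "real set"
  assumes sets_W: "W \<in> sets lebesgue"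
    and basis: "orthonormal_basis_L2 (dilated_modes (wavelet_spectrum W))"
begin

abbreviation modes :: "int \<times> int \<Rightarrow> real \<Rightarrow> complex" where
  "modes \<equiv> dilated_modes (wavelet_spectrum W)"

lemma modes_orthonormal: "L2_inner (modes i) (modes i') =
    (if i = i' then 1 else 0)"
  using basis unfolding orthonormal_basis_L2_def by blast

lemma modes_L2: "modes i \<in> L2"
  using basis unfolding orthonormal_basis_L2_def by blast

lemma mode_zero: "modes (0, k) = (\<lambda>x. of_real (1 / sqrt (measure lebesgue W)) *
    (cis (- (of_int k * x)) * indicator W x))"
  by (rule ext) (simp add: dilated_modes_def wavelet_spectrum_def indicator_def)

lemma measure_W_pos: "0 < measure lebesgue W"
proof (rule ccontr)
  assume "\<not> 0 < measure lebesgue W"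
  then have "measure lebesgue W = 0" using measure_nonneg[of lebesgue W] by linarith
  then have "modes (0, 0) = (\<lambda>_. 0)" by (simp add: mode_zero)
  then show False using modes_orthonormal[of "(0,0)" "(0,0)"] by (simp add: L2_inner_def)
qed

lemma lmeasurable_W: "W \<in> lmeasurable"
  using measure_W_pos by (intro lmeasurable_of_measure_nonzero sets_W) simp

lemma inner_mode_zero:
  "L2_inner F (modes (0, k)) =
    of_real (1 / sqrt (measure lebesgue W)) * (\<integral>x. indicator W x * F x * cis (of_int k * x) \<partial>lebesgue)"
  unfolding L2_inner_dilated_modes by (simp add: scaled_restriction_def)

lemma integral_cis_zero:
  assumes "k \<noteq> 0"
  shows "(\<integral>x. indicator W x * cis (of_int k * x) \<partial>lebesgue) = 0"
proof -
  let ?C = "complex_of_real (1 / sqrt (measure lebesgue W))"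
  have "0 = L2_inner (modes (0, 0)) (modes (0, k))"
    using assms by (simp add: modes_orthonormal)
  also have "\<dots> = ?C * (\<integral>x. ?C * (indicator W x * cis (of_int k * x)) \<partial>lebesgue)"
    unfolding inner_mode_zero unfolding mode_zero
    by (intro arg_cong[where f="\<lambda>z. ?C * z"] Bochner_Integration.integral_cong) (auto simp: indicator_def)
  finally show ?thesis using measure_W_pos by simp
qed

text \<open>The inner product of the modes \<open>(-k, 0)\<close> and \<open>(0, 0)\<close> is a positive multiple of the measure of this
set.\<close>

lemma dilates_disjoint:
  assumes "k \<noteq> 0"
  shows "{x \<in> W. 2 powi k * x \<in> W} \<in> null_sets lebesgue"
proof -
  let ?C = "1 / sqrt (measure lebesgue W)"
  let ?A = "{x \<in> W. 2 powi k * x \<in> W}"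
  have "{x. 2 powi k * x \<in> W} \<in> sets lebesgue"
    using emeasure_affine_vimage(2)[OF _ sets_W, of "2 powi k" 0] by simp
  then have "W \<inter> {x. 2 powi k * x \<in> W} \<in> lmeasurable"
    by (intro fmeasurable_Int_fmeasurable lmeasurable_W)
  also have "W \<inter> {x. 2 powi k * x \<in> W} = ?A" by auto
  finally have A: "?A \<in> lmeasurable" .
  have sq: "complex_of_real (sqrt (measure lebesgue W)) * of_real (sqrt (measure lebesgue W)) = of_real (measure lebesgue W)"
    by (simp flip: of_real_mult)
  have "0 = L2_inner (modes (- k, 0)) (modes (0, 0))"
    using assms by (simp add: modes_orthonormal)
  also have "\<dots> = (\<integral>x. of_real (?C * (2 powr (of_int k / 2) * ?C) * indicator ?A x) \<partial>lebesgue)"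
    unfolding L2_inner_def
    by (intro Bochner_Integration.integral_cong) (auto simp: dilated_modes_def wavelet_spectrum_def indicator_def sq)
  also have "\<dots> = of_real (?C * (2 powr (of_int k / 2) * ?C) * measure lebesgue ?A)"
    unfolding integral_complex_of_real using A by (simp add: fmeasurableD)
  finally have "?C * (2 powr (of_int k / 2) * ?C) * measure lebesgue ?A = 0"
    by (subst (asm) eq_commute) (simp only: of_real_eq_0_iff)
  then have "measure lebesgue ?A = 0" using measure_W_pos by simp
  then show ?thesis by (rule null_sets_of_measure_zero[OF A])
qed

lemma supported_inner_zero:
  assumes f: "f \<in> L2" and supp: "\<And>x. x \<notin> W \<Longrightarrow> f x = 0" and j: "j \<noteq> 0"
  shows "L2_inner f (modes (j, k)) = 0"
proof -
  have "AE x in lebesgue. x \<notin> {x \<in> W. 2 powi (- j) * x \<in> W}"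
    by (rule AE_not_in[OF dilates_disjoint]) (use j in simp)
  then have ae: "AE x in lebesgue. f x * cnj (modes (j, k) x) = 0"
  proof eventually_elim
    case (elim x)
    then show ?case using supp[of x] by (cases "x \<in> W") (auto simp: dilated_modes_def wavelet_spectrum_def)
  qed
  have m: "(\<lambda>x. f x * cnj (modes (j, k) x)) \<in> borel_measurable lebesgue"
    using L2_inner_integrable[OF f modes_L2] by auto
  have "L2_inner f (modes (j, k)) = (\<integral>x. 0 \<partial>(lebesgue :: real measure))"
    unfolding L2_inner_def by (rule integral_cong_AE[OF m _ ae]) simp
  then show ?thesis by simp
qed

text \<open>Let \<open>A\<close> be the part of this set in one period, and compare \<open>A\<close> with its translate \<open>?B\<close> by \<open>2\<pi>j\<close>.  Both lie
in \<open>W\<close> and they are disjoint.  The difference of their indicators is orthogonal to the modes of scale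
0, which are periodic on \<open>W\<close>, and to those of the other scales, which vanish almost everywhere
on \<open>W\<close>.  So the difference is null, and so is \<open>A\<close>.\<close>

lemma translates_disjoint:
  assumes "j \<noteq> (0::int)"
  shows "{x \<in> W. x + of_int j * (2*pi) \<in> W} \<in> null_sets lebesgue"
proof -
  define A where "A n = {x \<in> W. x + of_int j * (2*pi) \<in> W} \<inter> {of_int n * (2*pi)..<of_int n * (2*pi) + 2*pi}" for n :: int
  have vs: "{x. c + x \<in> S} \<in> lmeasurable" if "S \<in> lmeasurable" for c :: real and S
  proof -
    have "emeasure lebesgue S = emeasure lebesgue {x. c + x \<in> S}" "{x. c + x \<in> S} \<in> sets lebesgue"
      using emeasure_affine_vimage[of 1 S c] that by (auto simp: fmeasurableD)
    then show ?thesis using that by (auto simp: fmeasurable_def)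
  qed
  have AA: "A n = W \<inter> {x. of_int j * (2*pi) + x \<in> W} \<inter> {of_int n * (2*pi)..<of_int n * (2*pi) + 2*pi}" for n
    by (auto simp: A_def add.commute)
  have A: "A n \<in> lmeasurable" for n
    unfolding AA by (intro fmeasurable_Int_fmeasurable lmeasurable_W fmeasurableD vs lmeasurable_Ico)
  have "A n \<in> null_sets lebesgue" for n
  proof -
    let ?B = "{x. - (of_int j * (2*pi)) + x \<in> A n}"
    have B: "?B \<in> lmeasurable" by (rule vs[OF A])
    have BW: "?B \<subseteq> W" by (auto simp: A_def)
    have AW: "A n \<subseteq> W" by (auto simp: A_def)
    have dj: "x \<notin> ?B" if "x \<in> A n" for x
    proof
      assume "x \<in> ?B"
      then have "of_int n * (2*pi) \<le> x" "x < of_int n * (2*pi) + 2*pi"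
        "of_int n * (2*pi) \<le> x - of_int j * (2*pi)" "x - of_int j * (2*pi) < of_int n * (2*pi) + 2*pi"
        using that by (auto simp: A_def)
      then have "of_int j * (2*pi) < 1 * (2*pi)" "(- 1) * (2*pi) < of_int j * (2*pi)" by linarith+
      then have "of_int j < (1::real)" "(-1::real) < of_int j"
        using mult_less_cancel_right_pos[of "2*pi" "of_int j" 1] mult_less_cancel_right_pos[of "2*pi" "-1" "of_int j"]
        by simp_all
      then show False using assms by linarith
    qed
    define f :: "real \<Rightarrow> complex" where "f x = indicator (A n) x - indicator ?B x" for x
    have f: "f \<in> L2" unfolding f_def[abs_def] by (intro L2_diff L2_indicator_set A B)
    have int: "integrable lebesgue (\<lambda>x. indicator S x * cis (of_int k * x))" if "S \<in> lmeasurable" for S and k :: int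
    proof -
      have "integrable lebesgue (indicator S :: real \<Rightarrow> real)"
        using that by (intro integrable_real_indicator) (auto simp: fmeasurable_def simp del: emeasure_completion)
      moreover have "(\<lambda>x. indicator S x * cis (of_int k * x)) \<in> borel_measurable lebesgue"
        using that by (intro borel_measurable_times borel_measurable_indicator borel_measurable_lebesgue_cis fmeasurableD)
      ultimately show ?thesis
        by (rule Bochner_Integration.integrable_bound) (auto simp: norm_mult indicator_def)
    qed
    have "L2_inner f (modes (i, k)) = 0" for i k
    proof (cases "i = 0")
      case False
      show ?thesis
        by (rule supported_inner_zero[OF f _ False]) (use AW BW in \<open>auto simp: f_def indicator_def\<close>)
    next
      case True
      have "(\<integral>x. indicator W x * f x * cis (of_int k * x) \<partial>lebesgue) =
          (\<integral>x. indicator (A n) x * cis (of_int k * x) - indicator ?B x * cis (of_int k * x) \<partial>lebesgue)"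
        using AW BW by (intro Bochner_Integration.integral_cong) (auto simp: f_def indicator_def)
      also have "\<dots> = (\<integral>x. indicator (A n) x * cis (of_int k * x) \<partial>lebesgue) - (\<integral>x. indicator ?B x * cis (of_int k * x) \<partial>lebesgue)"
        by (intro Bochner_Integration.integral_diff int A B)
      also have "(\<integral>x. indicator ?B x * cis (of_int k * x) \<partial>lebesgue) =
          (\<integral>x. indicator ?B (of_int j * (2*pi) + 1 * x) * cis (of_int k * (of_int j * (2*pi) + 1 * x)) \<partial>lebesgue)"
        by (subst lebesgue_integral_real_affine[of 1 _ "of_int j * (2*pi)"]) auto
      also have "\<dots> = (\<integral>x. indicator (A n) x * cis (of_int k * x) \<partial>lebesgue)"
      proof (rule Bochner_Integration.integral_cong[OF refl])
        fix x
        have "cis (of_int k * (of_int j * (2*pi) + 1 * x)) = cis (2 * pi * of_int (k * j)) * cis (of_int k * x)"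
          by (simp add: cis_mult algebra_simps)
        then show "indicator ?B (of_int j * (2*pi) + 1 * x) * cis (of_int k * (of_int j * (2*pi) + 1 * x)) =
            indicator (A n) x * cis (of_int k * x)"
          by (simp add: indicator_def cis_multiple_2pi)
      qed
      finally show ?thesis unfolding True inner_mode_zero by simp
    qed
    then have "L2_sqnorm f = 0"
      by (intro L2_sqnorm_zero_of_orthogonal[OF basis f]) auto
    then show ?thesis
      by (rule null_sets_of_sqnorm_zero[OF A f]) (use dj in \<open>simp add: f_def\<close>)
  qed
  then have "(\<Union>n::int. A n) \<in> null_sets lebesgue" by (intro null_sets_UN) auto
  moreover have "{x \<in> W. x + of_int j * (2*pi) \<in> W} \<subseteq> (\<Union>n::int. A n)"
  proof
    fix x assume x: "x \<in> {x \<in> W. x + of_int j * (2*pi) \<in> W}"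
    have "x \<in> A \<lfloor>x / (2*pi)\<rfloor>" using x period_floor[of x] by (simp add: A_def)
    then show "x \<in> (\<Union>n. A n)" by blast
  qed
  ultimately show ?thesis unfolding negligible_iff_null_sets[symmetric] by (rule negligible_subset)
qed

text \<open>No mode charges this set, so the indicators of its bounded parts are orthogonal to all modes.\<close>

lemma dilates_cover: "{x. \<forall>k::int. 2 powi k * x \<notin> W} \<in> null_sets lebesgue"
proof -
  let ?N = "{x. \<forall>k::int. 2 powi k * x \<notin> W}"
  have "?N = - (\<Union>k::int. {x. 0 + 2 powi k * x \<in> W})" by auto
  also have "(\<Union>k::int. {x. 0 + 2 powi k * x \<in> W}) \<in> sets lebesgue"
    by (intro sets.countable_UN'' emeasure_affine_vimage(2) sets_W) auto
  then have "- (\<Union>k::int. {x. 0 + 2 powi k * x \<in> W}) \<in> sets lebesgue"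
    using sets.compl_sets[of _ lebesgue] by (simp add: Compl_eq_Diff_UNIV)
  finally have N: "?N \<in> sets lebesgue" .
  have "?N \<inter> {- real n..<real n} \<in> null_sets lebesgue" for n :: nat
  proof -
    have A: "?N \<inter> {- real n..<real n} \<in> lmeasurable" (is "?A \<in> _")
      using fmeasurable_Int_fmeasurable[OF lmeasurable_Ico N] by (simp add: Int_commute)
    have "L2_sqnorm (indicator ?A) = 0"
    proof (rule L2_sqnorm_zero_of_orthogonal[OF basis L2_indicator_set(1)[OF A]])
      fix i
      have "indicator ?A x * cnj (modes i x) = 0" for x
        by (cases i) (auto simp: dilated_modes_def wavelet_spectrum_def indicator_def)
      then show "L2_inner (indicator ?A) (modes i) = 0" by (rule L2_inner_eq_0)
    qed
    then show ?thesis using L2_indicator_set(2)[OF A] by (intro null_sets_of_measure_zero A) simp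
  qed
  then have "(\<Union>n::nat. ?N \<inter> {- real n..<real n}) \<in> null_sets lebesgue" by (intro null_sets_UN) auto
  also have "(\<Union>n::nat. ?N \<inter> {- real n..<real n}) = ?N"
  proof -
    have "\<exists>n::nat. - real n \<le> x \<and> x < real n" for x :: real
    proof -
      obtain n where "\<bar>x\<bar> < real n" using reals_Archimedean2 by blast
      then show ?thesis by (intro exI[of _ n]) linarith
    qed
    then show ?thesis by auto
  qed
  finally show ?thesis .
qed

text \<open>After removal of a null set \<open>W\<close> meets each class modulo \<open>2\<pi>\<close> at most once.  All Fourier coefficients
of its indicator vanish except the one of index 0, which is \<open>\<mu>(W)\<close>; Parseval's identity becomes
\<open>\<mu>(W)\<^sup>2 = 2\<pi> \<mu>(W)\<close>.  Hence the reduction of \<open>W\<close> has the full measure \<open>2\<pi>\<close> of a period.\<close>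

lemma translates_cover: "{x. \<forall>j::int. x + of_int j * (2*pi) \<notin> W} \<in> null_sets lebesgue"
proof -
  define D where "D = (\<Union>j\<in>UNIV - {0::int}. {x \<in> W. x + of_int j * (2*pi) \<in> W})"
  have D: "D \<in> null_sets lebesgue"
    unfolding D_def by (intro null_sets_UN' translates_disjoint) auto
  define V where "V = W - D"
  have V: "V \<in> lmeasurable"
    using D by (auto simp: V_def intro!: fmeasurable_Diff lmeasurable_W)
  have VW: "AE x in lebesgue. x \<in> V \<longleftrightarrow> x \<in> W"
    using AE_not_in[OF D] by eventually_elim (auto simp: V_def)
  have inj: "periodic_injective V"
    unfolding periodic_injective_def V_def D_def by blast
  have mV: "measure lebesgue V = measure lebesgue W"
    using VW V lmeasurable_W by (intro measure_eq_AE) (auto simp: fmeasurableD)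
  have VWk: "(\<integral>x. indicator V x * cis (of_int k * x) \<partial>lebesgue) = (\<integral>x. indicator W x * cis (of_int k * x) \<partial>lebesgue)" for k :: int
  proof (rule integral_cong_AE)
    show "AE x in lebesgue. indicator V x * cis (of_int k * x) = indicator W x * cis (of_int k * x)"
      using VW by eventually_elim (simp add: indicator_def)
  qed (intro borel_measurable_times borel_measurable_indicator borel_measurable_lebesgue_cis fmeasurableD V lmeasurable_W)+
  have "(\<integral>\<^sup>+k. ennreal ((cmod (\<integral>y. indicator V y * cis (of_int k * y) \<partial>lebesgue))\<^sup>2) \<partial>count_space (UNIV :: int set)) =
      ennreal (2 * pi * L2_sqnorm (indicator V))"
    by (rule parseval_periodic_injective[OF fmeasurableD[OF V] inj L2_indicator_set(1)[OF V]]) simp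
  also have "L2_sqnorm (indicator V) = measure lebesgue W" by (simp add: L2_indicator_set(2)[OF V] mV)
  also have "(\<integral>\<^sup>+k. ennreal ((cmod (\<integral>y. indicator V y * cis (of_int k * y) \<partial>lebesgue))\<^sup>2) \<partial>count_space (UNIV :: int set)) =
      (\<integral>\<^sup>+k. ennreal ((measure lebesgue W)\<^sup>2) * indicator {0} k \<partial>count_space (UNIV :: int set))"
  proof (rule nn_integral_cong)
    fix k :: int
    show "ennreal ((cmod (\<integral>y. indicator V y * cis (of_int k * y) \<partial>lebesgue))\<^sup>2) = ennreal ((measure lebesgue W)\<^sup>2) * indicator {0} k"
    proof (cases "k = 0")
      case True
      have "(\<integral>y. indicator W y \<partial>lebesgue) = (\<integral>y. complex_of_real (indicator W y) \<partial>lebesgue)"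
        by (intro Bochner_Integration.integral_cong) (auto simp: indicator_def)
      also have "\<dots> = of_real (measure lebesgue W)"
        unfolding integral_complex_of_real using sets_W by simp
      finally show ?thesis unfolding VWk using True by simp
    qed (simp add: VWk integral_cis_zero)
  qed
  also have "\<dots> = ennreal ((measure lebesgue W)\<^sup>2)" by (subst nn_integral_cmult_indicator) auto
  finally have "(measure lebesgue W)\<^sup>2 = 2 * pi * measure lebesgue W" by simp
  then have mW: "measure lebesgue W = 2 * pi" using measure_W_pos by (simp add: power2_eq_square)
  define G where "G = {0..<2*pi} - folded V"
  have fV: "folded V \<in> sets lebesgue" by (rule folded_sets[OF fmeasurableD[OF V]])
  have "emeasure lebesgue (folded V) = emeasure lebesgue V" by (rule emeasure_folded[OF fmeasurableD[OF V] inj])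
  also have "\<dots> = ennreal (2 * pi)" using V mV mW by (simp add: emeasure_eq_measure2 del: emeasure_completion)
  finally have "emeasure lebesgue (folded V) = ennreal (2 * pi)" .
  then have "emeasure lebesgue G = emeasure lebesgue {0..<2*pi} - ennreal (2*pi)"
    unfolding G_def using fV by (subst emeasure_Diff) (auto simp: folded_def simp del: emeasure_completion)
  also have "emeasure lebesgue {0..<2*pi} = ennreal (2*pi)" by simp
  finally have G: "G \<in> null_sets lebesgue" using fV by (auto simp: null_sets_def G_def simp del: emeasure_completion)
  have "(\<Union>n::int. {x. of_int n * (2*pi) + 1 * x \<in> G}) \<in> null_sets lebesgue"
    by (intro null_sets_UN null_sets_affine_vimage G) auto
  moreover have "{x. \<forall>j::int. x + of_int j * (2*pi) \<notin> W} \<subseteq> (\<Union>n::int. {x. of_int n * (2*pi) + 1 * x \<in> G})"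
  proof
    fix x assume x: "x \<in> {x. \<forall>j::int. x + of_int j * (2*pi) \<notin> W}"
    define n where "n = - \<lfloor>x / (2*pi)\<rfloor>"
    have "of_int n * (2*pi) + x \<in> {0..<2*pi}" using period_floor[of x] by (simp add: n_def)
    moreover have "of_int n * (2*pi) + x \<notin> folded V"
    proof
      assume "of_int n * (2*pi) + x \<in> folded V"
      then obtain j :: int where "of_int n * (2*pi) + x + of_int j * (2*pi) \<in> W" by (auto simp: folded_def V_def)
      then have "x + of_int (n + j) * (2*pi) \<in> W" by (simp add: algebra_simps)
      then show False using x by blast
    qed
    ultimately show "x \<in> (\<Union>n::int. {x. of_int n * (2*pi) + 1 * x \<in> G})" by (auto simp: G_def)
  qed
  ultimately show ?thesis unfolding negligible_iff_null_sets[symmetric] by (rule negligible_subset)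
qed

end

section \<open>The maps \<tau> and \<delta>\<close>

text \<open>Two points of \<open>E\<close> are less than \<open>4\<pi>\<close> apart, so \<open>n\<close> is \<open>-1\<close>, \<open>0\<close> or \<open>1\<close>, and a shift by \<open>2\<pi>\<close> moves either
half of \<open>E\<close> out of \<open>E\<close>.\<close>

lemma E_translate_unique:
  assumes "a \<in> E" "b \<in> E" "a = b + 2 * of_int n * pi"
  shows "n = 0"
proof -
  have bounds: "- (2 * pi) \<le> a" "a < 2 * pi" "- (2 * pi) \<le> b" "b < 2 * pi"
    using assms(1,2) pi_gt_zero by (auto simp: E_def)
  have "n < 2"
  proof (rule ccontr)
    assume "\<not> n < 2"
    then have "2 * pi \<le> of_int n * pi" by (intro mult_right_mono) auto
    then show False using assms(3) bounds by linarith
  qed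
  moreover have "- 2 < n"
  proof (rule ccontr)
    assume "\<not> - 2 < n"
    then have "of_int n * pi \<le> (- 2) * pi" by (intro mult_right_mono) auto
    then show False using assms(3) bounds by linarith
  qed
  moreover have "n \<noteq> 1" "n \<noteq> - 1" using assms by (auto simp: E_def)
  ultimately show ?thesis by linarith
qed

lemma tau_ex1: "\<exists>!j. x + 2 * of_int j * pi \<in> E"
proof (rule ex_ex1I)
  let ?n = "\<lfloor>x / (2*pi)\<rfloor>"
  have b: "of_int ?n * (2*pi) \<le> x" "x < of_int ?n * (2*pi) + 2*pi" using period_floor[of x] by auto
  show "\<exists>j. x + 2 * of_int j * pi \<in> E"
  proof (cases "of_int ?n * (2*pi) + pi \<le> x")
    case True
    then have "x + 2 * of_int (- ?n) * pi \<in> E" using b by (auto simp: E_def)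
    then show ?thesis by blast
  next
    case False
    then have "x + 2 * of_int (- ?n - 1) * pi \<in> E" using b by (auto simp: E_def algebra_simps)
    then show ?thesis by blast
  qed
next
  fix i j assume "x + 2 * of_int i * pi \<in> E" "x + 2 * of_int j * pi \<in> E"
  from E_translate_unique[OF this, of "i - j"] show "i = j" by (simp add: algebra_simps)
qed

lemma tau_eqI: "x + 2 * of_int j * pi \<in> E \<Longrightarrow> \<tau> x = x + 2 * of_int j * pi"
  unfolding \<tau>_def by (simp only: the1_equality[OF tau_ex1])

lemma tau_cases: obtains j where "\<tau> x = x + 2 * of_int j * pi" "x + 2 * of_int j * pi \<in> E"
  using ex1_implies_ex[OF tau_ex1[of x]] tau_eqI by blast

lemma tau_in_E: "\<tau> x \<in> E"
  using tau_cases[of x] by metis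

lemma tau_eq_iff: "\<tau> x = \<tau> y \<longleftrightarrow> (\<exists>n::int. y = x + 2 * of_int n * pi)"
proof
  obtain i where i: "\<tau> x = x + 2 * of_int i * pi" by (rule tau_cases)
  obtain j where j: "\<tau> y = y + 2 * of_int j * pi" by (rule tau_cases)
  assume "\<tau> x = \<tau> y"
  then have "y = x + 2 * of_int (i - j) * pi" using i j by (simp add: algebra_simps)
  then show "\<exists>n::int. y = x + 2 * of_int n * pi" by blast
next
  assume "\<exists>n::int. y = x + 2 * of_int n * pi"
  then obtain n :: int where n: "y = x + 2 * of_int n * pi" by blast
  obtain i where i: "\<tau> x = x + 2 * of_int i * pi" "x + 2 * of_int i * pi \<in> E" by (rule tau_cases)
  have "x + 2 * of_int i * pi = y + 2 * of_int (i - n) * pi" by (simp add: n algebra_simps)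
  then show "\<tau> x = \<tau> y" using i tau_eqI[of y "i - n"] by simp
qed

lemma E_dilate_unique_aux:
  assumes "a \<in> E" "b \<in> E" "a = 2 powi n * b"
  shows "n \<le> 0"
proof (rule ccontr)
  assume "\<not> n \<le> 0"
  then have "(2::real) powi 1 \<le> 2 powi n" by (intro power_int_increasing) auto
  then have two: "(2::real) \<le> 2 powi n" by simp
  show False
  proof (cases "0 < b")
    case True
    then have "2 * b \<le> a" using two assms(3) by simp
    then show False using assms(1,2) True by (auto simp: E_def)
  next
    case False
    then have "2 powi n * b \<le> 2 * b" using two by (intro mult_right_mono_neg) auto
    then have "a \<le> 2 * b" using assms(3) by simp
    then show False using assms(1,2) False by (auto simp: E_def)
  qed
qed

lemma E_dilate_unique:
  assumes "a \<in> E" "b \<in> E" "a = 2 powi n * b"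
  shows "n = 0"
proof -
  have "b = 2 powi (- n) * a" using assms(3) by simp
  then have "- n \<le> 0" using E_dilate_unique_aux[OF assms(2,1)] by blast
  then show ?thesis using E_dilate_unique_aux[OF assms] by simp
qed

lemma powi_two_eq_iff: "(2::real) powi i = 2 powi j \<longleftrightarrow> i = j"
  by (metis linorder_neq_iff order_less_irrefl power_int_strict_increasing one_less_numeral_iff semiring_norm(76))

lemma zero_notin_E: "0 \<notin> E"
  by (simp add: E_def not_le)

lemma delta_ex1:
  assumes "x \<noteq> 0" shows "\<exists>!k. 2 powi k * x \<in> E"
proof (rule ex_ex1I)
  have pw: "2 powr of_int n = (2::real) powi n" for n by (simp add: powr_real_of_int')
  show "\<exists>k. 2 powi k * x \<in> E"
  proof (cases "0 < x")
    case True
    define n where "n = \<lfloor>log 2 (x / pi)\<rfloor>"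
    have "2 powr of_int n \<le> 2 powr (log 2 (x / pi))" "2 powr (log 2 (x / pi)) < 2 powr (of_int (n + 1))"
      unfolding n_def by (auto simp: floor_correct)
    then have "2 powi n \<le> x / pi" "x / pi < 2 * 2 powi n"
      using True unfolding pw by (simp_all add: power_int_add)
    then have "2 powi n * pi \<le> x" "x < 2 * 2 powi n * pi"
      using pi_gt_zero by (simp_all add: pos_le_divide_eq pos_divide_less_eq)
    then have "2 powi (- n) * x \<in> E"
      by (auto simp: E_def power_int_minus field_simps)
    then show ?thesis by blast
  next
    case False
    define n where "n = \<lceil>log 2 (- x / pi)\<rceil> - 1"
    have "2 powr of_int n < 2 powr (log 2 (- x / pi))" "2 powr (log 2 (- x / pi)) \<le> 2 powr (of_int (n + 1))"
      unfolding n_def by (auto, linarith)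
    moreover have "0 < - x / pi" using False assms by (simp add: divide_less_0_iff not_less)
    ultimately have "2 powi n < - x / pi" "- x / pi \<le> 2 * 2 powi n"
      unfolding pw by (simp_all add: power_int_add)
    then have "2 powi n * pi < - x" "- x \<le> 2 * 2 powi n * pi"
      using pi_gt_zero pos_less_divide_eq[of pi "2 powi n" "- x"] pos_divide_le_eq[of pi "- x" "2 * 2 powi n"] by auto
    then have "2 powi (- n) * x \<in> E"
      by (auto simp: E_def power_int_minus field_simps)
    then show ?thesis by blast
  qed
next
  fix i j assume ij: "2 powi i * x \<in> E" "2 powi j * x \<in> E"
  have "2 powi i * x = 2 powi (i - j) * (2 powi j * x)"
    by (simp add: power_int_diff)
  from E_dilate_unique[OF ij this] show "i = j" by simp
qed

lemma delta_eqI: assumes "2 powi k * x \<in> E" shows "\<delta> x = 2 powi k * x"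
proof -
  have "x \<noteq> 0" using assms zero_notin_E by auto
  from the1_equality[OF delta_ex1[OF this] assms] show ?thesis by (simp add: \<delta>_def)
qed

lemma delta_cases: assumes "x \<noteq> 0" obtains k where "\<delta> x = 2 powi k * x" "2 powi k * x \<in> E"
  using ex1_implies_ex[OF delta_ex1[OF assms]] delta_eqI by blast

lemma delta_in_E: "x \<noteq> 0 \<Longrightarrow> \<delta> x \<in> E"
  using delta_cases[of x] by metis

lemma delta_dilate: assumes "e \<in> E" shows "\<delta> (2 powi k * e) = e"
  using delta_eqI[of "- k" "2 powi k * e"] assms by simp

lemma delta_eq_iff: assumes "x \<noteq> 0" "y \<noteq> 0" shows "\<delta> x = \<delta> y \<longleftrightarrow> (\<exists>n. y = 2 powi n * x)"
proof
  obtain i where i: "\<delta> x = 2 powi i * x" using delta_cases[OF assms(1)] by blast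
  obtain j where j: "\<delta> y = 2 powi j * y" using delta_cases[OF assms(2)] by blast
  assume "\<delta> x = \<delta> y"
  then have "y = 2 powi (i - j) * x" using i j by (simp add: power_int_diff field_simps)
  then show "\<exists>n. y = 2 powi n * x" by blast
next
  assume "\<exists>n. y = 2 powi n * x"
  then obtain n where n: "y = 2 powi n * x" by blast
  obtain i where i: "\<delta> x = 2 powi i * x" "2 powi i * x \<in> E" using delta_cases[OF assms(1)] by blast
  have "2 powi (i - n) * y = 2 powi i * x" by (simp add: n power_int_diff)
  then show "\<delta> x = \<delta> y" using i delta_eqI[of "i - n" y] by simp
qed

text \<open>The maps \<^const>\<open>\<tau>\<close>, \<^const>\<open>\<delta>\<close> and those of \<^const>\<open>dyadic_form\<close> are affine, up to fractional parts, on
countably many measurable pieces.\<close>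

lemma borel_measurable_pieces:
  fixes f :: "real \<Rightarrow> real" and P :: "'k::countable \<Rightarrow> real set"
  assumes P: "\<And>k. P k \<in> sets lebesgue" and cover: "S \<subseteq> (\<Union>k. P k)"
    and fg: "\<And>k x. x \<in> P k \<Longrightarrow> f x = g k x" and g: "\<And>k. g k \<in> borel_measurable lebesgue"
  shows "f \<in> borel_measurable (lebesgue_on S)"
proof (rule measurable_piecewise_restrict[where C="range P"])
  show "\<Omega> \<inter> space (lebesgue_on S) \<in> sets (lebesgue_on S)" if "\<Omega> \<in> range P" for \<Omega>
    using that P by (auto simp: sets_restrict_space Int_commute)
  show "f \<in> borel_measurable (restrict_space (lebesgue_on S) \<Omega>)" if \<Omega>: "\<Omega> \<in> range P" for \<Omega>
  proof -
    obtain k where k: "\<Omega> = P k" using \<Omega> by auto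
    have "g k \<in> borel_measurable (restrict_space (lebesgue_on S) \<Omega>)"
      by (intro measurable_restrict_space1 g)
    then show ?thesis
      by (subst measurable_cong[where g="g k"]) (auto simp: space_restrict_space k fg)
  qed
qed (use cover in auto)

lemma E_sets [simp]: "E \<in> sets lebesgue"
  by (simp add: E_def)

lemma tau_measurable: "\<tau> \<in> borel_measurable (lebesgue_on S)"
proof (rule borel_measurable_pieces[where P="\<lambda>j. {x. 2 * of_int j * pi + 1 * x \<in> E}" and g="\<lambda>j x. x + 2 * of_int j * pi"])
  show "{x. 2 * of_int j * pi + 1 * x \<in> E} \<in> sets lebesgue" for j
    by (rule emeasure_affine_vimage(2)) auto
  show "S \<subseteq> (\<Union>j. {x. 2 * of_int j * pi + 1 * x \<in> E})"
    using ex1_implies_ex[OF tau_ex1] by (auto simp: add.commute)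
  show "\<tau> x = x + 2 * of_int j * pi" if "x \<in> {x. 2 * of_int j * pi + 1 * x \<in> E}" for j x
    using that by (intro tau_eqI) (simp add: add.commute)
  show "(\<lambda>x. x + 2 * of_int j * pi) \<in> borel_measurable lebesgue" for j
    by (rule lebesgue_borel_measurable) measurable
qed

lemma delta_measurable: assumes "0 \<notin> S" shows "\<delta> \<in> borel_measurable (lebesgue_on S)"
proof (rule borel_measurable_pieces[where P="\<lambda>k. {x. 0 + 2 powi k * x \<in> E}" and g="\<lambda>k x. 2 powi k * x :: real"])
  show "{x. 0 + 2 powi k * x \<in> E} \<in> sets lebesgue" for k
    by (rule emeasure_affine_vimage(2)) auto
  show "S \<subseteq> (\<Union>k. {x. 0 + 2 powi k * x \<in> E})"
  proof
    fix x assume "x \<in> S"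
    then have "x \<noteq> 0" using assms by auto
    then show "x \<in> (\<Union>k. {x. 0 + 2 powi k * x \<in> E})" using ex1_implies_ex[OF delta_ex1] by auto
  qed
  show "\<delta> x = 2 powi k * x" if "x \<in> {x. 0 + 2 powi k * x \<in> E}" for k x
    using that by (intro delta_eqI) simp
  show "(\<lambda>x. 2 powi k * x :: real) \<in> borel_measurable lebesgue" for k :: int
    by (rule lebesgue_borel_measurable) measurable
qed

text \<open>The fibres of \<open>\<tau>\<close> are the classes modulo \<open>2\<pi>\<close> and those of \<open>\<delta>\<close> the dyadic orbits, so bijectivity onto \<open>E\<close>
says that each class and each orbit contains exactly one point of \<open>W\<close>.\<close>

lemma exact_tiling_iff:
  "exact_tiling W \<longleftrightarrow> 0 \<notin> W \<and> measurable_bij \<tau> W E \<and> measurable_bij \<delta> W E"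
proof
  assume L: "exact_tiling W"
  then have W: "W \<in> sets lebesgue" and W0: "0 \<notin> W"
    and trans: "\<And>x. \<exists>!j::int. x + of_int j * (2*pi) \<in> W"
    and dil: "\<And>x. x \<noteq> 0 \<Longrightarrow> \<exists>!k::int. 2 powi k * x \<in> W"
    by (auto simp: exact_tiling_def)
  have "bij_betw \<tau> W E"
  proof (rule bij_betw_imageI)
    show "inj_on \<tau> W"
    proof (rule inj_onI)
      fix x y assume xy: "x \<in> W" "y \<in> W" "\<tau> x = \<tau> y"
      then obtain n :: int where n: "y = x + 2 * of_int n * pi" by (auto simp: tau_eq_iff)
      have "x + of_int 0 * (2*pi) \<in> W" "x + of_int n * (2*pi) \<in> W" using xy n by (auto simp: mult_ac)
      then have "n = 0" using trans[of x] by blast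
      then show "x = y" using n by simp
    qed
    show "\<tau> ` W = E"
    proof (intro equalityI subsetI)
      fix e assume e: "e \<in> E"
      obtain j :: int where j: "e + of_int j * (2*pi) \<in> W" using ex1_implies_ex[OF trans] by blast
      have "\<tau> (e + of_int j * (2*pi)) = e"
        using tau_eqI[of "e + of_int j * (2*pi)" "- j"] e by (simp add: algebra_simps)
      then show "e \<in> \<tau> ` W" using j by (metis image_eqI)
    qed (auto intro: tau_in_E)
  qed
  moreover have "bij_betw \<delta> W E"
  proof (rule bij_betw_imageI)
    show "inj_on \<delta> W"
    proof (rule inj_onI)
      fix x y assume xy: "x \<in> W" "y \<in> W" "\<delta> x = \<delta> y"
      then have nz: "x \<noteq> 0" "y \<noteq> 0" using W0 by auto
      obtain n where n: "y = 2 powi n * x" using xy(3) delta_eq_iff[OF nz] by blast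
      have "2 powi 0 * x \<in> W" "2 powi n * x \<in> W" using xy n by auto
      then have "n = 0" using dil[OF nz(1)] by blast
      then show "x = y" using n by simp
    qed
    show "\<delta> ` W = E"
    proof (intro equalityI subsetI)
      fix e assume e: "e \<in> E"
      then have "e \<noteq> 0" using zero_notin_E by auto
      then obtain k :: int where k: "2 powi k * e \<in> W" using ex1_implies_ex[OF dil] by blast
      then show "e \<in> \<delta> ` W" using delta_dilate[OF e] by (metis image_eqI)
    next
      fix e assume "e \<in> \<delta> ` W"
      then show "e \<in> E" using W0 by (auto intro!: delta_in_E)
    qed
  qed
  ultimately show "0 \<notin> W \<and> measurable_bij \<tau> W E \<and> measurable_bij \<delta> W E"
    using W W0 by (simp add: measurable_bij_def tau_measurable delta_measurable)
next
  assume R: "0 \<notin> W \<and> measurable_bij \<tau> W E \<and> measurable_bij \<delta> W E"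
  then have W0: "0 \<notin> W" and W: "W \<in> sets lebesgue" and t: "bij_betw \<tau> W E" and d: "bij_betw \<delta> W E"
    by (auto simp: measurable_bij_def)
  have "\<exists>!j::int. x + of_int j * (2*pi) \<in> W" for x
  proof (rule ex_ex1I)
    obtain y where y: "y \<in> W" "\<tau> x = \<tau> y"
      using tau_in_E[of x] bij_betw_imp_surj_on[OF t] by (metis imageE)
    then obtain n :: int where "y = x + 2 * of_int n * pi" by (auto simp: tau_eq_iff)
    then have "x + of_int n * (2*pi) \<in> W" using y(1) by (simp add: mult_ac)
    then show "\<exists>j::int. x + of_int j * (2*pi) \<in> W" by blast
  next
    fix i j :: int assume ij: "x + of_int i * (2*pi) \<in> W" "x + of_int j * (2*pi) \<in> W"
    have "\<tau> x = \<tau> (x + of_int i * (2*pi))" "\<tau> x = \<tau> (x + of_int j * (2*pi))"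
      unfolding tau_eq_iff by (auto simp: mult_ac)
    then have "x + of_int i * (2*pi) = x + of_int j * (2*pi)"
      using inj_onD[OF bij_betw_imp_inj_on[OF t] _ ij] by simp
    then show "i = j" by simp
  qed
  moreover have "\<exists>!k::int. 2 powi k * x \<in> W" if x: "x \<noteq> 0" for x
  proof (rule ex_ex1I)
    obtain y where y: "y \<in> W" "\<delta> x = \<delta> y"
      using delta_in_E[OF x] bij_betw_imp_surj_on[OF d] by (metis imageE)
    then have "y \<noteq> 0" using W0 by auto
    then obtain n where "y = 2 powi n * x" using y(2) delta_eq_iff[OF x] by blast
    then show "\<exists>k::int. 2 powi k * x \<in> W" using y(1) by blast
  next
    fix i j :: int assume ij: "2 powi i * x \<in> W" "2 powi j * x \<in> W"
    have "\<delta> x = \<delta> (2 powi n * x)" for n using x by (subst delta_eq_iff) auto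
    then have "2 powi i * x = 2 powi j * x"
      using inj_onD[OF bij_betw_imp_inj_on[OF d] _ ij] by metis
    then show "i = j" using x by (simp add: powi_two_eq_iff)
  qed
  ultimately show "exact_tiling W" using W W0 by (simp add: exact_tiling_def)
qed

section \<open>Regularization\<close>

lemma ae_eq_subset_null:
  assumes "N \<in> null_sets lebesgue" "sym_diff A B \<subseteq> N" shows "ae_eq A B"
  unfolding ae_eq_def using assms unfolding negligible_iff_null_sets[symmetric] by (rule negligible_subset)

lemma ae_eq_sym: "ae_eq A B \<Longrightarrow> ae_eq B A"
  by (simp add: ae_eq_def Un_commute)

lemma ae_eq_trans: assumes "ae_eq A B" "ae_eq B C" shows "ae_eq A C"
  using null_sets.Un[OF assms[unfolded ae_eq_def]] by (rule ae_eq_subset_null) auto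

lemma exact_tiling_E: "exact_tiling E"
proof -
  have "\<tau> x = x" if "x \<in> E" for x using tau_eqI[of x 0] that by simp
  moreover have "\<delta> x = x" if "x \<in> E" for x using delta_eqI[of 0 x] that by simp
  ultimately show ?thesis
    unfolding exact_tiling_iff measurable_bij_def
    by (simp add: zero_notin_E tau_measurable delta_measurable bij_betw_def inj_on_def)
qed

text \<open>Outside the invariant null set \<open>Z\<close> the set \<open>W\<close> already tiles exactly, and inside \<open>Z\<close> the set \<open>E\<close> does.
As classes and orbits lie entirely inside or entirely outside \<open>Z\<close>, the two pieces combine to
an exact tiling.\<close>

theorem wavelet_set_regularized:
  assumes "wavelet_set W"
  shows "\<exists>W'. regularized_version W W'"
proof -
  interpret wavelet_set_in_frequency W
    using assms by unfold_locales (auto simp: wavelet_set_iff_basis)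
  \<comment> \<open>The points where \<open>W\<close> fails to tile.  The point 0 is added because it is a dyadic orbit of its own.\<close>
  define N where "N = {0} \<union> (\<Union>j\<in>UNIV - {0::int}. {x \<in> W. x + of_int j * (2*pi) \<in> W}) \<union>
    (\<Union>k\<in>UNIV - {0::int}. {x \<in> W. 2 powi k * x \<in> W}) \<union>
    {x. \<forall>j::int. x + of_int j * (2*pi) \<notin> W} \<union> {x. \<forall>k::int. 2 powi k * x \<notin> W}"
  have N: "N \<in> null_sets lebesgue"
    unfolding N_def
    by (intro null_sets.Un null_sets_UN' translates_disjoint dilates_disjoint translates_cover dilates_cover) auto
  \<comment> \<open>Rational parameters form a group of affine maps; integer powers of 2 and integer shifts alone do not.\<close>
  define Z where "Z = {x. \<exists>p\<in>\<rat> - {0}. \<exists>q\<in>\<rat>. 2*pi * q + p * x \<in> N}"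
  have Z: "Z \<in> null_sets lebesgue"
  proof -
    have "Z = (\<Union>p\<in>\<rat> - {0}. \<Union>q\<in>\<rat>. {x. 2*pi * q + p * x \<in> N})" by (auto simp: Z_def)
    also have "\<dots> \<in> null_sets lebesgue"
      by (intro null_sets_UN' null_sets_affine_vimage N) (auto simp: countable_rat)
    finally show ?thesis .
  qed
  have NZ: "x \<in> Z" if "x \<in> N" for x
    unfolding Z_def mem_Collect_eq by (rule bexI[of _ 1], rule bexI[of _ 0]) (use that in auto)
  have Zaff: "x \<in> Z" if "a * x + 2*pi * b \<in> Z" "a \<in> \<rat>" "a \<noteq> 0" "b \<in> \<rat>" for a b x
  proof -
    note in_Z = that(1)
    obtain p q where pq: "p \<in> \<rat>" "p \<noteq> 0" "q \<in> \<rat>" "2*pi * q + p * (a * x + 2*pi * b) \<in> N"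
      using in_Z unfolding Z_def by blast
    have "2*pi * (q + p * b) + (p * a) * x \<in> N" using pq(4) by (simp add: algebra_simps)
    moreover have "p * a \<in> \<rat> - {0}" "q + p * b \<in> \<rat>" using pq that by auto
    ultimately show ?thesis unfolding Z_def by blast
  qed
  have Zt: "x + of_int j * (2*pi) \<in> Z \<longleftrightarrow> x \<in> Z" for x and j :: int
  proof
    show "x \<in> Z" if "x + of_int j * (2*pi) \<in> Z"
      by (rule Zaff[of 1 _ "of_int j"]) (use that in \<open>auto simp: mult_ac\<close>)
    show "x + of_int j * (2*pi) \<in> Z" if "x \<in> Z"
      by (rule Zaff[of 1 _ "- of_int j"]) (use that in \<open>auto simp: mult_ac\<close>)
  qed
  have rat: "2 powi k \<in> (\<rat> :: real set)" for k :: int by (simp add: power_int_def)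
  have Zd: "2 powi k * x \<in> Z \<longleftrightarrow> x \<in> Z" for x and k :: int
  proof
    show "x \<in> Z" if "2 powi k * x \<in> Z"
      by (rule Zaff[of "2 powi k" _ 0]) (use that rat in auto)
    show "2 powi k * x \<in> Z" if "x \<in> Z"
      by (rule Zaff[of "2 powi (- k)" _ 0]) (use that rat in auto)
  qed
  define W' where "W' = (W - Z) \<union> (E \<inter> Z)"
  have E_trans: "\<exists>!j::int. x + of_int j * (2*pi) \<in> E" and E_dil: "x \<noteq> 0 \<Longrightarrow> \<exists>!k::int. 2 powi k * x \<in> E" for x
    using exact_tiling_E by (auto simp: exact_tiling_def)
  have "exact_tiling W'"
    unfolding exact_tiling_def
  proof (intro conjI allI impI)
    show "W' \<in> sets lebesgue" unfolding W'_def using Z sets_W by (intro sets.Un sets.Diff sets.Int) auto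
    have "0 \<in> Z" by (rule NZ) (simp add: N_def)
    then show "0 \<notin> W'" using zero_notin_E by (simp add: W'_def)
    show "\<exists>!j::int. x + of_int j * (2*pi) \<in> W'" for x
    proof (cases "x \<in> Z")
      case True
      then show ?thesis using E_trans[of x] by (simp add: W'_def Zt)
    next
      case False
      then have "x \<notin> N" using NZ by blast
      then have "\<exists>j::int. x + of_int j * (2*pi) \<in> W" by (auto simp: N_def)
      moreover have "i = j" if ij: "x + of_int i * (2*pi) \<in> W" "x + of_int j * (2*pi) \<in> W" for i j :: int
      proof (rule ccontr)
        assume "i \<noteq> j"
        have "x + of_int i * (2*pi) + of_int (j - i) * (2*pi) \<in> W" using ij(2) by (simp add: algebra_simps)
        moreover have "j - i \<in> UNIV - {0}" using \<open>i \<noteq> j\<close> by simp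
        ultimately have "x + of_int i * (2*pi) \<in> N" using ij(1) unfolding N_def by blast
        then show False using NZ Zt False by blast
      qed
      ultimately show ?thesis using False by (auto simp: W'_def Zt)
    qed
    show "\<exists>!k::int. 2 powi k * x \<in> W'" if x: "x \<noteq> 0" for x
    proof (cases "x \<in> Z")
      case True
      then show ?thesis using E_dil[OF x] by (simp add: W'_def Zd)
    next
      case False
      then have "x \<notin> N" using NZ by blast
      then have "\<exists>k::int. 2 powi k * x \<in> W" by (auto simp: N_def)
      moreover have "i = j" if ij: "2 powi i * x \<in> W" "2 powi j * x \<in> W" for i j :: int
      proof (rule ccontr)
        assume "i \<noteq> j"
        have "2 powi (j - i) * (2 powi i * x) \<in> W" using ij(2) by (simp add: power_int_diff)
        moreover have "j - i \<in> UNIV - {0}" using \<open>i \<noteq> j\<close> by simp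
        ultimately have "2 powi i * x \<in> N" using ij(1) unfolding N_def by blast
        then show False using NZ Zd False by blast
      qed
      ultimately show ?thesis using False by (auto simp: W'_def Zd)
    qed
  qed
  moreover have "ae_eq W' W"
    by (rule ae_eq_subset_null[OF Z]) (auto simp: W'_def)
  ultimately show ?thesis unfolding regularized_version_def exact_tiling_iff by blast
qed

section \<open>The induced map of the unit interval\<close>

text \<open>The inverse of \<^const>\<open>\<xi>\<close>.\<close>

definition \<eta> :: "real \<Rightarrow> real" where
  "\<eta> x = (if x < 1/2 then 2 * pi * (x - 1) else 2 * pi * x)"

lemma eta_in_E: assumes "x \<in> {0..<1}" shows "\<eta> x \<in> E"
proof -
  have "x < 1/2 \<Longrightarrow> 2 * pi * (x - 1) < 2 * pi * (-1/2)" "1/2 \<le> x \<Longrightarrow> 2 * pi * (1/2) \<le> 2 * pi * x"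
    "2 * pi * (-1) \<le> 2 * pi * (x - 1)" "2 * pi * x < 2 * pi * 1"
    using assms by (intro mult_strict_left_mono mult_left_mono; simp)+
  then show ?thesis by (auto simp: \<eta>_def E_def)
qed

lemma xi_eta: assumes "x \<in> {0..<1}" shows "\<xi> (\<eta> x) = x"
proof (cases "x < 1/2")
  case True
  have "2 * pi * (x - 1) < 0" using True by (intro mult_pos_neg) auto
  then show ?thesis using True pi_gt_zero by (auto simp: \<xi>_def \<eta>_def)
next
  case False
  have "2 * pi * (1/2) \<le> 2 * pi * x" "2 * pi * x < 2 * pi * 1"
    using assms False by (intro mult_strict_left_mono mult_left_mono; simp)+
  then show ?thesis using False by (auto simp: \<xi>_def \<eta>_def)
qed

lemma xi_in: assumes "e \<in> E" shows "\<xi> e \<in> {0..<1}"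
  using assms pi_gt_zero by (auto simp: E_def \<xi>_def field_simps)

lemma eta_xi: assumes "e \<in> E" shows "\<eta> (\<xi> e) = e"
  using assms pi_gt_zero by (auto simp: E_def \<xi>_def \<eta>_def field_simps)

lemma bij_xi: "bij_betw \<xi> E {0..<1}"
  by (rule bij_betw_byWitness[where f'="\<eta>"]) (use xi_in in \<open>auto simp: eta_xi xi_eta eta_in_E\<close>)

lemma bij_eta: "bij_betw \<eta> {0..<1} E"
  by (rule bij_betw_byWitness[where f'="\<xi>"]) (use xi_in in \<open>auto simp: eta_xi xi_eta eta_in_E\<close>)

lemma inv_into_xi: "x \<in> {0..<1} \<Longrightarrow> inv_into E \<xi> x = \<eta> x"
  by (rule inv_into_f_eq[OF bij_betw_imp_inj_on[OF bij_xi] eta_in_E xi_eta])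

text \<open>Both sides lie in \<open>[0, 1)\<close> and differ from \<open>y / (2\<pi>)\<close> by an integer.\<close>

lemma xi_tau: "\<xi> (\<tau> y) = frac (y / (2*pi))"
proof -
  obtain j where j: "\<tau> y = y + 2 * of_int j * pi" by (rule tau_cases)
  have "\<xi> (\<tau> y) - \<tau> y / (2*pi) \<in> \<int>" by (auto simp: \<xi>_def)
  moreover have "\<tau> y / (2*pi) = y / (2*pi) + of_int j" by (simp add: j field_simps)
  ultimately have "\<xi> (\<tau> y) - y / (2*pi) - of_int j \<in> \<int>" by (simp add: algebra_simps)
  then have "\<xi> (\<tau> y) - y / (2*pi) \<in> \<int>" by simp
  then have "y / (2*pi) - \<xi> (\<tau> y) \<in> \<int>" by (metis Ints_minus minus_diff_eq)
  then show ?thesis using xi_in[OF tau_in_E[of y]] by (metis atLeastLessThan_iff frac_unique_iff)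
qed

lemma frac_eta: "x \<in> {0..<1} \<Longrightarrow> frac (2 powi k * \<eta> x / (2*pi)) =
   (if x < 1/2 then frac (2 powi k * (x - 1)) else frac (2 powi k * x))"
  by (simp add: \<eta>_def)

lemma induced_map_eq:
  assumes W: "exact_tiling W" and x: "x \<in> {0..<1}" and k: "2 powi k * \<eta> x \<in> W"
  shows "inv_into W \<delta> (\<eta> x) = 2 powi k * \<eta> x"
    and "wavelet_induced_map W x = frac (2 powi k * \<eta> x / (2*pi))"
proof -
  have "inj_on \<delta> W" using W by (auto simp: exact_tiling_iff measurable_bij_def bij_betw_def)
  then show i: "inv_into W \<delta> (\<eta> x) = 2 powi k * \<eta> x"
    by (intro inv_into_f_eq k delta_dilate eta_in_E x)
  show "wavelet_induced_map W x = frac (2 powi k * \<eta> x / (2*pi))"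
    by (simp add: wavelet_induced_map_def wavelet_map_def inv_into_xi[OF x] i xi_tau)
qed

lemma bij_induced_map:
  assumes "exact_tiling W" shows "bij_betw (wavelet_induced_map W) {0..<1} {0..<1}"
proof -
  have t: "bij_betw \<tau> W E" and d: "bij_betw \<delta> W E"
    using assms by (auto simp: exact_tiling_iff measurable_bij_def)
  from bij_betw_trans[OF bij_betw_trans[OF bij_betw_trans[OF bij_betw_inv_into[OF bij_xi] bij_betw_inv_into[OF d]] t] bij_xi]
  show ?thesis by (simp add: wavelet_induced_map_def wavelet_map_def comp_assoc)
qed

text \<open>The pieces collect the points \<open>x\<close> with the same exponent \<open>k\<close>, where \<open>2\<^sup>k \<eta>(x)\<close> is the point of \<open>W\<close> in the
orbit of \<open>\<eta>(x)\<close>.\<close>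

lemma dyadic_form_induced_map:
  assumes W: "exact_tiling W" shows "dyadic_form (wavelet_induced_map W)"
proof -
  have Ws: "W \<in> sets lebesgue" and dil: "\<And>x. x \<noteq> 0 \<Longrightarrow> \<exists>!k::int. 2 powi k * x \<in> W"
    using W by (auto simp: exact_tiling_def)
  define A where "A k = {1/2..<1} \<inter> {x. 0 + (2 powi k * (2*pi)) * x \<in> W}" for k :: int
  define B where "B k = {0..<1/2} \<inter> {x. - (2 powi k * (2*pi)) + (2 powi k * (2*pi)) * x \<in> W}" for k :: int
  have A_eta: "x \<in> A k \<longleftrightarrow> x \<in> {1/2..<1} \<and> 2 powi k * \<eta> x \<in> W" for x k
    by (auto simp: A_def \<eta>_def mult_ac)
  have B_eta: "x \<in> B k \<longleftrightarrow> x \<in> {0..<1/2} \<and> 2 powi k * \<eta> x \<in> W" for x k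
    by (auto simp: B_def \<eta>_def algebra_simps)
  have ex1: "\<exists>!k::int. 2 powi k * \<eta> x \<in> W" if "x \<in> {0..<1}" for x
    using dil eta_in_E[OF that] zero_notin_E by metis
  have part: "measurable_partition P S"
    if P: "\<And>x k. x \<in> P k \<longleftrightarrow> x \<in> S \<and> 2 powi k * \<eta> x \<in> W" and S: "S \<subseteq> {0..<1}" and Pm: "\<And>k. P k \<in> sets lebesgue" for P S
    unfolding measurable_partition_def disjoint_family_on_def
  proof (intro conjI allI ballI impI Pm)
    fix i j :: int assume "i \<noteq> j"
    then show "P i \<inter> P j = {}" using ex1 P S by blast
  next
    show "(\<Union>k. P k) = S"
    proof (intro equalityI subsetI)
      fix x assume x: "x \<in> S"
      then have "x \<in> {0..<1}" using S by blast
      then obtain k where "2 powi k * \<eta> x \<in> W" using ex1_implies_ex[OF ex1] by blast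
      then have "x \<in> P k" using P x by simp
      then show "x \<in> (\<Union>k. P k)" by blast
    qed (auto simp: P)
  qed
  have "measurable_partition A {1/2..<1}"
  proof (rule part[OF A_eta])
    show "A k \<in> sets lebesgue" for k
      unfolding A_def by (intro sets.Int emeasure_affine_vimage(2) Ws) auto
  qed auto
  moreover have "measurable_partition B {0..<1/2}"
  proof (rule part[OF B_eta])
    show "B k \<in> sets lebesgue" for k
      unfolding B_def by (intro sets.Int emeasure_affine_vimage(2) Ws) auto
  qed auto
  moreover have "wavelet_induced_map W x = frac (2 powi k * x)" if "x \<in> A k" for x k
    using induced_map_eq(2)[OF W, of x k] that by (simp add: A_eta frac_eta)
  moreover have "wavelet_induced_map W x = frac (2 powi k * (x - 1))" if "x \<in> B k" for x k
    using induced_map_eq(2)[OF W, of x k] that by (simp add: B_eta frac_eta)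
  ultimately show ?thesis unfolding dyadic_form_def by blast
qed

lemma dyadic_form_measurable:
  assumes "dyadic_form h" shows "h \<in> borel_measurable (lebesgue_on {0..<1})"
proof -
  obtain A B where A: "measurable_partition A {1/2..<1}" and B: "measurable_partition B {0..<1/2}"
    and hA: "\<And>k x. x \<in> A k \<Longrightarrow> h x = frac (2 powi k * x)"
    and hB: "\<And>k x. x \<in> B k \<Longrightarrow> h x = frac (2 powi k * (x - 1))"
    using assms unfolding dyadic_form_def by blast
  define P where "P = (\<lambda>(b, k). if b then A k else B k)"
  define g where "g = (\<lambda>(b, k) x. if b then frac (2 powi k * x) else frac (2 powi k * (x - 1)) :: real)"
  show ?thesis
  proof (rule borel_measurable_pieces[where P=P and g=g])
    show "P i \<in> sets lebesgue" for i
      using A B by (cases i) (auto simp: P_def measurable_partition_def)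
    show "{0..<1} \<subseteq> (\<Union>i. P i)"
    proof
      fix x :: real assume "x \<in> {0..<1}"
      then consider "x \<in> (\<Union>k. A k)" | "x \<in> (\<Union>k. B k)"
        using A B unfolding measurable_partition_def by fastforce
      then show "x \<in> (\<Union>i. P i)"
      proof cases
        case 1
        then obtain k where "x \<in> P (True, k)" by (auto simp: P_def)
        then show ?thesis by blast
      next
        case 2
        then obtain k where "x \<in> P (False, k)" by (auto simp: P_def)
        then show ?thesis by blast
      qed
    qed
    show "h x = g i x" if "x \<in> P i" for i x
      using that hA hB by (cases i) (auto simp: P_def g_def split: if_splits)
    show "g i \<in> borel_measurable lebesgue" for i
    proof (cases i)
      case (Pair b k)
      have "(\<lambda>x. frac (2 powi k * x)) \<in> borel_measurable (borel :: real measure)"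
        "(\<lambda>x. frac (2 powi k * (x - 1))) \<in> borel_measurable (borel :: real measure)"
        unfolding frac_def by measurable
      then show ?thesis by (cases b) (auto simp: g_def Pair)
    qed
  qed
qed

theorem induced_map_properties:
  assumes "exact_tiling W"
  shows "measurable_bij (wavelet_induced_map W) {0..<1} {0..<1}" "dyadic_form (wavelet_induced_map W)"
  using assms by (auto simp: measurable_bij_def dyadic_form_induced_map bij_induced_map dyadic_form_measurable)

text \<open>With \<open>\<kappa>(x)\<close> the index of the piece that contains \<open>x\<close>, take \<open>W\<close> to be the set of all
\<open>\<omega>(x) = 2\<^sup>\<kappa>\<^sup>(\<^sup>x\<^sup>) \<eta>(x)\<close>.  Then \<open>\<delta> \<circ> \<omega> = \<eta>\<close> and \<open>\<tau> \<circ> \<omega> = \<eta> \<circ> h\<close> are bijections onto \<open>E\<close>.\<close>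

theorem dyadic_form_realized:
  assumes h: "measurable_bij h {0..<1} {0..<1}" "dyadic_form h"
  shows "\<exists>W. exact_tiling W \<and> (\<forall>x\<in>{0..<1}. h x = wavelet_induced_map W x)"
proof -
  obtain A B where A: "measurable_partition A {1/2..<1}" and B: "measurable_partition B {0..<1/2}"
    and hA: "\<And>k x. x \<in> A k \<Longrightarrow> h x = frac (2 powi k * x)"
    and hB: "\<And>k x. x \<in> B k \<Longrightarrow> h x = frac (2 powi k * (x - 1))"
    using h(2) unfolding dyadic_form_def by blast
  have Asub: "A k \<subseteq> {1/2..<1}" and Bsub: "B k \<subseteq> {0..<1/2}" for k
    using A B by (auto simp: measurable_partition_def)
  have "\<exists>k. x \<in> A k \<union> B k" if "x \<in> {0..<1}" for x
  proof (cases "x < 1/2")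
    case True
    then have "x \<in> (\<Union>k. B k)" using that B by (simp add: measurable_partition_def)
    then show ?thesis by blast
  next
    case False
    then have "x \<in> (\<Union>k. A k)" using that A by (simp add: measurable_partition_def)
    then show ?thesis by blast
  qed
  then obtain \<kappa> where \<kappa>: "\<And>x. x \<in> {0..<1} \<Longrightarrow> x \<in> A (\<kappa> x) \<union> B (\<kappa> x)" by metis
  have \<kappa>_unique: "k = \<kappa> x" if "x \<in> A k \<union> B k" for x k
  proof (cases "x < 1/2")
    case True
    then have "x \<in> B k" "x \<in> B (\<kappa> x)" using that \<kappa>[of x] Asub Bsub by fastforce+
    then show ?thesis using B unfolding measurable_partition_def disjoint_family_on_def by blast
  next
    case False
    then have "x \<in> A k" "x \<in> A (\<kappa> x)" using that \<kappa>[of x] Asub Bsub by fastforce+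
    then show ?thesis using A unfolding measurable_partition_def disjoint_family_on_def by blast
  qed
  define \<omega> where "\<omega> x = 2 powi \<kappa> x * \<eta> x" for x
  define W where "W = \<omega> ` {0..<1}"
  have h_frac: "h x = frac (\<omega> x / (2*pi))" if x: "x \<in> {0..<1}" for x
  proof (cases "x < 1/2")
    case True
    then have "x \<in> B (\<kappa> x)" using \<kappa>[OF x] Asub by fastforce
    then show ?thesis using hB frac_eta[OF x] True by (simp add: \<omega>_def)
  next
    case False
    then have "x \<in> A (\<kappa> x)" using \<kappa>[OF x] Bsub by fastforce
    then show ?thesis using hA frac_eta[OF x] False by (simp add: \<omega>_def)
  qed
  have \<delta>\<omega>: "\<delta> (\<omega> x) = \<eta> x" if "x \<in> {0..<1}" for x
    unfolding \<omega>_def by (rule delta_dilate[OF eta_in_E[OF that]])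
  have \<tau>\<omega>: "\<tau> (\<omega> x) = \<eta> (h x)" if "x \<in> {0..<1}" for x
  proof -
    have "\<xi> (\<tau> (\<omega> x)) = h x" by (simp add: xi_tau h_frac[OF that])
    then show ?thesis using eta_xi[OF tau_in_E[of "\<omega> x"]] by simp
  qed
  have Wm: "W \<in> sets lebesgue"
  proof -
    have pk: "inverse ((2::real) powi k * (2*pi)) \<noteq> 0" for k :: int by simp
    have W_eq: "W = (\<Union>k. {w. 0 + inverse (2 powi k * (2*pi)) * w \<in> A k}) \<union>
        (\<Union>k. {w. 1 + inverse (2 powi k * (2*pi)) * w \<in> B k})"
    proof (intro equalityI subsetI)
      fix w assume "w \<in> W"
      then obtain x where x: "x \<in> {0..<1}" "w = 2 powi \<kappa> x * \<eta> x" by (auto simp: W_def \<omega>_def)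
      show "w \<in> (\<Union>k. {w. 0 + inverse (2 powi k * (2*pi)) * w \<in> A k}) \<union>
        (\<Union>k. {w. 1 + inverse (2 powi k * (2*pi)) * w \<in> B k})"
      proof (cases "x < 1/2")
        case True
        then have "x \<in> B (\<kappa> x)" using \<kappa>[OF x(1)] Asub by fastforce
        moreover have "1 + inverse (2 powi \<kappa> x * (2*pi)) * w = x" using True by (simp add: x(2) \<eta>_def field_simps)
        ultimately have "1 + inverse (2 powi \<kappa> x * (2*pi)) * w \<in> B (\<kappa> x)" by (simp only:)
        then show ?thesis by blast
      next
        case False
        then have "x \<in> A (\<kappa> x)" using \<kappa>[OF x(1)] Bsub by fastforce
        moreover have "0 + inverse (2 powi \<kappa> x * (2*pi)) * w = x" using False by (simp add: x(2) \<eta>_def field_simps)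
        ultimately have "0 + inverse (2 powi \<kappa> x * (2*pi)) * w \<in> A (\<kappa> x)" by (simp only:)
        then show ?thesis by blast
      qed
    next
      fix w assume "w \<in> (\<Union>k. {w. 0 + inverse (2 powi k * (2*pi)) * w \<in> A k}) \<union>
        (\<Union>k. {w. 1 + inverse (2 powi k * (2*pi)) * w \<in> B k})"
      then consider k where "0 + inverse (2 powi k * (2*pi)) * w \<in> A k"
        | k where "1 + inverse (2 powi k * (2*pi)) * w \<in> B k" by blast
      then show "w \<in> W"
      proof cases
        case (1 k)
        define x where "x = inverse (2 powi k * (2*pi)) * w"
        have xA: "x \<in> A k" using 1 by (simp add: x_def)
        then have x: "x \<in> {1/2..<1}" using Asub by blast
        have "k = \<kappa> x" using xA by (intro \<kappa>_unique) auto
        moreover have "w = 2 powi k * \<eta> x" using x by (simp add: \<eta>_def x_def field_simps)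
        ultimately have "w = \<omega> x" by (simp add: \<omega>_def)
        then show ?thesis using x by (auto simp: W_def)
      next
        case (2 k)
        define x where "x = 1 + inverse (2 powi k * (2*pi)) * w"
        have xB: "x \<in> B k" using 2 by (simp add: x_def)
        then have x: "x \<in> {0..<1/2}" using Bsub by blast
        have "k = \<kappa> x" using xB by (intro \<kappa>_unique) auto
        moreover have "w = 2 powi k * (2 * pi * (x - 1))" by (simp add: x_def field_simps)
        then have "w = 2 powi k * \<eta> x" using x by (simp add: \<eta>_def)
        ultimately have "w = \<omega> x" by (simp add: \<omega>_def)
        then show ?thesis using x by (auto simp: W_def)
      qed
    qed
    show ?thesis unfolding W_eq
      using A B by (intro sets.Un sets.countable_UN'' emeasure_affine_vimage(2) pk) (auto simp: measurable_partition_def)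
  qed
  have W0: "0 \<notin> W"
  proof
    assume "0 \<in> W"
    then obtain x where "x \<in> {0..<1}" "\<eta> x = 0" by (auto simp: W_def \<omega>_def)
    then show False using eta_in_E zero_notin_E by metis
  qed
  have bij_via: "bij_betw f W E" if "bij_betw (\<lambda>x. f (\<omega> x)) {0..<1} E" for f
  proof (rule bij_betw_imageI)
    show "inj_on f W"
      unfolding W_def by (rule inj_on_imageI) (use bij_betw_imp_inj_on[OF that] in \<open>simp add: comp_def\<close>)
    show "f ` W = E"
      unfolding W_def image_image by (rule bij_betw_imp_surj_on[OF that])
  qed
  have "bij_betw \<delta> W E"
  proof (rule bij_via)
    have "bij_betw (\<lambda>x. \<delta> (\<omega> x)) {0..<1} E \<longleftrightarrow> bij_betw \<eta> {0..<1} E"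
      by (rule bij_betw_cong) (rule \<delta>\<omega>)
    then show "bij_betw (\<lambda>x. \<delta> (\<omega> x)) {0..<1} E" using bij_eta by (rule iffD2)
  qed
  moreover have "bij_betw \<tau> W E"
  proof (rule bij_via)
    have "bij_betw (\<eta> \<circ> h) {0..<1} E"
      using h(1) by (intro bij_betw_trans[OF _ bij_eta]) (auto simp: measurable_bij_def)
    moreover have "bij_betw (\<lambda>x. \<tau> (\<omega> x)) {0..<1} E \<longleftrightarrow> bij_betw (\<eta> \<circ> h) {0..<1} E"
      by (rule bij_betw_cong) (simp add: \<tau>\<omega>)
    ultimately show "bij_betw (\<lambda>x. \<tau> (\<omega> x)) {0..<1} E" by (rule rev_iffD2)
  qed
  ultimately have W: "exact_tiling W"
    by (simp add: exact_tiling_iff measurable_bij_def Wm W0 tau_measurable delta_measurable)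
  moreover have "h x = wavelet_induced_map W x" if x: "x \<in> {0..<1}" for x
  proof -
    have "2 powi \<kappa> x * \<eta> x \<in> W" using x by (auto simp: W_def \<omega>_def)
    from induced_map_eq(2)[OF W x this] show ?thesis by (simp add: h_frac[OF x] \<omega>_def)
  qed
  ultimately show ?thesis by blast
qed

section \<open>Intersections\<close>

text \<open>If the points \<open>w \<in> W1\<close> and \<open>w2 \<in> W2\<close> chosen from one orbit are congruent modulo \<open>2\<pi>\<close>, then
\<open>(2\<^sup>m - 1) w = 2\<pi>n\<close> for some integers \<open>m\<close> and \<open>n\<close>.  Unless \<open>m = 0\<close>, and hence \<open>w = w2\<close>, this confines \<open>w\<close> to the countable
set \<open>C\<close>.\<close>

theorem intersection_of_coincidence:
  assumes W1: "exact_tiling W1" and W2: "exact_tiling W2"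
    and \<Omega>: "\<Omega> = {x \<in> {0..<1}. wavelet_induced_map W1 x = wavelet_induced_map W2 x}"
  shows "ae_eq (W1 \<inter> W2) (inv_into W1 \<delta> ` inv_into E \<xi> ` \<Omega>)"
proof -
  define C where "C = range (\<lambda>(m::int, n::int). 2 * of_int n * pi / (2 powi m - 1))"
  have "countable C" unfolding C_def by auto
  then have C: "C \<in> null_sets lebesgue"
    using countable_imp_null_set_lborel null_sets_completionI by blast
  have dil: "\<exists>k::int. 2 powi k * \<eta> x \<in> W" if "exact_tiling W" "x \<in> {0..<1}" for W x
    using that eta_in_E[OF that(2)] zero_notin_E unfolding exact_tiling_def by metis
  let ?S = "inv_into W1 \<delta> ` inv_into E \<xi> ` \<Omega>"
  show ?thesis
  proof (rule ae_eq_subset_null[OF C])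
    have "w \<in> ?S" if w: "w \<in> W1" "w \<in> W2" for w
    proof -
      have "w \<noteq> 0" using w W1 by (auto simp: exact_tiling_def)
      then obtain k where k: "\<delta> w = 2 powi k * w" "2 powi k * w \<in> E" by (rule delta_cases)
      define x where "x = \<xi> (\<delta> w)"
      have x: "x \<in> {0..<1}" unfolding x_def using k by (intro xi_in) simp
      have "\<eta> x = \<delta> w" unfolding x_def using k by (intro eta_xi) simp
      then have w_eq: "2 powi (- k) * \<eta> x = w" by (simp add: k)
      have "x \<in> \<Omega>"
        using induced_map_eq(2)[OF W1 x, of "- k"] induced_map_eq(2)[OF W2 x, of "- k"] w x
        unfolding w_eq \<Omega> by simp
      moreover have "inv_into W1 \<delta> (inv_into E \<xi> x) = w"
        using induced_map_eq(1)[OF W1 x, of "- k"] w unfolding w_eq inv_into_xi[OF x] by simp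
      ultimately show ?thesis by (metis image_eqI)
    qed
    moreover have "w \<in> W1 \<inter> W2 \<or> w \<in> C" if w: "w \<in> ?S" for w
    proof -
      obtain x where x: "x \<in> \<Omega>" and w_inv: "w = inv_into W1 \<delta> (inv_into E \<xi> x)" using w by blast
      have x01: "x \<in> {0..<1}" and eq: "wavelet_induced_map W1 x = wavelet_induced_map W2 x" using x \<Omega> by auto
      obtain k where k: "2 powi k * \<eta> x \<in> W1" using dil[OF W1 x01] by blast
      obtain l where l: "2 powi l * \<eta> x \<in> W2" using dil[OF W2 x01] by blast
      define w2 where "w2 = 2 powi l * \<eta> x"
      have w1: "w = 2 powi k * \<eta> x"
        unfolding w_inv inv_into_xi[OF x01] by (rule induced_map_eq(1)[OF W1 x01 k])
      have "\<xi> (\<tau> w) = \<xi> (\<tau> w2)"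
        using eq unfolding induced_map_eq(2)[OF W1 x01 k] induced_map_eq(2)[OF W2 x01 l] xi_tau w1 w2_def .
      then have "\<tau> w = \<tau> w2"
        using inj_onD[OF bij_betw_imp_inj_on[OF bij_xi]] tau_in_E by blast
      then obtain n :: int where n: "w2 = w + 2 * of_int n * pi" by (auto simp: tau_eq_iff)
      have m: "w2 = 2 powi (l - k) * w" by (simp add: w2_def w1 power_int_diff)
      show ?thesis
      proof (cases "l = k")
        case True
        then show ?thesis using k l w1 by simp
      next
        case False
        then have "(2::real) powi (l - k) \<noteq> 2 powi 0" by (subst powi_two_eq_iff) auto
        moreover have "(2 powi (l - k) - 1) * w = 2 * of_int n * pi" using n m by (simp add: algebra_simps)
        ultimately have "w = 2 * of_int n * pi / (2 powi (l - k) - 1)" by (simp add: field_simps)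
        then show ?thesis unfolding C_def by (auto intro!: image_eqI[of _ _ "(l - k, n)"])
      qed
    qed
    ultimately show "sym_diff (W1 \<inter> W2) ?S \<subseteq> C" by blast
  qed
qed

lemma regularized_exact_tiling: "regularized_version W W' \<Longrightarrow> exact_tiling W'"
  by (simp add: regularized_version_def exact_tiling_iff)

lemma ae_eq_Int: assumes "ae_eq A A'" "ae_eq B B'" shows "ae_eq (A \<inter> B) (A' \<inter> B')"
  using null_sets.Un[OF assms[unfolded ae_eq_def]] by (rule ae_eq_subset_null) auto

theorem proposition2p3:
  shows "(\<forall>W. wavelet_set W \<longrightarrow>
            (\<exists>W'. regularized_version W W') \<and>
            (\<forall>W'. regularized_version W W' \<longrightarrow>
               measurable_bij (wavelet_induced_map W') {0 ..< 1} {0 ..< 1} \<and>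
               dyadic_form (wavelet_induced_map W'))) \<and>
         (\<forall>h. measurable_bij h {0 ..< 1} {0 ..< 1} \<and> dyadic_form h \<longrightarrow>
            (\<exists>W W'. wavelet_set W \<and> regularized_version W W' \<and>
               (\<forall>x\<in>{0 ..< 1}. h x = wavelet_induced_map W' x))) \<and>
         (\<forall>W1 W2 W1' W2' \<Omega>.
            wavelet_set W1 \<and> wavelet_set W2 \<and>
            regularized_version W1 W1' \<and> regularized_version W2 W2' \<and>
            \<Omega> = {x \<in> {0 ..< 1}. wavelet_induced_map W1' x = wavelet_induced_map W2' x} \<longrightarrow>
            ae_eq (W1 \<inter> W2) (inv_into W1' \<delta> ` inv_into E \<xi> ` \<Omega>) \<and>
            ae_eq (inv_into W1' \<delta> ` inv_into E \<xi> ` \<Omega>) (inv_into W2' \<delta> ` inv_into E \<xi> ` \<Omega>))"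
proof (intro conjI allI impI)
  fix W assume "wavelet_set W"
  then show "\<exists>W'. regularized_version W W'" by (rule wavelet_set_regularized)
next
  fix W W' assume "regularized_version W W'"
  then have "exact_tiling W'" by (rule regularized_exact_tiling)
  then show "measurable_bij (wavelet_induced_map W') {0 ..< 1} {0 ..< 1}" "dyadic_form (wavelet_induced_map W')"
    by (rule induced_map_properties)+
next
  fix h assume "measurable_bij h {0 ..< 1} {0 ..< 1} \<and> dyadic_form h"
  then obtain W where W: "exact_tiling W" and h: "\<forall>x\<in>{0 ..< 1}. h x = wavelet_induced_map W x"
    using dyadic_form_realized by blast
  have "ae_eq W W" by (simp add: ae_eq_def)
  then have "regularized_version W W" using W by (simp add: regularized_version_def exact_tiling_iff)
  then show "\<exists>W W'. wavelet_set W \<and> regularized_version W W' \<and> (\<forall>x\<in>{0 ..< 1}. h x = wavelet_induced_map W' x)"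
    using exact_tiling_wavelet_set[OF W] h by blast
next
  fix W1 W2 W1' W2' \<Omega>
  assume "wavelet_set W1 \<and> wavelet_set W2 \<and>
    regularized_version W1 W1' \<and> regularized_version W2 W2' \<and>
    \<Omega> = {x \<in> {0 ..< 1}. wavelet_induced_map W1' x = wavelet_induced_map W2' x}"
  then have r1: "regularized_version W1 W1'" and r2: "regularized_version W2 W2'"
    and \<Omega>: "\<Omega> = {x \<in> {0 ..< 1}. wavelet_induced_map W1' x = wavelet_induced_map W2' x}" by auto
  note t1 = regularized_exact_tiling[OF r1] and t2 = regularized_exact_tiling[OF r2]
  have \<Omega>': "\<Omega> = {x \<in> {0 ..< 1}. wavelet_induced_map W2' x = wavelet_induced_map W1' x}" using \<Omega> by auto
  have S1: "ae_eq (W1' \<inter> W2') (inv_into W1' \<delta> ` inv_into E \<xi> ` \<Omega>)"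
    by (rule intersection_of_coincidence[OF t1 t2 \<Omega>])
  have S2: "ae_eq (W1' \<inter> W2') (inv_into W2' \<delta> ` inv_into E \<xi> ` \<Omega>)"
    using intersection_of_coincidence[OF t2 t1 \<Omega>'] by (simp add: Int_commute)
  have "ae_eq (W1 \<inter> W2) (W1' \<inter> W2')"
    using r1 r2 unfolding regularized_version_def by (intro ae_eq_Int[OF ae_eq_sym ae_eq_sym]) blast+
  from ae_eq_trans[OF this S1] show "ae_eq (W1 \<inter> W2) (inv_into W1' \<delta> ` inv_into E \<xi> ` \<Omega>)" .
  from ae_eq_trans[OF ae_eq_sym[OF S1] S2]
  show "ae_eq (inv_into W1' \<delta> ` inv_into E \<xi> ` \<Omega>) (inv_into W2' \<delta> ` inv_into E \<xi> ` \<Omega>)" .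
qed

end
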